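(* Let $P$ be a branching program of length $T$ and width $W$ on Boolean inputs $x_1,\dots,x_n$, where Alice holds $x_1,\dots,x_{n/2}$ and Bob holds $x_{n/2+1},\dots,x_n$. For every $\epsilon>0$ there is a computationally efficient interactive (IP) communication protocol for checking whether $P$ accepts $x_1,\dots,x_n$, in which: (1) Merlin and Alice exchange $O(\log^2W\log^2T\cdot(\log\log W+\log\log T+\log\epsilon^{-1}))$ bits; (2) Alice tosses $O(\log^2W\log^2T\cdot(\log\log W+\log\log T+\log\epsilon^{-1}))$ public coins; (3) Bob sends $O(\log\log W+\log\log T+\log\epsilon^{-1})$ bits to Alice; (4) Alice accepts or rejects at the end. If $P$ accepts the input then (with Merlin behaving honestly) Alice always accepts; otherwise, whatever Merlin does, Alice rejects with probability at least $1-\epsilon$.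
   Context: A (nondeterministic) branching program of length $T$ and width $W$ on Boolean inputs $x_1,\dots,x_n$ is a layered directed graph with $T$ layers of $W$ nodes; all nodes of layer $i<T$ are labelled by one variable $x_{f(i)}$; edges go between consecutive layers and are marked $0$ or $1$; it accepts $x$ iff there is a path from the first node of layer $1$ to the first node of layer $T$ using only edges whose mark equals the value of the variable labelling their starting node. In an IP communication protocol, Alice and Bob each hold part of the input, an untrusted prover Merlin knows the whole input, and Alice's public coin tosses are visible to Merlin and Bob. *)

theory Defs
  imports "HOL-Probability.Probability_Mass_Function"
begin

type_synonym bits = "bool list"

section \<open>Branching programs\<close>

text \<open>
  Layers, nodes and variables are numbered from 0.  An edge \<open>(i, u, b, v)\<close> leads from node \<open>u\<close> of
  layer \<open>i\<close> to node \<open>v\<close> of layer \<open>i + 1\<close> and carries the mark \<open>b\<close>.  Several edges may leave a node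
  with the same mark, so the programs are nondeterministic.
\<close>

record branching_program =
  bp_vars :: nat
  bp_length :: nat
  bp_width :: nat
  bp_label :: "nat \<Rightarrow> nat"
  bp_edges :: "(nat \<times> nat \<times> bool \<times> nat) set"

definition wf_bp :: "branching_program \<Rightarrow> bool" where
  "wf_bp P \<longleftrightarrow>
     1 \<le> bp_length P \<and> 1 \<le> bp_width P \<and>
     (\<forall>i. Suc i < bp_length P \<longrightarrow> bp_label P i < bp_vars P) \<and>
     (\<forall>(i, u, b, v) \<in> bp_edges P. Suc i < bp_length P \<and> u < bp_width P \<and> v < bp_width P)"

definition bp_accepts :: "branching_program \<Rightarrow> bits \<Rightarrow> bool" where
  "bp_accepts P x \<longleftrightarrow>
     (\<exists>p. length p = bp_length P \<and> p ! 0 = 0 \<and> p ! (bp_length P - 1) = 0 \<and>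
        (\<forall>i. Suc i < bp_length P \<longrightarrow> (i, p ! i, x ! bp_label P i, p ! Suc i) \<in> bp_edges P))"

definition alice_part :: "branching_program \<Rightarrow> bits \<Rightarrow> bits" where
  "alice_part P x = take (bp_vars P div 2) x"

definition bob_part :: "branching_program \<Rightarrow> bits \<Rightarrow> bits" where
  "bob_part P x = drop (bp_vars P div 2) x"


section \<open>IP communication protocols\<close>

text \<open>
  In each round Alice tosses fresh public coins, sends Merlin a message, and Merlin replies.  A
  transcript lists the triples (coins, message of Alice, reply of Merlin) of the rounds played so
  far.  A strategy for Merlin maps the transcript of the earlier rounds together with the coins and
  Alice's message of the current round to his reply; he does not see coins of later rounds.
\<close>

type_synonym transcript = "(bits \<times> bits \<times> bits) list"
type_synonym strategy = "transcript \<Rightarrow> bits \<Rightarrow> bits \<Rightarrow> bits"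

text \<open>
  The schedule gives, for each round, the number of coins tossed and the number of bits Alice reads
  from Merlin.  Alice's message depends on her own input, the transcript of the earlier rounds and
  the fresh coins.  After the last round Bob, who has seen all the coins but not the messages
  between Alice and Merlin, sends one message to Alice, who then decides.  The component
  \<open>ip_merlin\<close> is the honest strategy; it depends on the whole input.
\<close>

record ip_protocol =
  ip_schedule :: "(nat \<times> nat) list"
  ip_alice :: "bits \<Rightarrow> transcript \<Rightarrow> bits \<Rightarrow> bits"
  ip_bob :: "bits \<Rightarrow> bits list \<Rightarrow> bits"
  ip_verdict :: "bits \<Rightarrow> transcript \<Rightarrow> bits \<Rightarrow> bool"
  ip_merlin :: "bits \<Rightarrow> strategy"

definition coin_space :: "ip_protocol \<Rightarrow> bits list set" where
  "coin_space \<pi> = {cs. map length cs = map fst (ip_schedule \<pi>)}"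

definition coin_count :: "ip_protocol \<Rightarrow> nat" where
  "coin_count \<pi> = sum_list (map fst (ip_schedule \<pi>))"

definition strategies :: "ip_protocol \<Rightarrow> strategy set" where
  "strategies \<pi> = {m. \<forall>tr c a. length tr < length (ip_schedule \<pi>) \<longrightarrow>
     length (m tr c a) = snd (ip_schedule \<pi> ! length tr)}"

definition play :: "ip_protocol \<Rightarrow> bits \<Rightarrow> strategy \<Rightarrow> bits list \<Rightarrow> transcript" where
  "play \<pi> xa m cs =
     foldl (\<lambda>tr c. let a = ip_alice \<pi> xa tr c in tr @ [(c, a, m tr c a)]) [] cs"

definition exchanged_bits :: "transcript \<Rightarrow> nat" where
  "exchanged_bits tr = (\<Sum>(c, a, w) \<leftarrow> tr. length a + length w)"

definition alice_accepts :: "ip_protocol \<Rightarrow> bits \<Rightarrow> bits \<Rightarrow> strategy \<Rightarrow> bits list \<Rightarrow> bool" where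
  "alice_accepts \<pi> xa xb m cs \<longleftrightarrow> ip_verdict \<pi> xa (play \<pi> xa m cs) (ip_bob \<pi> xb cs)"


section \<open>Polynomial time\<close>

text \<open>
  The machine model is the WHILE language of N. D. Jones (Computability and Complexity from a
  Programming Perspective): imperative programs on binary trees in which every elementary
  operation costs one unit of time.  Trees can be stored with sharing, and there is no equality
  test other than against the atom, so polynomial time in this model coincides with polynomial
  time on Turing machines.
\<close>

datatype sexp = Atom | Dot sexp sexp

datatype expr = EAtom | EVar nat | EDot expr expr | EHd expr | ETl expr

datatype com =
    Skip
  | Assign nat expr
  | Seq com com
  | If expr com com
  | While expr com

type_synonym store = "nat \<Rightarrow> sexp"

fun eval :: "expr \<Rightarrow> store \<Rightarrow> sexp" where
  "eval EAtom s = Atom"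
| "eval (EVar v) s = s v"
| "eval (EDot d e) s = Dot (eval d s) (eval e s)"
| "eval (EHd e) s = (case eval e s of Atom \<Rightarrow> Atom | Dot a b \<Rightarrow> a)"
| "eval (ETl e) s = (case eval e s of Atom \<Rightarrow> Atom | Dot a b \<Rightarrow> b)"

fun cost :: "expr \<Rightarrow> nat" where
  "cost EAtom = 1"
| "cost (EVar v) = 1"
| "cost (EDot d e) = cost d + cost e + 1"
| "cost (EHd e) = cost e + 1"
| "cost (ETl e) = cost e + 1"

text \<open>\<open>exec c s t s'\<close>: started in \<open>s\<close>, the command \<open>c\<close> terminates in \<open>s'\<close> after \<open>t\<close> steps.\<close>

inductive exec :: "com \<Rightarrow> store \<Rightarrow> nat \<Rightarrow> store \<Rightarrow> bool" where
  "exec Skip s 1 s"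
| "exec (Assign v e) s (cost e + 1) (s(v := eval e s))"
| "exec c s t s' \<Longrightarrow> exec d s' t' s'' \<Longrightarrow> exec (Seq c d) s (t + t') s''"
| "eval e s \<noteq> Atom \<Longrightarrow> exec c s t s' \<Longrightarrow> exec (If e c d) s (cost e + t + 1) s'"
| "eval e s = Atom \<Longrightarrow> exec d s t s' \<Longrightarrow> exec (If e c d) s (cost e + t + 1) s'"
| "eval e s = Atom \<Longrightarrow> exec (While e c) s (cost e + 1) s"
| "eval e s \<noteq> Atom \<Longrightarrow> exec c s t s' \<Longrightarrow> exec (While e c) s' t' s'' \<Longrightarrow>
     exec (While e c) s (cost e + t + t' + 1) s''"

text \<open>Variable 0 holds the input and the output; the other variables start with the atom.\<close>

definition runs :: "com \<Rightarrow> sexp \<Rightarrow> nat \<Rightarrow> sexp \<Rightarrow> bool" where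
  "runs c inp t out \<longleftrightarrow> (\<exists>s. exec c ((\<lambda>_. Atom)(0 := inp)) t s \<and> s 0 = out)"

text \<open>
  A set of pairs (input, output) is polynomial-time computable if one single program produces
  every output from its input within a number of steps polynomial in the size of the input.
\<close>

definition poly_time :: "(sexp \<times> sexp) set \<Rightarrow> bool" where
  "poly_time R \<longleftrightarrow>
     (\<exists>c d. \<forall>(inp, out) \<in> R. \<exists>t. t \<le> d * (size inp + 1) ^ d \<and> runs c inp t out)"


section \<open>Encodings\<close>

definition code_bool :: "bool \<Rightarrow> sexp" where
  "code_bool b = (if b then Dot Atom Atom else Atom)"

definition code_list :: "('a \<Rightarrow> sexp) \<Rightarrow> 'a list \<Rightarrow> sexp" where
  "code_list f xs = foldr (\<lambda>x. Dot (f x)) xs Atom"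

text \<open>Numbers are in unary.\<close>

definition code_nat :: "nat \<Rightarrow> sexp" where
  "code_nat n = (Dot Atom ^^ n) Atom"

abbreviation code_bits :: "bits \<Rightarrow> sexp" where
  "code_bits \<equiv> code_list code_bool"

definition code_transcript :: "transcript \<Rightarrow> sexp" where
  "code_transcript =
     code_list (\<lambda>(c, a, w). Dot (code_bits c) (Dot (code_bits a) (code_bits w)))"

definition code_schedule :: "(nat \<times> nat) list \<Rightarrow> sexp" where
  "code_schedule = code_list (\<lambda>(k, l). Dot (code_nat k) (code_nat l))"

text \<open>
  A program is given by its parameters and, for each layer but the last, the label of the layer and
  a table that tells for all \<open>u\<close> and \<open>v\<close> whether there are edges with mark 0 and with mark 1.
\<close>

definition code_bp :: "branching_program \<Rightarrow> sexp" where
  "code_bp P =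
     Dot (code_nat (bp_vars P)) (Dot (code_nat (bp_length P)) (Dot (code_nat (bp_width P))
       (code_list (\<lambda>i. Dot (code_nat (bp_label P i))
          (code_list (\<lambda>u. code_list (\<lambda>v.
              Dot (code_bool ((i, u, False, v) \<in> bp_edges P))
                  (code_bool ((i, u, True, v) \<in> bp_edges P)))
            [0..<bp_width P]) [0..<bp_width P]))
        [0..<bp_length P - 1])))"

text \<open>
  The real number \<open>\<epsilon>\<close> is given to the parties as the unary number \<open>\<lceil>log 2 (1/\<epsilon>)\<rceil>\<close>, so polynomial time
  means polynomial in the size of the branching program and in \<open>log (1/\<epsilon>)\<close>.
\<close>

definition code_instance :: "branching_program \<Rightarrow> real \<Rightarrow> sexp" where
  "code_instance P \<epsilon> = Dot (code_bp P) (code_nat (nat \<lceil>log 2 (1 / \<epsilon>)\<rceil>))"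


section \<open>Computationally efficient protocols\<close>

text \<open>
  A family of protocols, one for each branching program and each error bound, is efficient if
  everything that Alice and Bob do is computable in uniform polynomial time.  Merlin is unbounded.
\<close>

definition efficient :: "(branching_program \<Rightarrow> real \<Rightarrow> ip_protocol) \<Rightarrow> bool" where
  "efficient F \<longleftrightarrow>
     poly_time {(code_instance P \<epsilon>, code_schedule (ip_schedule (F P \<epsilon>))) | P \<epsilon>.
        wf_bp P \<and> \<epsilon> > 0} \<and>
     poly_time {(Dot (code_instance P \<epsilon>)
                   (Dot (code_bits xa) (Dot (code_transcript tr) (code_bits c))),
                 code_bits (ip_alice (F P \<epsilon>) xa tr c)) | P \<epsilon> xa tr c.
        wf_bp P \<and> \<epsilon> > 0 \<and> length xa = bp_vars P div 2} \<and>
     poly_time {(Dot (code_instance P \<epsilon>)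
                   (Dot (code_bits xa) (Dot (code_transcript tr) (code_bits w))),
                 code_bool (ip_verdict (F P \<epsilon>) xa tr w)) | P \<epsilon> xa tr w.
        wf_bp P \<and> \<epsilon> > 0 \<and> length xa = bp_vars P div 2} \<and>
     poly_time {(Dot (code_instance P \<epsilon>) (Dot (code_bits xb) (code_list code_bits cs)),
                 code_bits (ip_bob (F P \<epsilon>) xb cs)) | P \<epsilon> xb cs.
        wf_bp P \<and> \<epsilon> > 0 \<and> length xb = bp_vars P - bp_vars P div 2}"


section \<open>The complexity bounds\<close>

text \<open>
  The logarithms are cut off below at 1, so that the bounds also make sense for \<open>W = 1\<close>, \<open>T = 1\<close> and
  \<open>\<epsilon> \<ge> 1\<close>.  For \<open>W \<ge> 4\<close>, \<open>T \<ge> 4\<close> and \<open>\<epsilon> \<le> 1/2\<close> they are the ordinary logarithms.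
\<close>

definition lg :: "real \<Rightarrow> real" where
  "lg z = max 1 (log 2 z)"

definition bob_bound :: "real \<Rightarrow> real \<Rightarrow> real \<Rightarrow> real" where
  "bob_bound W T \<epsilon> = lg (lg W) + lg (lg T) + lg (1 / \<epsilon>)"

definition alice_bound :: "real \<Rightarrow> real \<Rightarrow> real \<Rightarrow> real" where
  "alice_bound W T \<epsilon> = (lg W)\<^sup>2 * (lg T)\<^sup>2 * bob_bound W T \<epsilon>"

end

theory Submission
  imports Defs "HOL-Computational_Algebra.Primes" "HOL-Number_Theory.Cong" "HOL-Library.More_List"
    "HOL-Library.Log_Nat"
begin

text \<open>
  Savitch's recursion writes acceptance as a quantified formula over the bits of the layer index and
  of the nodes: \<open>reach\<^sub>k\<^sub>+\<^sub>1(s, t)\<close> holds iff there is a midpoint \<open>w\<close> such that for both values of the next index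
  bit \<open>b\<close> the half selected by \<open>b\<close> leads from \<open>b ? w : s\<close> to \<open>b ? t : w\<close>.  The formula is evaluated by
  Shamir's protocol in Shen's form: quantifiers and multiplexers become operators on polynomials,
  each followed by a linearization of every variable, so every univariate restriction is quadratic
  and is sent as three field elements.  The innermost polynomial is the multilinear extension of the
  table of edges; it is the sum of a part known to Alice and a part known to Bob, and Bob only has to
  send the value of his part at a point that depends on the coins alone.

  There are \<open>N = O(log\<^sup>2 W log\<^sup>2 T)\<close> operators.  To find the field in polynomial time, it is taken to be a
  prime field of size polynomial in \<open>N\<close>, which gives error at most \<open>2\<^sup>-\<^sup>h\<close> with \<open>h = O(log N)\<close>, and the
  protocol is repeated about \<open>log (1/\<epsilon>) / h\<close> times in sequence; the costs then add up to
  \<open>O(h + log (1/\<epsilon>))\<close> bits per operator.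
\<close>

text \<open>All arithmetic is on unary numbers, so field elements must be polynomially small. Trial
  division then finds the prime, and a weak existence theorem for primes is enough. With
  \<open>2 * N < 2 ^ h\<close> the prime is taken between \<open>2 ^ (2 * h)\<close> and
  \<open>2 ^ (5 * h)\<close>: \<open>2 * h\<close> coins name distinct points, so a run errs with
  probability at most \<open>2 * N / 2 ^ (2 * h)\<close>, and \<open>5 * h\<close> bits hold a field
  element.

  The multiplexers let both halves of a path share one recursive occurrence; two separate
  occurrences would double the formula at every level.

  No field type is used. Polynomials are functions on lists of integers whose degrees are
  established over the integers; the prime enters only through congruences between claims, points
  and values.

  Merlin may adapt to earlier repetitions. The error still multiplies, because each repetition
  restarts from the claim 1 at the point 0 and its bound is uniform in the preceding
  transcript.\<close>

section \<open>Primes in short intervals\<close>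

text \<open>The integrality of the Leibniz harmonic triangle scaled by a common multiple of the denominators.\<close>

lemma times_binomial_dvd:
  fixes d n k :: nat
  assumes "1 \<le> k" "k \<le> n" "\<And>i. 1 \<le> i \<Longrightarrow> i \<le> n \<Longrightarrow> i dvd d"
  shows "k * (n choose k) dvd d"
  using assms
proof (induction k arbitrary: n)
  case (Suc k)
  show ?case
  proof (cases "k = 0")
    case True
    then show ?thesis using Suc.prems by auto
  next
    case False
    define a b c where "a = k * ((n - 1) choose k)" and "b = k * (n choose k)" and "c = Suc k * (n choose Suc k)"
    have "a dvd d" unfolding a_def by (rule Suc.IH) (use Suc.prems False in auto)
    then obtain x where x: "d = a * x" by (rule dvdE)
    have "b dvd d" unfolding b_def by (rule Suc.IH) (use Suc.prems False in auto)
    then obtain y where y: "d = b * y" by (rule dvdE)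
    obtain n' where n': "n = Suc n'" using Suc.prems by (cases n) auto
    have pos: "a > 0" "b > 0" "c > 0" using Suc.prems False n' by (auto simp: a_def b_def c_def)
    have 1: "(n - k) * (n choose k) = Suc k * (n choose Suc k)"
      by (simp only: binomial_absorb_comp binomial_absorption)
    have 2: "(n - k) * (n choose k) = n * ((n - 1) choose k)"
      by (rule binomial_absorb_comp)
    have c1: "c = (n - k) * (n choose k)" using 1 c_def by simp
    \<comment> \<open>In terms of reciprocals this is the rule of the Leibniz triangle,
      \<open>1/a = 1/b + 1/c\<close>: an entry is the sum of the two below it.\<close>
    have key: "b * c = a * (b + c)"
    proof -
      have "b + c = n * (n choose k)"
        unfolding b_def c1 using Suc.prems by (simp add: add_mult_distrib[symmetric])
      then have "a * (b + c) = k * (n choose k) * (n * ((n - 1) choose k))" by (simp add: a_def)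
      also have "\<dots> = b * c" unfolding b_def c1 2 ..
      finally show ?thesis ..
    qed
    text \<open>Hence \<open>1/c = 1/a - 1/b\<close>.\<close>
    have "int d = int c * (int x - int y)"
    proof -
      have "int a * int b * int d = int a * int b * (int c * (int x - int y))"
      proof -
        have e: "int b * int c = int a * (int b + int c)" using key by (metis of_nat_add of_nat_mult)
        have "int a * int b * (int c * (int x - int y)) = int b * int c * (int a * int x) - int a * int c * (int b * int y)"
          by (simp add: algebra_simps)
        also have "\<dots> = (int b * int c - int a * int c) * int d"
          unfolding x[THEN arg_cong[of _ _ int], unfolded of_nat_mult, symmetric]
            y[THEN arg_cong[of _ _ int], unfolded of_nat_mult, symmetric] by (simp only: left_diff_distrib)
        also have "\<dots> = int a * int b * int d" using e by (simp add: algebra_simps)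
        finally show ?thesis ..
      qed
      then show ?thesis using pos by simp
    qed
    then have "int c dvd int d" by (metis dvd_triv_left)
    then show ?thesis unfolding c_def by (simp only: of_nat_dvd_iff)
  qed
qed simp

text \<open>The quadratic upper end lets a trivial count suffice: with at most \<open>n\<close>
  primes up to \<open>n\<close>, their powers multiply to at most \<open>(2 * m) ^ n\<close>, far
  below \<open>4 ^ m\<close> for \<open>m = n\<^sup>2\<close>. The search for a field only needs
  some polynomial upper end.\<close>

lemma ex_prime_between:
  fixes n :: nat
  assumes n: "n \<ge> 64"
  shows "\<exists>p. prime p \<and> n < p \<and> p \<le> 2 * n\<^sup>2"
proof (rule ccontr)
  assume no: "\<nexists>p. prime p \<and> n < p \<and> p \<le> 2 * n\<^sup>2"
  text \<open>Then every \<open>i \<le> 2m\<close> divides a product \<open>d\<close> of at most \<open>n\<close> prime powers, each of them at most \<open>2m\<close>,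
    and so does \<open>m (2m choose m)\<close>, which is too large for that.\<close>
  define m where "m = n\<^sup>2"
  define S where "S = {p. prime p \<and> p \<le> n}"
  have m: "m > 0" using n by (simp add: m_def)
  have finS: "finite S" unfolding S_def by (rule finite_subset[of _ "{..n}"]) auto
  define pw where "pw p = Max {k. p ^ k \<le> 2 * m}" for p :: nat
  have pw: "p ^ pw p \<le> 2 * m" "p ^ k \<le> 2 * m \<Longrightarrow> k \<le> pw p" if "prime p" for p k
  proof -
    have "finite {k. p ^ k \<le> 2 * m}"
    proof (rule finite_subset[of _ "{..2*m}"])
      show "{k. p ^ k \<le> 2 * m} \<subseteq> {..2 * m}"
      proof
        fix k assume "k \<in> {k. p ^ k \<le> 2 * m}"
        moreover have "k < 2 ^ k" by (rule less_exp)
        moreover have "2 ^ k \<le> p ^ k" using prime_ge_2_nat[OF that] by (intro power_mono) auto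
        ultimately have "k \<le> 2 * m" by (meson mem_Collect_eq order_trans less_imp_le)
        then show "k \<in> {..2 * m}" by simp
      qed
    qed simp
    moreover have "{k. p ^ k \<le> 2 * m} \<noteq> {}" using m by (auto intro!: exI[of _ 0])
    ultimately show "p ^ pw p \<le> 2 * m" "p ^ k \<le> 2 * m \<Longrightarrow> k \<le> pw p"
      using Max_in[of "{k. p ^ k \<le> 2 * m}"] Max_ge[of "{k. p ^ k \<le> 2 * m}" k] by (auto simp: pw_def)
  qed
  define d where "d = (\<Prod>p\<in>S. p ^ pw p)"
  have dvd: "i dvd d" if "1 \<le> i" "i \<le> 2 * m" for i
  proof -
    have "prime_factors i \<subseteq> S"
    proof
      fix p assume p: "p \<in> prime_factors i"
      then have "prime p" "p \<le> i" using that by (auto intro: dvd_imp_le)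
      then show "p \<in> S" using no that by (auto simp: S_def m_def not_less)
    qed
    then have "i = (\<Prod>p\<in>S. p ^ multiplicity p i)"
      using prime_factorization_nat[of i] that finS
      by (subst prod.mono_neutral_right[of S "prime_factors i"])
         (auto simp: prime_factors_multiplicity S_def)
    also have "\<dots> dvd d" unfolding d_def
    proof (rule prod_dvd_prod)
      fix p assume "p \<in> S"
      then have p: "prime p" by (simp add: S_def)
      have "p ^ multiplicity p i \<le> i" using that by (intro dvd_imp_le multiplicity_dvd) auto
      then show "p ^ multiplicity p i dvd p ^ pw p" using pw(2)[OF p] that by (intro le_imp_power_dvd) auto
    qed
    finally show ?thesis .
  qed
  have dpos: "d > 0" unfolding d_def by (intro prod_pos) (auto simp: S_def prime_gt_0_nat)
  have "m * (2 * m choose m) dvd d" by (rule times_binomial_dvd) (use m dvd in auto)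
  then have "m * (2 * m choose m) \<le> d" using dpos by (rule dvd_imp_le)
  moreover have "4 ^ m \<le> 2 * m * (2 * m choose m)"
  proof -
    have "real (4 ^ m) \<le> real (2 * m * (2 * m choose m))"
      using central_binomial_lower_bound[of m] m by (simp add: field_simps)
    then show ?thesis by linarith
  qed
  moreover have "d \<le> (2 * m) ^ n"
  proof -
    have "d \<le> (\<Prod>p\<in>S. 2 * m)" unfolding d_def by (intro prod_mono) (auto simp: S_def pw)
    also have "\<dots> = (2 * m) ^ card S" by simp
    also have "\<dots> \<le> (2 * m) ^ n"
    proof (rule power_increasing)
      have "S \<subseteq> {1..n}" by (auto simp: S_def Suc_le_eq prime_gt_0_nat)
      then show "card S \<le> n" using card_mono[of "{1..n}" S] by simp
    qed (use m in auto)
    finally show ?thesis .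
  qed
  ultimately have "4 ^ m \<le> 2 * (2 * m) ^ n" by (simp add: mult.assoc)
  \<comment> \<open>For \<open>n \<ge> 64\<close> one has \<open>2 * m < 2 ^ n\<close>, so the left
    side is at most \<open>2 ^ Suc m\<close>. The number 64 is a convenient start for the
    induction.\<close>
  moreover have "2 * (2 * m) ^ n < 4 ^ m"
  proof -
    have "2 * k\<^sup>2 < 2 ^ k" if "k \<ge> 64" for k :: nat
      using that
    proof (induction k rule: dec_induct)
      case (step k)
      have "2 * (Suc k)\<^sup>2 = 2 * k\<^sup>2 + 4 * k + 2" by (simp add: power2_eq_square algebra_simps)
      also have "\<dots> \<le> 2 * k\<^sup>2 + 2 * k\<^sup>2"
      proof -
        have "4 * k + 2 \<le> 5 * k" using step by simp
        also have "\<dots> \<le> 2 * k * k" using step by (intro mult_right_mono) auto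
        finally show ?thesis by (simp add: power2_eq_square)
      qed
      also have "\<dots> < 2 ^ Suc k" using step by simp
      finally show ?case .
    qed simp
    from this[OF n] have "2 * m < 2 ^ n" unfolding m_def .
    then have "(2 * m) ^ n \<le> (2 ^ n) ^ n" by (intro power_mono) auto
    then have "2 * (2 * m) ^ n \<le> 2 ^ Suc m" by (simp add: m_def power2_eq_square power_mult)
    also have "\<dots> < 2 ^ (2 * m)"
    proof (rule power_strict_increasing)
      have "64 * 64 \<le> n * n" using n by (intro mult_mono) auto
      then show "Suc m < 2 * m" by (simp add: m_def power2_eq_square)
    qed simp
    finally show ?thesis by (simp add: power_mult)
  qed
  ultimately show False by simp
qed

section \<open>Polynomial-time functions on encodable types\<close>

text \<open>A type class lets closure rules for polynomial time be stated once for all types. Its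
  instances reproduce the encodings that occur in \<open>efficient\<close>.\<close>

class codable =
  fixes code :: "'a \<Rightarrow> sexp"

instantiation unit :: codable
begin
definition code_unit_inst: "code (u::unit) = Atom"
instance ..
end

instantiation bool :: codable
begin
definition code_bool_inst: "code = code_bool"
instance ..
end

instantiation nat :: codable
begin
definition code_nat_inst: "code = code_nat"
instance ..
end

instantiation list :: (codable) codable
begin
definition code_list_inst: "code = code_list code"
instance ..
end

instantiation prod :: (codable, codable) codable
begin
definition code_prod_inst: "code z = Dot (code (fst z)) (code (snd z))"
instance ..
end

lemma code_Nil [simp]: "code [] = Atom"
  and code_Cons [simp]: "code (x # xs) = Dot (code x) (code xs)"
  by (simp_all add: code_list_def code_list_inst)

lemma code_0 [simp]: "code (0::nat) = Atom"
  and code_Suc [simp]: "code (Suc n) = Dot Atom (code n)"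
  by (simp_all add: code_nat_inst code_nat_def)

lemma code_False [simp]: "code False = Atom"
  and code_True [simp]: "code True = Dot Atom Atom"
  by (simp_all add: code_bool_inst code_bool_def)

lemma code_Pair [simp]: "code (x, y) = Dot (code x) (code y)"
  by (simp add: code_prod_inst)

lemma code_unit [simp]: "code () = Atom"
  by (simp add: code_unit_inst)

lemma size_code_nat [simp]: "size (code (n::nat)) = n"
  by (induction n) auto

lemma size_code_bool: "size (code (b::bool)) \<le> 1"
  by (cases b) auto

lemma length_le_size_code: "length xs \<le> size (code xs)"
  by (induction xs) auto

lemma size_code_mem: "x \<in> set xs \<Longrightarrow> size (code x) < size (code xs)"
  by (induction xs) auto

lemma size_code_list_le:
  assumes "\<And>x. x \<in> set xs \<Longrightarrow> size (code x) \<le> b"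
  shows "size (code xs) \<le> length xs * (b + 1)"
    using assms
proof (induction xs)
  case (Cons x xs)
  then have "size (code xs) \<le> length xs * (b + 1)" "size (code x) \<le> b" by auto
  then show ?case by simp
qed simp

section \<open>Polynomial bounds, and programs that respect them\<close>

definition pb :: "('a::codable \<Rightarrow> nat) \<Rightarrow> bool" where
  "pb g \<longleftrightarrow> (\<exists>d. \<forall>a. g a \<le> d * (size (code a) + 1) ^ d)"

lemma pb_mono: "pb h \<Longrightarrow> (\<And>a. g a \<le> h a) \<Longrightarrow> pb g"
  unfolding pb_def by (meson order_trans)

lemma poly_bound_mono:
  fixes x d e :: nat
  assumes "d \<le> e" "x \<le> y"
  shows "d * (x + 1) ^ d \<le> e * (y + 1) ^ e"
proof -
  have "d * (x + 1) ^ d \<le> e * (x + 1) ^ e"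
    using assms by (intro mult_mono power_increasing) auto
  also have "\<dots> \<le> e * (y + 1) ^ e"
    using assms by (intro mult_left_mono power_mono) auto
  finally show ?thesis .
qed

lemma pb_const: "pb (\<lambda>_. c)"
proof -
  have "c \<le> c * (x + 1) ^ c" for x :: nat by simp
  then show ?thesis unfolding pb_def by blast
qed

lemma pb_size: "pb (\<lambda>a. size (code a))"
  unfolding pb_def by (rule exI[of _ 1]) simp

lemma pb_add:
  assumes "pb f" "pb g" shows "pb (\<lambda>a. f a + g a)"
proof -
  obtain d e where d: "\<And>a. f a \<le> d * (size (code a) + 1) ^ d"
    and e: "\<And>a. g a \<le> e * (size (code a) + 1) ^ e"
    using assms unfolding pb_def by blast
  have "f a + g a \<le> (d + e) * (size (code a) + 1) ^ (d + e)" for a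
  proof -
    let ?x = "size (code a) + 1"
    have "f a \<le> d * ?x ^ (d + e)"
      using d[of a] by (rule order_trans) (intro mult_left_mono power_increasing, auto)
    moreover have "g a \<le> e * ?x ^ (d + e)"
      using e[of a] by (rule order_trans) (intro mult_left_mono power_increasing, auto)
    ultimately show ?thesis by (simp add: add_mult_distrib)
  qed
  then show ?thesis unfolding pb_def by blast
qed

lemma pb_mult:
  assumes "pb f" "pb g" shows "pb (\<lambda>a. f a * g a)"
proof -
  obtain d e where d: "\<And>a. f a \<le> d * (size (code a) + 1) ^ d"
    and e: "\<And>a. g a \<le> e * (size (code a) + 1) ^ e"
    using assms unfolding pb_def by blast
  let ?D = "d * e + d + e"
  have "f a * g a \<le> ?D * (size (code a) + 1) ^ ?D" for a
  proof -
    let ?x = "size (code a) + 1"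
    have "f a * g a \<le> (d * ?x ^ d) * (e * ?x ^ e)"
      by (intro mult_mono d e) auto
    also have "\<dots> = d * e * ?x ^ (d + e)" by (simp add: power_add)
    also have "\<dots> \<le> ?D * ?x ^ ?D" by (intro mult_mono power_increasing) auto
    finally show ?thesis .
  qed
  then show ?thesis unfolding pb_def by blast
qed

lemma pb_power: "pb f \<Longrightarrow> pb (\<lambda>a. f a ^ k)"
  by (induction k) (auto intro: pb_const pb_mult)

lemma pb_comp:
  assumes "pb g" "pb (\<lambda>a. size (code (f a)))"
  shows "pb (\<lambda>a. g (f a))"
proof -
  obtain d where d: "\<And>a. g a \<le> d * (size (code a) + 1) ^ d"
    using assms(1) unfolding pb_def by blast
  show ?thesis
    by (rule pb_mono[OF _ d]) (intro pb_mult pb_power pb_add pb_const assms)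
qed

text \<open>Unlike \<open>runs\<close>, this allows any contents in the variables other than 0, so
  that a program can be started where another one has stopped.\<close>

definition computes :: "com \<Rightarrow> ('a::codable \<Rightarrow> 'b::codable) \<Rightarrow> ('a \<Rightarrow> nat) \<Rightarrow> bool" where
  "computes c f B \<longleftrightarrow> (\<forall>a s. s 0 = code a \<longrightarrow>
     (\<exists>t s'. exec c s t s' \<and> s' 0 = code (f a) \<and> t \<le> B a))"

lemma computesD:
  "computes c f B \<Longrightarrow> s 0 = code a \<Longrightarrow> \<exists>t s'. exec c s t s' \<and> s' 0 = code (f a) \<and> t \<le> B a"
  unfolding computes_def by blast

text \<open>Running time does not bound the size of the output: with sharing, repeated pairing of a
  tree with itself doubles its size at unit cost. The size bound is therefore carried along, and
  composition relies on it.\<close>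

definition pt :: "('a::codable \<Rightarrow> 'b::codable) \<Rightarrow> bool" where
  "pt f \<longleftrightarrow> pb (\<lambda>a. size (code (f a))) \<and> (\<exists>c B. pb B \<and> computes c f B)"

lemma ptI:
  assumes "pb (\<lambda>a. size (code (f a)))" "pb B"
    and "\<And>a s. s 0 = code a \<Longrightarrow> \<exists>t s'. exec c s t s' \<and> s' 0 = code (f a) \<and> t \<le> B a"
  shows "pt f"
  using assms unfolding pt_def computes_def by blast

lemma ptE:
  assumes "pt f"
  obtains c B where "pb B" "computes c f B"
  using assms unfolding pt_def computes_def by blast

lemma pb_size_pt: "pt f \<Longrightarrow> pb (\<lambda>a. size (code (f a)))"
  unfolding pt_def by blast

lemma pb_nat: "pt f \<Longrightarrow> pb (f :: _ \<Rightarrow> nat)"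
  using pb_size_pt[of f] by simp

lemma pb_length: "pt f \<Longrightarrow> pb (\<lambda>a. length (f a))"
  by (rule pb_mono[OF pb_size_pt length_le_size_code])

fun writes :: "com \<Rightarrow> nat set" where
  "writes Skip = {}"
| "writes (Assign v e) = {v}"
| "writes (Seq c d) = writes c \<union> writes d"
| "writes (If e c d) = writes c \<union> writes d"
| "writes (While e c) = writes c"

lemma finite_writes: "finite (writes c)"
  by (induction c) auto

lemma exec_frame: "exec c s t s' \<Longrightarrow> v \<notin> writes c \<Longrightarrow> s' v = s v"
  by (induction rule: exec.induct) auto

text \<open>Supplies the registers \<open>k\<close> and \<open>Suc k\<close> in which values survive
  the execution of \<open>c\<close> and \<open>d\<close>.\<close>

lemma fresh_variable:
  "\<exists>k>0. (\<forall>v\<ge>k. v \<notin> writes c) \<and> (\<forall>v\<ge>k. v \<notin> writes d)"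
proof -
  obtain m where "\<forall>v \<in> writes c \<union> writes d. v \<le> m"
    using finite_writes finite_nat_set_iff_bounded_le by (metis finite_UnI)
  then show ?thesis by (intro exI[of _ "Suc m"]) (auto simp: not_less_eq_eq[symmetric])
qed

lemma exec_Assign: "x = eval e s \<Longrightarrow> t = cost e + 1 \<Longrightarrow> exec (Assign v e) s t (s(v := x))"
  using exec.intros(2) by simp

lemma pt_expr:
  assumes "\<And>a s. s 0 = code a \<Longrightarrow> eval e s = code (f a)" "pb (\<lambda>a. size (code (f a)))"
  shows "pt f"
proof (rule ptI[where c = "Assign 0 e" and B = "\<lambda>_. cost e + 1"])
  fix a and s :: store assume "s 0 = code (a::'a)"
  with assms(1) have "(s(0 := eval e s)) 0 = code (f a)" by simp
  then show "\<exists>t s'. exec (Assign 0 e) s t s' \<and> s' 0 = code (f a) \<and> t \<le> cost e + 1"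
    using exec.intros(2) by blast
qed (use assms pb_const in auto)

lemma pt_ident: "pt (\<lambda>x. x)"
  by (rule pt_expr[where e = "EVar 0"]) (auto intro: pb_size)

fun expr_of :: "sexp \<Rightarrow> expr" where
  "expr_of Atom = EAtom"
| "expr_of (Dot a b) = EDot (expr_of a) (expr_of b)"

lemma eval_expr_of [simp]: "eval (expr_of a) s = a"
  by (induction a) auto

lemma pt_const: "pt (\<lambda>_. c)"
  by (rule pt_expr[where e = "expr_of (code c)"]) (auto intro: pb_const)

lemma pt_comp:
  assumes "pt g" "pt f" shows "pt (\<lambda>x. g (f x))"
proof -
  obtain c B where "pb B" "computes c f B" using ptE[OF assms(2)] by blast
  note c = this(1) computesD[OF this(2)]
  obtain c' B' where "pb B'" "computes c' g B'" using ptE[OF assms(1)] by blast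
  note c' = this(1) computesD[OF this(2)]
  show ?thesis
  proof (rule ptI[where c = "Seq c c'" and B = "\<lambda>x. B x + B' (f x)"])
    show "pb (\<lambda>x. B x + B' (f x))"
      by (rule pb_add[OF c(1) pb_comp[OF c'(1) pb_size_pt[OF assms(2)]]])
    show "pb (\<lambda>a. size (code (g (f a))))"
      by (rule pb_comp[OF pb_size_pt pb_size_pt, OF assms])
    fix a and s :: store assume "s 0 = code (a::'c)"
    then obtain t s' where 1: "exec c s t s'" "s' 0 = code (f a)" "t \<le> B a" using c(2) by blast
    obtain t' s'' where 2: "exec c' s' t' s''" "s'' 0 = code (g (f a))" "t' \<le> B' (f a)"
      using c'(2)[of s' "f a", OF 1(2)] by blast
    show "\<exists>t s'. exec (Seq c c') s t s' \<and> s' 0 = code (g (f a)) \<and> t \<le> B a + B' (f a)"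
      using exec.intros(3)[OF 1(1) 2(1)] 1(3) 2(2,3) by (intro exI conjI) (assumption, auto)
  qed
qed

lemma pt_fst0: "pt fst"
  by (rule pt_expr[where e = "EHd (EVar 0)"], simp add: code_prod_inst)
    (rule pb_mono[OF pb_size], simp add: code_prod_inst)

lemma pt_snd0: "pt snd"
  by (rule pt_expr[where e = "ETl (EVar 0)"], simp add: code_prod_inst)
    (rule pb_mono[OF pb_size], simp add: code_prod_inst)

lemmas pt_fst = pt_comp[OF pt_fst0] and pt_snd = pt_comp[OF pt_snd0]

lemma pt_Pair:
  assumes "pt f" "pt g" shows "pt (\<lambda>x. (f x, g x))"
proof -
  obtain c B where "pb B" "computes c f B" using ptE[OF assms(1)] by blast
  note c = this(1) computesD[OF this(2)]
  obtain c' B' where "pb B'" "computes c' g B'" using ptE[OF assms(2)] by blast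
  note c' = this(1) computesD[OF this(2)]
  obtain k where k: "0 < k" "\<And>v. k \<le> v \<Longrightarrow> v \<notin> writes c" "\<And>v. k \<le> v \<Longrightarrow> v \<notin> writes c'"
    using fresh_variable[of c c'] by blast
  define d where "d = Seq (Assign k (EVar 0)) (Seq c (Seq (Assign (Suc k) (EVar 0))
    (Seq (Assign 0 (EVar k)) (Seq c' (Assign 0 (EDot (EVar (Suc k)) (EVar 0)))))))"
  show ?thesis
  proof (rule ptI[where c = d and B = "\<lambda>x. B x + B' x + 10"])
    show "pb (\<lambda>x. B x + B' x + 10)" by (intro pb_add c c' pb_const)
    show "pb (\<lambda>a. size (code (f a, g a)))"
      using pb_add[OF pb_add[OF pb_size_pt[OF assms(1)] pb_size_pt[OF assms(2)]] pb_const[of 1]] by simp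
    fix a and s :: store assume s: "s 0 = code (a::'a)"
    let ?s1 = "s(k := s 0)"
    obtain t s' where 1: "exec c ?s1 t s'" "s' 0 = code (f a)" "t \<le> B a"
      using c(2)[of ?s1 a] s k(1) by auto
    have k1: "s' k = s 0" using exec_frame[OF 1(1) k(2)] by simp
    let ?s2 = "s'(Suc k := s' 0)" let ?s3 = "?s2(0 := ?s2 k)"
    obtain t' s'' where 2: "exec c' ?s3 t' s''" "s'' 0 = code (g a)" "t' \<le> B' a"
      using c'(2)[of ?s3 a] k1 s by auto
    have k2: "s'' (Suc k) = code (f a)" using exec_frame[OF 2(1) k(3)[of "Suc k"]] 1 by simp
    let ?s4 = "s''(0 := Dot (s'' (Suc k)) (s'' 0))"
    have e1: "exec (Assign k (EVar 0)) s 2 ?s1"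
       by (intro exec_Assign) (auto simp: code_prod_inst)
    have e2: "exec (Assign (Suc k) (EVar 0)) s' 2 ?s2"
       by (intro exec_Assign) (auto simp: code_prod_inst)
    have e3: "exec (Assign 0 (EVar k)) ?s2 2 ?s3"
       by (intro exec_Assign) (auto simp: code_prod_inst)
    have e4: "exec (Assign 0 (EDot (EVar (Suc k)) (EVar 0))) s'' 4 ?s4"
       by (intro exec_Assign) (auto simp: code_prod_inst)
    have "exec d s (2 + (t + (2 + (2 + (t' + 4))))) ?s4"
      unfolding d_def by (intro exec.intros(3)[OF e1] exec.intros(3)[OF 1(1)] exec.intros(3)[OF e2]
        exec.intros(3)[OF e3] exec.intros(3)[OF 2(1)] e4)
    then show "\<exists>t s'. exec d s t s' \<and> s' 0 = code (f a, g a) \<and> t \<le> B a + B' a + 10"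
      using 1 2 k2 by (intro exI conjI) (assumption, auto)
  qed
qed

lemma pt_If_low:
  assumes "pt f" "pt g" shows "pt (\<lambda>z. if snd z then f (fst z) else g (fst z))"
proof -
  obtain c B where "pb B" "computes c f B" using ptE[OF assms(1)] by blast
  note c = this(1) computesD[OF this(2)]
  obtain c' B' where "pb B'" "computes c' g B'" using ptE[OF assms(2)] by blast
  note c' = this(1) computesD[OF this(2)]
  define d where "d = Seq (Assign 1 (ETl (EVar 0))) (Seq (Assign 0 (EHd (EVar 0))) (If (EVar 1) c c'))"
  show ?thesis
  proof (rule ptI[where c = d and B = "\<lambda>z. B (fst z) + B' (fst z) + 10"])
    show "pb (\<lambda>z::'a\<times>bool. B (fst z) + B' (fst z) + 10)"
      by (rule pb_add[OF pb_add[OF pb_comp[OF c(1)] pb_comp[OF c'(1)]] pb_const]) (rule pb_size_pt[OF pt_fst0])+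
    have "pb (\<lambda>z::'a\<times>bool. size (code (f (fst z))) + size (code (g (fst z))))"
      by (rule pb_add[OF pb_size_pt pb_size_pt, OF pt_comp[OF assms(1) pt_fst0] pt_comp[OF assms(2) pt_fst0]])
    then show "pb (\<lambda>z. size (code (if snd z then f (fst z) else g (fst z))))"
      by (rule pb_mono) auto
    fix a :: "'a \<times> bool" and s :: store assume s: "s 0 = code a"
    obtain e b where a: "a = (e, b)" by (cases a)
    let ?s = "(s(1 := code b))(0 := code e)"
    have 1: "exec (Assign 1 (ETl (EVar 0))) s 3 (s(1 := code b))"
      using s a by (intro exec_Assign) (auto simp: code_prod_inst)
    have 2: "exec (Assign 0 (EHd (EVar 0))) (s(1 := code b)) 3 ?s"
      using s a by (intro exec_Assign) (auto simp: code_prod_inst)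
    obtain t s' where 3: "exec c ?s t s'" "s' 0 = code (f e)" "t \<le> B e" using c(2)[of ?s e] by auto
    obtain t' s'' where 4: "exec c' ?s t' s''" "s'' 0 = code (g e)" "t' \<le> B' e" using c'(2)[of ?s e] by auto
    show "\<exists>t s'. exec d s t s' \<and> s' 0 = code (if snd a then f (fst a) else g (fst a)) \<and>
        t \<le> B (fst a) + B' (fst a) + 10"
    proof (cases b)
      case True
      have "exec d s (3 + (3 + (1 + t + 1))) s'" unfolding d_def
        using exec.intros(3)[OF 1 exec.intros(3)[OF 2 exec.intros(4)[OF _ 3(1)]], of "EVar 1" c'] True by simp
      then show ?thesis using 3 True a by (intro exI conjI) (assumption, auto)
    next
      case False
      have "exec d s (3 + (3 + (1 + t' + 1))) s''" unfolding d_def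
        using exec.intros(3)[OF 1 exec.intros(3)[OF 2 exec.intros(5)[OF _ 4(1)]], of "EVar 1" c] False by simp
      then show ?thesis using 4 False a by (intro exI conjI) (assumption, auto)
    qed
  qed
qed

lemma pt_If:
  assumes "pt b" "pt f" "pt g" shows "pt (\<lambda>x. if b x then f x else g x)"
  using pt_comp[OF pt_If_low[OF assms(2,3)] pt_Pair[OF pt_ident assms(1)]] unfolding fst_conv snd_conv .

text \<open>The pair of \<open>e\<close> and \<open>y # ys\<close> is the same tree as the triple
  \<open>(e, y, ys)\<close>, so the program for \<open>g\<close> starts on the input as it stands,
  and its bounds may be taken at the size of the whole input.\<close>

lemma pt_case_list_low:
  assumes "pt f" "pt g"
  shows "pt (\<lambda>z. case snd z of [] \<Rightarrow> f (fst z) | y # ys \<Rightarrow> g (fst z, y, ys))"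
proof -
  obtain c B where "pb B" "computes c f B" using ptE[OF assms(1)] by blast
  note c = this(1) computesD[OF this(2)]
  obtain c' B' where "pb B'" "computes c' g B'" using ptE[OF assms(2)] by blast
  note c' = this(1) computesD[OF this(2)]
  obtain d1 where d1: "\<And>a. B' a \<le> d1 * (size (code a) + 1) ^ d1" using c'(1) unfolding pb_def by blast
  obtain d2 where d2: "\<And>a. size (code (g a)) \<le> d2 * (size (code a) + 1) ^ d2"
    using pb_size_pt[OF assms(2)] unfolding pb_def by blast
  define d where "d = If (ETl (EVar 0)) c' (Seq (Assign 0 (EHd (EVar 0))) c)"
  let ?h = "\<lambda>z. case snd z of [] \<Rightarrow> f (fst z) | y # ys \<Rightarrow> g (fst z, y, ys)"
  show ?thesis
  proof (rule ptI[where c = d and B = "\<lambda>z. B (fst z) + d1 * (size (code z) + 1) ^ d1 + 10"])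
    show "pb (\<lambda>z::'a\<times>'c list. B (fst z) + d1 * (size (code z) + 1) ^ d1 + 10)"
      by (intro pb_add pb_mult pb_power pb_const pb_size pb_comp[OF c(1) pb_size_pt[OF pt_fst0]])
    have "pb (\<lambda>z::'a\<times>'c list. size (code (f (fst z))) + d2 * (size (code z) + 1) ^ d2)"
      by (intro pb_add pb_mult pb_power pb_const pb_size pb_size_pt[OF pt_comp[OF assms(1) pt_fst0]])
    then show "pb (\<lambda>z. size (code (?h z)))"
    proof (rule pb_mono)
      fix z :: "'a \<times> 'c list"
      show "size (code (?h z)) \<le> size (code (f (fst z))) + d2 * (size (code z) + 1) ^ d2"
        using d2[of "(fst z, hd (snd z), tl (snd z))"]
        by (cases z; cases "snd z") (auto intro: trans_le_add2)
    qed
    fix a :: "'a \<times> 'c list" and s :: store assume s: "s 0 = code a"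
    show "\<exists>t s'. exec d s t s' \<and> s' 0 = code (?h a) \<and> t \<le> B (fst a) + d1 * (size (code a) + 1) ^ d1 + 10"
    proof (cases "snd a")
      case Nil
      let ?s = "s(0 := code (fst a))"
      have 2: "exec (Assign 0 (EHd (EVar 0))) s 3 ?s"
        using s by (intro exec_Assign) (auto simp: code_prod_inst)
      obtain t s' where 3: "exec c ?s t s'" "s' 0 = code (f (fst a))" "t \<le> B (fst a)"
        using c(2)[of ?s "fst a"] by auto
      have "exec d s (2 + (3 + t) + 1) s'" unfolding d_def
        using exec.intros(5)[OF _ exec.intros(3)[OF 2 3(1)], of "ETl (EVar 0)" c'] Nil s
        by (simp add: code_prod_inst)
      then show ?thesis using 3 Nil by (intro exI conjI) (assumption, auto)
    next
      case (Cons y ys)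
      then have ca: "code a = code (fst a, y, ys)" by (simp add: code_prod_inst)
      obtain t s' where 3: "exec c' s t s'" "s' 0 = code (g (fst a, y, ys))" "t \<le> B' (fst a, y, ys)"
        using c'(2)[of s "(fst a, y, ys)"] s ca by auto
      have "exec d s (2 + t + 1) s'" unfolding d_def
        using exec.intros(4)[OF _ 3(1), of "ETl (EVar 0)"] Cons s
        by (simp add: code_prod_inst)
      then show ?thesis using 3 Cons d1[of "(fst a, y, ys)"] ca by (intro exI conjI) (assumption, auto)
    qed
  qed
qed

lemma pt_case_list:
  assumes "pt xs" "pt f" "pt (\<lambda>z. g (fst z) (fst (snd z)) (snd (snd z)))"
  shows "pt (\<lambda>x. case xs x of [] \<Rightarrow> f x | y # ys \<Rightarrow> g x y ys)"
  using pt_comp[OF pt_case_list_low[OF assms(2,3)] pt_Pair[OF pt_ident assms(1)]] unfolding fst_conv snd_conv .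

text \<open>A unary number and a list of units are the same tree. Conversion costs nothing, and
  loops over numbers come from loops over lists.\<close>

lemma code_replicate_unit: "code (replicate n ()) = code n"
  by (induction n) auto

lemma code_length_unit: "code (length xs) = code (xs :: unit list)"
  by (induction xs) auto

lemma pt_recode:
  assumes "pt f" "\<And>a. code (g a) = code (f a)" shows "pt g"
  using assms unfolding pt_def computes_def by simp

lemma pt_replicate_unit: "pt n \<Longrightarrow> pt (\<lambda>x. replicate (n x) ())"
  by (erule pt_recode) (rule code_replicate_unit)

text \<open>The loop keeps the environment \<open>e\<close> in register \<open>k\<close>, the unread
  list in \<open>Suc k\<close> and the accumulator in variable 0. Since \<open>m\<close> bounds
  every argument passed to \<open>c\<close>, one bound covers all iterations; the summand 20 pays
  for the register moves and the loop test.\<close>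

lemma exec_foldl_loop:
  fixes xs :: "'c::codable list" and f :: "'a::codable \<times> 'b \<times> 'c \<Rightarrow> 'b::codable" and k :: nat and s :: store and c :: com
  defines "body \<equiv> Seq (Assign 0 (EDot (EVar k) (EDot (EVar 0) (EHd (EVar (Suc k))))))
      (Seq c (Assign (Suc k) (ETl (EVar (Suc k)))))"
  assumes k: "0 < k" "\<And>v. k \<le> v \<Longrightarrow> v \<notin> writes c"
    and c: "\<And>a s. s 0 = code a \<Longrightarrow> \<exists>t s'. exec c s t s' \<and> s' 0 = code (f a) \<and> t \<le> d * (size (code a) + 1) ^ d"
    and bnd: "\<And>i. i \<le> length xs \<Longrightarrow> size (code (foldl (\<lambda>acc x. f (e, acc, x)) acc (take i xs))) \<le> b"
    and m: "size (code e) + size (code xs) + b + 2 \<le> m"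
    and s: "s 0 = code acc" "s k = code e" "s (Suc k) = code xs"
  shows "\<exists>t s'. exec (While (EVar (Suc k)) body) s t s' \<and>
      s' 0 = code (foldl (\<lambda>acc x. f (e, acc, x)) acc xs) \<and>
      t \<le> length xs * (d * (m + 1) ^ d + 20) + 2"
  using bnd m s
proof (induction xs arbitrary: acc s)
  case Nil
  then have "exec (While (EVar (Suc k)) body) s 2 s"
    using exec.intros(6)[of "EVar (Suc k)" s body] by (simp add: numeral_2_eq_2)
  then show ?case using Nil by (intro exI conjI) (assumption, auto)
next
  case (Cons x xs)
  let ?acc = "f (e, acc, x)"
  let ?s = "s(0 := code (e, acc, x))"
  have 1: "exec (Assign 0 (EDot (EVar k) (EDot (EVar 0) (EHd (EVar (Suc k)))))) s 7 ?s"
    using Cons.prems by (intro exec_Assign) (auto simp: code_prod_inst)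
  obtain t s' where 2: "exec c ?s t s'" "s' 0 = code ?acc"
      "t \<le> d * (size (code (e, acc, x)) + 1) ^ d" using c[of ?s "(e, acc, x)"] by auto
  have k': "s' k = code e" "s' (Suc k) = code (x # xs)"
    using exec_frame[OF 2(1) k(2)[of k]] exec_frame[OF 2(1) k(2)[of "Suc k"]] k(1) Cons.prems by auto
  let ?s' = "s'(Suc k := code xs)"
  have 3: "exec (Assign (Suc k) (ETl (EVar (Suc k)))) s' 3 ?s'"
    using k' by (intro exec_Assign) (auto simp: code_prod_inst)
  have 4: "exec body s (7 + (t + 3)) ?s'"
    unfolding body_def by (intro exec.intros(3)[OF 1] exec.intros(3)[OF 2(1)] 3)
  have "\<exists>t s'. exec (While (EVar (Suc k)) body) ?s' t s' \<and>
      s' 0 = code (foldl (\<lambda>acc x. f (e, acc, x)) ?acc xs) \<and>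
      t \<le> length xs * (d * (m + 1) ^ d + 20) + 2"
  proof (rule Cons.IH)
    show "size (code (foldl (\<lambda>acc x. f (e, acc, x)) ?acc (take i xs))) \<le> b" if "i \<le> length xs" for i
      using Cons.prems(1)[of "Suc i"] that by simp
  qed (use Cons.prems 2 k' in auto)
  then obtain t' s'' where 5: "exec (While (EVar (Suc k)) body) ?s' t' s''"
      "s'' 0 = code (foldl (\<lambda>acc x. f (e, acc, x)) ?acc xs)"
      "t' \<le> length xs * (d * (m + 1) ^ d + 20) + 2" by blast
  have "size (code (e, acc, x)) \<le> m"
    using Cons.prems(1)[of 0] Cons.prems(2) by simp
  then have "t \<le> d * (m + 1) ^ d" using 2(3) poly_bound_mono[of d d "size (code (e, acc, x))" m] by linarith
  moreover have "exec (While (EVar (Suc k)) body) s (1 + (7 + (t + 3)) + t' + 1) s''"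
    using exec.intros(7)[OF _ 4 5(1)] Cons.prems(5) by simp
  ultimately show ?case
    using 5 by (intro exI conjI) (assumption, auto)
qed

text \<open>Polynomially many polynomial-time steps can still build something exponentially large,
  for instance by repeated doubling. Hence the bound \<open>b\<close> on all intermediate
  accumulators, to be supplied at each use.\<close>

lemma pt_foldl:
  assumes st: "pt (\<lambda>z. st (fst z) (fst (snd z)) (snd (snd z)))" and "pt init" "pt xs" and "pb b"
    and bnd: "\<And>e i. i \<le> length (xs e) \<Longrightarrow> size (code (foldl (st e) (init e) (take i (xs e)))) \<le> b e"
  shows "pt (\<lambda>e. foldl (st e) (init e) (xs e))"
proof -
  let ?f = "\<lambda>z. st (fst z) (fst (snd z)) (snd (snd z))"
  obtain c B where "pb B" "computes c ?f B" using ptE[OF st] by blast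
  note c = this(1) computesD[OF this(2)]
  obtain d where d: "\<And>a. B a \<le> d * (size (code a) + 1) ^ d" using c(1) unfolding pb_def by blast
  have c': "\<exists>t s'. exec c s t s' \<and> s' 0 = code (?f a) \<and> t \<le> d * (size (code a) + 1) ^ d"
    if "s 0 = code a" for a and s :: store using c(2)[of s a, OF that] d[of a] order_trans by blast
  have "pt (\<lambda>e. (e, init e, xs e))" by (intro pt_Pair pt_ident assms)
  then obtain c0 B0 where "pb B0" "computes c0 (\<lambda>e. (e, init e, xs e)) B0" using ptE by blast
  note c0 = this(1) computesD[OF this(2)]
  obtain k where k: "0 < k" "\<And>v. k \<le> v \<Longrightarrow> v \<notin> writes c"
    using fresh_variable[of c c] by blast
  define loop where "loop = While (EVar (Suc k)) (Seq (Assign 0 (EDot (EVar k) (EDot (EVar 0) (EHd (EVar (Suc k))))))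
      (Seq c (Assign (Suc k) (ETl (EVar (Suc k))))))"
  define p where "p = Seq c0 (Seq (Assign k (EHd (EVar 0))) (Seq (Assign (Suc k) (ETl (ETl (EVar 0))))
     (Seq (Assign 0 (EHd (ETl (EVar 0)))) loop)))"
  let ?m = "\<lambda>e. size (code e) + size (code (xs e)) + b e + 2"
  show ?thesis
  proof (rule ptI[where c = p and B = "\<lambda>e. B0 e + length (xs e) * (d * (?m e + 1) ^ d + 20) + 20"])
    show "pb (\<lambda>e. B0 e + length (xs e) * (d * (?m e + 1) ^ d + 20) + 20)"
      by (intro pb_add pb_mult pb_power pb_const pb_size pb_length pb_size_pt c0 assms)
    show "pb (\<lambda>e. size (code (foldl (st e) (init e) (xs e))))"
      using pb_mono[OF \<open>pb b\<close>] bnd[of "length (xs e)" e for e] by simp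
    fix e and s :: store assume "s 0 = code (e :: 'a)"
    then obtain t s1 where 1: "exec c0 s t s1" "s1 0 = code (e, init e, xs e)" "t \<le> B0 e" using c0(2) by blast
    let ?s2 = "s1(k := code e)" let ?s3 = "?s2(Suc k := code (xs e))" let ?s4 = "?s3(0 := code (init e))"
    have 2: "exec (Assign k (EHd (EVar 0))) s1 3 ?s2"
      using 1 by (intro exec_Assign) (auto simp: code_prod_inst)
    have 3: "exec (Assign (Suc k) (ETl (ETl (EVar 0)))) ?s2 4 ?s3"
      using 1 k by (intro exec_Assign) (auto simp: code_prod_inst)
    have 4: "exec (Assign 0 (EHd (ETl (EVar 0)))) ?s3 4 ?s4"
      using 1 k by (intro exec_Assign) (auto simp: code_prod_inst)
    have "\<exists>t s'. exec loop ?s4 t s' \<and>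
      s' 0 = code (foldl (\<lambda>acc x. ?f (e, acc, x)) (init e) (xs e)) \<and>
      t \<le> length (xs e) * (d * (?m e + 1) ^ d + 20) + 2"
      unfolding loop_def
      by (rule exec_foldl_loop[OF k c', where b = "b e"]) (use k bnd in auto)
    then obtain t' s' where 5: "exec loop ?s4 t' s'"
      "s' 0 = code (foldl (st e) (init e) (xs e))"
      "t' \<le> length (xs e) * (d * (?m e + 1) ^ d + 20) + 2" by auto
    have "exec p s (t + (3 + (4 + (4 + t')))) s'"
      unfolding p_def by (intro exec.intros(3)[OF 1(1)] exec.intros(3)[OF 2] exec.intros(3)[OF 3]
        exec.intros(3)[OF 4] 5)
    then show "\<exists>t s'. exec p s t s' \<and> s' 0 = code (foldl (st e) (init e) (xs e)) \<and>
        t \<le> B0 e + length (xs e) * (d * (?m e + 1) ^ d + 20) + 20"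
      using 1 5 by (intro exI conjI) (assumption, auto)
  qed
qed

lemma pt_case_nat:
  assumes "pt n" "pt f" "pt (\<lambda>z. g (fst z) (snd z))"
  shows "pt (\<lambda>x. case n x of 0 \<Rightarrow> f x | Suc m \<Rightarrow> g x m)"
proof -
  have m: "pt (\<lambda>z::'a \<times> unit \<times> unit list. length (snd (snd z)))"
    by (rule pt_recode[OF pt_snd[OF pt_snd0]]) (rule code_length_unit)
  have "pt (\<lambda>x. case replicate (n x) () of [] \<Rightarrow> f x | y # ys \<Rightarrow> g x (length ys))"
    using pt_comp[OF assms(3) pt_Pair[OF pt_fst0 m]]
    by (intro pt_case_list pt_replicate_unit assms) auto
  moreover have "(case replicate (n x) () of [] \<Rightarrow> f x | y # ys \<Rightarrow> g x (length ys)) =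
      (case n x of 0 \<Rightarrow> f x | Suc m \<Rightarrow> g x m)" for x
    by (cases "n x") auto
  ultimately show ?thesis by simp
qed

lemma pt_Cons: "pt x \<Longrightarrow> pt xs \<Longrightarrow> pt (\<lambda>e. x e # xs e)"
  by (rule pt_recode[OF pt_Pair]) auto

lemma pt_Suc: "pt n \<Longrightarrow> pt (\<lambda>e. Suc (n e))"
  by (rule pt_recode[OF pt_Pair[OF pt_const[of "()"]]]) auto

section \<open>Polynomial-time functions on lists and unary numbers\<close>

named_theorems pt_intros

lemmas [pt_intros] = pt_ident pt_const pt_fst pt_snd pt_Pair pt_If pt_case_list pt_case_nat
  pt_Cons pt_Suc pt_replicate_unit

lemma pt_cong: "pt f \<Longrightarrow> (\<And>e. g e = f e) \<Longrightarrow> pt g"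
  by presburger

lemma pt_conj [pt_intros]: "pt a \<Longrightarrow> pt b \<Longrightarrow> pt (\<lambda>e. a e \<and> b e)"
  by (rule pt_cong[OF pt_If[of a b "\<lambda>_. False"]]) (auto intro: pt_const)

lemma pt_not [pt_intros]: "pt a \<Longrightarrow> pt (\<lambda>e. \<not> a e)"
  by (rule pt_cong[OF pt_If[of a "\<lambda>_. False" "\<lambda>_. True"]]) (auto intro: pt_const)

lemma pt_disj [pt_intros]: "pt a \<Longrightarrow> pt b \<Longrightarrow> pt (\<lambda>e. a e \<or> b e)"
  by (rule pt_cong[OF pt_If[of a "\<lambda>_. True" b]]) (auto intro: pt_const)

lemma pt_of_bool [pt_intros]: "pt a \<Longrightarrow> pt (\<lambda>e. of_bool (a e) :: nat)"
  unfolding of_bool_def by (intro pt_intros)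

lemma size_code_append: "size (code (xs @ ys)) = size (code xs) + size (code ys)"
  by (induction xs) auto

lemma size_code_rev [simp]: "size (code (rev xs)) = size (code xs)"
  by (induction xs) (auto simp: size_code_append)

lemma size_code_take: "size (code (take i xs)) \<le> size (code xs)"
  by (metis append_take_drop_id le_add1 size_code_append)

lemma pt_rev [pt_intros]:
  assumes "pt xs" shows "pt (\<lambda>e. rev (xs e))"
proof -
  have eq: "foldl (\<lambda>acc x. x # acc) acc ys = rev ys @ acc" for acc ys :: "'b list"
    by (induction ys arbitrary: acc) auto
  have "pt (\<lambda>e. foldl (\<lambda>acc x. x # acc) [] (xs e))"
  proof (rule pt_foldl[where b = "\<lambda>e. size (code (xs e))"])
    show "size (code (foldl (\<lambda>acc x. x # acc) [] (take i (xs e)))) \<le> size (code (xs e))" for i e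
      unfolding eq by (simp add: size_code_take)
  qed (intro pt_intros assms pb_size_pt)+
  then show ?thesis unfolding eq by simp
qed

lemma pt_append [pt_intros]:
  assumes "pt xs" "pt ys" shows "pt (\<lambda>e. xs e @ ys e)"
proof -
  have eq: "foldl (\<lambda>acc x. x # acc) acc ys = rev ys @ acc" for acc ys :: "'b list"
    by (induction ys arbitrary: acc) auto
  have "pt (\<lambda>e. foldl (\<lambda>acc x. x # acc) (ys e) (rev (xs e)))"
  proof (rule pt_foldl[where b = "\<lambda>e. size (code (xs e)) + size (code (ys e))"])
    show "size (code (foldl (\<lambda>acc x. x # acc) (ys e) (take i (rev (xs e))))) \<le>
        size (code (xs e)) + size (code (ys e))" for i e
      unfolding eq using size_code_take[of i "rev (xs e)"] by (simp add: size_code_append)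
  qed (intro pt_intros assms pb_add pb_size_pt)+
  then show ?thesis unfolding eq by simp
qed

lemma pt_map [pt_intros]:
  assumes "pt (\<lambda>z. f (fst z) (snd z))" "pt xs" shows "pt (\<lambda>e. map (f e) (xs e))"
proof -
  have eq: "foldl (\<lambda>acc x. f e x # acc) acc ys = rev (map (f e) ys) @ acc" for acc ys e
    by (induction ys arbitrary: acc) auto
  obtain d where d: "\<And>z. size (code (f (fst z) (snd z))) \<le> d * (size (code z) + 1) ^ d"
    using pb_size_pt[OF assms(1)] unfolding pb_def by blast
  let ?m = "\<lambda>e. d * (size (code e) + size (code (xs e)) + 1 + 1) ^ d"
  have "pt (\<lambda>e. foldl (\<lambda>acc x. f e x # acc) [] (xs e))"
  proof (rule pt_foldl[where b = "\<lambda>e. length (xs e) * (?m e + 1)"])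
    show "pb (\<lambda>e. length (xs e) * (?m e + 1))"
      by (intro pb_mult pb_add pb_power pb_const pb_length pb_size pb_size_pt assms)
    fix e i
    have "size (code (map (f e) (take i (xs e)))) \<le> length (map (f e) (take i (xs e))) * (?m e + 1)"
    proof (rule size_code_list_le)
      fix y assume "y \<in> set (map (f e) (take i (xs e)))"
      then obtain x where x: "x \<in> set (xs e)" "y = f e x" by (auto dest: in_set_takeD)
      have "size (code y) \<le> d * (size (code (e, x)) + 1) ^ d" using d[of "(e, x)"] x by simp
      also have "\<dots> \<le> ?m e" by (rule poly_bound_mono) (use size_code_mem[OF x(1)] in auto)
      finally show "size (code y) \<le> ?m e" .
    qed
    also have "\<dots> \<le> length (xs e) * (?m e + 1)" by (intro mult_right_mono) auto
    finally show "size (code (foldl (\<lambda>acc x. f e x # acc) [] (take i (xs e)))) \<le> length (xs e) * (?m e + 1)"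
      unfolding eq by simp
    have "pt (\<lambda>z::('a \<times> 'c list \<times> 'b). f (fst z) (snd (snd z)))"
      using pt_comp[OF assms(1), of "\<lambda>z. (fst z, snd (snd z))"] by (simp add: pt_intros)
    then show "pt (\<lambda>z. f (fst z) (snd (snd z)) # fst (snd z))" by (intro pt_intros)
  qed (intro pt_intros assms)+
  then have "pt (\<lambda>e. rev (map (f e) (xs e)))" unfolding eq by simp
  then show ?thesis using pt_rev by fastforce
qed

lemma pt_filter [pt_intros]:
  assumes "pt (\<lambda>z. P (fst z) (snd z))" "pt xs" shows "pt (\<lambda>e. filter (P e) (xs e))"
proof -
  have eq: "foldl (\<lambda>acc x. if P e x then x # acc else acc) acc ys = rev (filter (P e) ys) @ acc" for acc ys e
    by (induction ys arbitrary: acc) auto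
  have le: "size (code (filter (P e) ys)) \<le> size (code ys)" for e ys
    by (induction ys) auto
  have "pt (\<lambda>e. foldl (\<lambda>acc x. if P e x then x # acc else acc) [] (xs e))"
  proof (rule pt_foldl[where b = "\<lambda>e. size (code (xs e))"])
    show "size (code (foldl (\<lambda>acc x. if P e x then x # acc else acc) [] (take i (xs e)))) \<le> size (code (xs e))" for i e
      unfolding eq using le[of e "take i (xs e)"] size_code_take[of i "xs e"] by simp
    have "pt (\<lambda>z::('a \<times> 'b list \<times> 'b). P (fst z) (snd (snd z)))"
      using pt_comp[OF assms(1), of "\<lambda>z. (fst z, snd (snd z))"] by (simp add: pt_intros)
    then show "pt (\<lambda>z. if P (fst z) (snd (snd z)) then snd (snd z) # fst (snd z) else fst (snd z))"
      by (intro pt_intros)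
  qed (intro pt_intros assms pb_size_pt)+
  then have "pt (\<lambda>e. rev (filter (P e) (xs e)))" unfolding eq by simp
  then show ?thesis using pt_rev by fastforce
qed

lemma pt_list_all [pt_intros]:
  assumes "pt (\<lambda>z. P (fst z) (snd z))" "pt xs" shows "pt (\<lambda>e. list_all (P e) (xs e))"
proof -
  have "list_all (P e) ys \<longleftrightarrow> filter (\<lambda>x. \<not> P e x) ys = []" for e ys
    by (induction ys) auto
  moreover have "ys = [] \<longleftrightarrow> (case ys of [] \<Rightarrow> True | _ \<Rightarrow> False)" for ys :: "'b list"
    by (cases ys) auto
  ultimately have "list_all (P e) (xs e) \<longleftrightarrow>
    (case filter (\<lambda>x. \<not> P e x) (xs e) of [] \<Rightarrow> True | _ \<Rightarrow> False)" for e
    by metis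
  then show ?thesis by (simp only:) (intro pt_intros assms)
qed

lemma pt_concat [pt_intros]:
  assumes "pt xs" shows "pt (\<lambda>e. concat (xs e))"
proof -
  have eq: "foldl (\<lambda>acc x. acc @ x) acc ys = acc @ concat ys" for acc and ys :: "'b list list"
    by (induction ys arbitrary: acc) auto
  have le: "size (code (concat ys)) \<le> size (code ys)" for ys :: "'b list list"
    by (induction ys) (auto simp: size_code_append)
  have "pt (\<lambda>e. foldl (\<lambda>acc x. acc @ x) [] (xs e))"
  proof (rule pt_foldl[where b = "\<lambda>e. size (code (xs e))"])
    show "size (code (foldl (\<lambda>acc x. acc @ x) [] (take i (xs e)))) \<le> size (code (xs e))" for i e
      unfolding eq using le[of "take i (xs e)"] size_code_take[of i "xs e"] by simp
  qed (intro pt_intros assms pb_size_pt)+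
  then show ?thesis unfolding eq by simp
qed

lemma pt_length [pt_intros]:
  assumes "pt xs" shows "pt (\<lambda>e. length (xs e))"
  by (rule pt_recode[of "\<lambda>e. map (\<lambda>_. ()) (xs e)"])
     (intro pt_intros assms, metis code_length_unit length_map)

lemma foldl_const_replicate: "foldl (\<lambda>acc _. f acc) a (replicate n ()) = (f ^^ n) a"
  by (induction n arbitrary: a) (auto simp: funpow_swap1)

lemma pt_funpow:
  fixes f :: "'a::codable \<Rightarrow> 'b::codable \<Rightarrow> 'b"
  assumes "pt (\<lambda>z. f (fst z) (snd z))" "pt a" "pt n" "pb b"
    and "\<And>e i. i \<le> n e \<Longrightarrow> size (code ((f e ^^ i) (a e))) \<le> b e"
  shows "pt (\<lambda>e. (f e ^^ n e) (a e))"
proof -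
  have "pt (\<lambda>e. foldl (\<lambda>acc _. f e acc) (a e) (replicate (n e) ()))"
  proof (rule pt_foldl[OF _ _ _ \<open>pb b\<close>])
    show "pt (\<lambda>z::'a \<times> 'b \<times> unit. f (fst z) (fst (snd z)))"
      using pt_comp[OF assms(1), of "\<lambda>z. (fst z, fst (snd z))"] by (simp add: pt_intros)
    show "size (code (foldl (\<lambda>acc _. f e acc) (a e) (take i (replicate (n e) ())))) \<le> b e"
      if "i \<le> length (replicate (n e) ())" for e i
      using that assms(5)[of i e] by (simp add: foldl_const_replicate take_replicate min_def)
  qed (intro pt_intros assms)+
  then show ?thesis unfolding foldl_const_replicate .
qed

lemma pt_add [pt_intros]:
  assumes "pt f" "pt g" shows "pt (\<lambda>e. f e + g e :: nat)"
proof -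
  have eq: "(Suc ^^ n) m = m + n" for m n by (induction n) auto
  have "pt (\<lambda>e. (Suc ^^ g e) (f e))"
    by (rule pt_funpow[where b = "\<lambda>e. f e + g e"]) ((intro pt_intros assms pb_add pb_nat)+, simp add: eq)
  then show ?thesis unfolding eq .
qed

lemma pt_mult [pt_intros]:
  assumes "pt f" "pt g" shows "pt (\<lambda>e. f e * g e :: nat)"
proof -
  have eq: "((\<lambda>a. a + m) ^^ n) 0 = m * n" for m n :: nat by (induction n) auto
  have "pt (\<lambda>e. ((\<lambda>a. a + f e) ^^ g e) 0)"
    by (rule pt_funpow[where b = "\<lambda>e. f e * g e"])
      ((intro pt_intros assms pb_mult pb_nat pt_comp[OF assms(1)])+, simp add: eq)
  then show ?thesis unfolding eq .
qed

lemma pt_diff [pt_intros]: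
  assumes "pt f" "pt g" shows "pt (\<lambda>e. f e - g e :: nat)"
proof -
  have eq: "((\<lambda>a. case a of 0 \<Rightarrow> 0 | Suc b \<Rightarrow> b) ^^ n) m = m - n" for m n :: nat
    by (induction n) (auto split: nat.split)
  have "pt (\<lambda>e. ((\<lambda>a. case a of 0 \<Rightarrow> 0 | Suc b \<Rightarrow> b) ^^ g e) (f e))"
    by (rule pt_funpow[where b = "\<lambda>e. f e"])
      ((intro pt_intros assms pb_nat)+, simp add: eq)
  then show ?thesis unfolding eq .
qed

lemma pt_nat_eq_0 [pt_intros]:
  assumes "pt f" shows "pt (\<lambda>e. f e = (0::nat))"
proof -
  have "n = 0 \<longleftrightarrow> (case n of 0 \<Rightarrow> True | Suc _ \<Rightarrow> False)" for n :: nat by (cases n) auto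
  then show ?thesis by (simp only:) (intro pt_intros assms)
qed

lemma pt_nat_le [pt_intros]:
  assumes "pt f" "pt g" shows "pt (\<lambda>e. f e \<le> (g e :: nat))"
proof -
  have "m \<le> n \<longleftrightarrow> m - n = 0" for m n :: nat by auto
  then show ?thesis by (simp only:) (intro pt_intros assms)
qed

lemma pt_nat_less [pt_intros]:
  assumes "pt f" "pt g" shows "pt (\<lambda>e. f e < (g e :: nat))"
  unfolding Suc_le_eq[symmetric] by (intro pt_intros assms)

lemma pt_nat_eq [pt_intros]:
  assumes "pt f" "pt g" shows "pt (\<lambda>e. f e = (g e :: nat))"
  unfolding order_eq_iff by (intro pt_intros assms)

lemma pt_mod [pt_intros]:
  assumes "pt f" "pt g" shows "pt (\<lambda>e. f e mod g e :: nat)"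
proof -
  \<comment> \<open>A counter that wraps around at \<open>m\<close>. For \<open>m = 0\<close> it
    never wraps, in agreement with \<open>n mod 0 = n\<close>.\<close>
  have eq: "((\<lambda>a. if Suc a = m then 0 else Suc a) ^^ n) 0 = n mod m" for m n :: nat
    by (induction n) (auto simp: mod_Suc)
  have "pt (\<lambda>e. ((\<lambda>a. if Suc a = g e then 0 else Suc a) ^^ f e) 0)"
  proof (rule pt_funpow[where b = "\<lambda>e. f e"])
    show "size (code (((\<lambda>a. if Suc a = g e then 0 else Suc a) ^^ i) 0)) \<le> f e" if "i \<le> f e" for e i
      unfolding eq using that by (simp add: order_trans[OF mod_less_eq_dividend])
  qed (intro pt_intros assms pb_nat pt_comp[OF assms(2)])+
  then show ?thesis unfolding eq .
qed

lemma pt_upt [pt_intros]: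
  assumes "pt f" "pt g" shows "pt (\<lambda>e. [f e..<g e])"
proof -
  have eq: "((\<lambda>a. a @ [m + length a]) ^^ n) [] = [m..<m + n]" for m n :: nat
    by (induction n) auto
  have "pt (\<lambda>e. ((\<lambda>a. a @ [f e + length a]) ^^ (g e - f e)) [])"
  proof (rule pt_funpow[where b = "\<lambda>e. (g e - f e) * (f e + (g e - f e) + 1)"])
    show "pb (\<lambda>e. (g e - f e) * (f e + (g e - f e) + 1))"
      by (intro pb_mult pb_add pb_const pb_nat pt_intros assms)
    fix e i assume i: "i \<le> g e - f e"
    have "size (code [f e..<f e + i]) \<le> length [f e..<f e + i] * (f e + (g e - f e) + 1)"
      by (rule size_code_list_le) (use i in auto)
    also have "\<dots> \<le> (g e - f e) * (f e + (g e - f e) + 1)" by (intro mult_right_mono) (use i in auto)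
    finally show "size (code (((\<lambda>a. a @ [f e + length a]) ^^ i) [])) \<le> (g e - f e) * (f e + (g e - f e) + 1)"
      unfolding eq .
  qed (intro pt_intros assms pt_comp[OF assms(1)])+
  moreover have "((\<lambda>a. a @ [f e + length a]) ^^ (g e - f e)) [] = [f e..<g e]" for e
    unfolding eq by (cases "f e \<le> g e") auto
  ultimately show ?thesis by simp
qed

lemma pt_replicate [pt_intros]:
  assumes "pt n" "pt x" shows "pt (\<lambda>e. replicate (n e) (x e))"
proof -
  have "pt (\<lambda>e. map (\<lambda>_. x e) (replicate (n e) ()))"
    by (intro pt_intros assms pt_comp[OF assms(2)])
  then show ?thesis by simp
qed

lemma pt_div [pt_intros]:
  assumes "pt f" "pt g" shows "pt (\<lambda>e. f e div g e :: nat)"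
proof -
  \<comment> \<open>The quotient counts the multiples of \<open>m\<close> among
    \<open>1, ..., n\<close>; for \<open>m = 0\<close> there are none, in agreement with
    \<open>n div 0 = 0\<close>.\<close>
  have eq: "length (filter (\<lambda>i. Suc i mod m = 0) [0..<n]) = n div m" for m n :: nat
    by (induction n) (auto simp: div_Suc)
  have "pt (\<lambda>e. length (filter (\<lambda>i. Suc i mod g e = 0) [0..<f e]))"
    by (intro pt_intros assms pt_comp[OF assms(2)])
  then show ?thesis unfolding eq .
qed

lemma pt_drop [pt_intros]:
  assumes "pt n" "pt xs" shows "pt (\<lambda>e. drop (n e) (xs e))"
proof -
  have eq: "((\<lambda>a. case a of [] \<Rightarrow> [] | y # ys \<Rightarrow> ys) ^^ n) xs = drop n xs" for n and xs :: "'b list"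
  proof -
    have "(\<lambda>a. case a of [] \<Rightarrow> [] | y # ys \<Rightarrow> ys) = (tl :: 'b list \<Rightarrow> 'b list)"
      by (auto simp: fun_eq_iff split: list.split)
    then show ?thesis by (induction n) (auto simp: drop_Suc tl_drop)
  qed
  have le: "size (code (drop i ys)) \<le> size (code ys)" for i and ys :: "'b list"
    by (metis append_take_drop_id le_add2 size_code_append)
  have "pt (\<lambda>e. ((\<lambda>a. case a of [] \<Rightarrow> [] | y # ys \<Rightarrow> ys) ^^ n e) (xs e))"
    by (rule pt_funpow[where b = "\<lambda>e. size (code (xs e))"])
      ((intro pt_intros assms pb_size_pt)+, simp add: eq le)
  then show ?thesis unfolding eq .
qed

lemma pt_take [pt_intros]:
  assumes "pt n" "pt xs" shows "pt (\<lambda>e. take (n e) (xs e))"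
proof -
  have eq: "rev (drop (length xs - n) (rev xs)) = take n xs" for n and xs :: "'b list"
    by (cases "n \<le> length xs") (simp_all add: rev_drop)
  have "pt (\<lambda>e. rev (drop (length (xs e) - n e) (rev (xs e))))"
    by (intro pt_intros assms)
  then show ?thesis unfolding eq .
qed

text \<open>List access with a default has a known value on all indices, whereas \<open>!\<close> is
  unspecified beyond the end. Functions to be shown polynomial-time therefore use
  \<open>nth_default\<close>.\<close>

lemma pt_nth_default [pt_intros]:
  assumes "pt d" "pt xs" "pt n" shows "pt (\<lambda>e. nth_default (d e) (xs e) (n e))"
proof -
  have eq: "nth_default d xs n = (case drop n xs of [] \<Rightarrow> d | y # ys \<Rightarrow> y)" for d n and xs :: "'b list"
    by (auto simp: nth_default_def Cons_nth_drop_Suc[symmetric] split: list.split)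
  show ?thesis unfolding eq by (intro pt_intros assms)
qed

lemma pt_list_update [pt_intros]:
  assumes "pt xs" "pt n" "pt x" shows "pt (\<lambda>e. (xs e)[n e := x e])"
proof -
  have eq: "xs[n := x] = (if n < length xs then take n xs @ x # drop (Suc n) xs else xs)"
    for n x and xs :: "'b list"
    by (auto simp: upd_conv_take_nth_drop list_update_beyond)
  show ?thesis unfolding eq by (intro pt_intros assms)
qed

lemma pt_zip [pt_intros]:
  assumes "pt xs" "pt ys" shows "pt (\<lambda>e. zip (xs e) (ys e))"
proof -
  have eq: "zip xs ys = concat (map (\<lambda>i. case drop i xs of [] \<Rightarrow> [] | x # _ \<Rightarrow>
      (case drop i ys of [] \<Rightarrow> [] | y # _ \<Rightarrow> [(x, y)])) [0..<length xs])" for xs :: "'b list" and ys :: "'c list"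
  proof (induction xs arbitrary: ys)
    case (Cons x xs)
    show ?case
    proof (cases ys)
      case Nil
      then show ?thesis by (auto split: list.split)
    next
      case (Cons y zs)
      have "[0..<length (x # xs)] = 0 # map Suc [0..<length xs]"
        using upt_conv_Cons[of 0 "Suc (length xs)"] by (simp add: map_Suc_upt del: upt_Suc)
      then show ?thesis unfolding \<open>ys = y # zs\<close> using Cons.IH[of zs] by (simp add: o_def cong: list.case_cong)
    qed
  qed simp
  show ?thesis unfolding eq by (intro pt_intros assms pt_comp[OF assms(1)] pt_comp[OF assms(2)])
qed

section \<open>Arithmetization of reachability\<close>

datatype op = Lin nat | All nat | Ex nat | Mux nat nat nat nat | Check

text \<open>Operators are listed from the outermost to the innermost one.  \<open>Check\<close> ends a repetition of the
  protocol: there the claim is compared with the innermost polynomial.\<close>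

fun sem :: "(int list \<Rightarrow> int) \<Rightarrow> op list \<Rightarrow> int list \<Rightarrow> int" where
  "sem g [] r = g r"
| "sem g (Check # os) r = g r"
| "sem g (Lin j # os) r = (1 - r ! j) * sem g os (r[j := 0]) + r ! j * sem g os (r[j := 1])"
| "sem g (All j # os) r = sem g os (r[j := 0]) * sem g os (r[j := 1])"
| "sem g (Ex j # os) r = sem g os (r[j := 0]) + (1 - sem g os (r[j := 0])) * sem g os (r[j := 1])"
| "sem g (Mux z a c b # os) r = sem g os (r[z := (1 - r ! b) * r ! a + r ! b * r ! c])"

text \<open>The quantified Boolean formula that \<open>sem\<close> arithmetizes. \<open>Lin\<close>
  is the identity here because linearization keeps the values at Boolean points.\<close>

fun bsem :: "(bool list \<Rightarrow> bool) \<Rightarrow> op list \<Rightarrow> bool list \<Rightarrow> bool" where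
  "bsem G [] y = G y"
| "bsem G (Check # os) y = G y"
| "bsem G (Lin j # os) y = bsem G os y"
| "bsem G (All j # os) y = (bsem G os (y[j := False]) \<and> bsem G os (y[j := True]))"
| "bsem G (Ex j # os) y = (bsem G os (y[j := False]) \<or> bsem G os (y[j := True]))"
| "bsem G (Mux z a c b # os) y = bsem G os (y[z := (if y ! b then y ! c else y ! a)])"

fun op_below :: "nat \<Rightarrow> op \<Rightarrow> bool" where
  "op_below M (Lin j) = (j < M)"
| "op_below M (All j) = (j < M)"
| "op_below M (Ex j) = (j < M)"
| "op_below M (Mux z a c b) = (z < M \<and> a < M \<and> c < M \<and> b < M)"
| "op_below M Check = True"

lemma sem_append_Check: "Check \<notin> set os \<Longrightarrow> sem g (os @ Check # rest) r = sem g os r"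
proof (induction os arbitrary: r)
  case (Cons x xs)
  then show ?case by (cases x) auto
qed simp

lemma map_of_bool_update: "(map of_bool y)[j := of_bool b] = map of_bool (y[j := b])"
  by (simp add: map_update)

text \<open>Each operator maps polynomials that are 0 or 1 on Boolean points to such polynomials.
  The equality is one of integers, so later only \<open>0 \<noteq> 1\<close> modulo the prime has to
  be added.\<close>

lemma sem_bool:
  assumes "\<And>y. length y = M \<Longrightarrow> g (map of_bool y) = of_bool (G y)"
    and "\<forall>x \<in> set os. op_below M x" "length y = M"
  shows "sem g os (map of_bool y) = of_bool (bsem G os y)"
  using assms(2,3)
proof (induction os arbitrary: y)
  case (Cons x os)
  have IH: "sem g os ((map of_bool y)[j := of_bool b]) = of_bool (bsem G os (y[j := b]))" for j b
    unfolding map_of_bool_update by (rule Cons.IH) (use Cons.prems in auto)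
  note IH0 = IH[of _ False, simplified] and IH1 = IH[of _ True, simplified]
  show ?case
  proof (cases x)
    case (Lin j)
    have "y[j := y ! j] = y" by simp
    then show ?thesis using Lin IH0[of j] IH1[of j] Cons.prems by (cases "y ! j") auto
  next
    case (Mux z a c b)
    then have "sem g (x # os) (map of_bool y) = sem g os ((map of_bool y)[z := of_bool (if y ! b then y ! c else y ! a)])"
      using Cons.prems by simp
    also note IH
    finally show ?thesis using Mux by simp
  qed (use IH0 IH1 assms(1) Cons.prems in auto)
qed (use assms(1) in simp)

text \<open>The parties keep reduced points while \<open>sem\<close> substitutes unreduced integers
  at a \<open>Mux\<close>; this property lets one be exchanged for the other.\<close>

definition pcong :: "int \<Rightarrow> nat \<Rightarrow> (int list \<Rightarrow> int) \<Rightarrow> bool" where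
  "pcong p M f \<longleftrightarrow> (\<forall>r r'. length r = M \<longrightarrow> list_all2 (\<lambda>a b. [a = b] (mod p)) r r' \<longrightarrow> [f r = f r'] (mod p))"

lemma pcong_sem:
  assumes "pcong p M g" "\<forall>x \<in> set os. op_below M x"
  shows "pcong p M (sem g os)"
  using assms(2)
proof (induction os)
  case (Cons x os)
  have IH: "[sem g os r = sem g os r'] (mod p)" if "length r = M" "list_all2 (\<lambda>a b. [a = b] (mod p)) r r'" for r r'
    using Cons that by (auto simp: pcong_def)
  show ?case unfolding pcong_def
  proof (intro allI impI)
    fix r r' assume r: "length r = M" "list_all2 (\<lambda>a b. [a = b] (mod p)) r r'"
    have upd: "[sem g os (r[j := a]) = sem g os (r'[j := b])] (mod p)" if "[a = b] (mod p)" for j a b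
      using r that by (intro IH list_all2_update_cong) auto
    have nth: "[r ! j = r' ! j] (mod p)" if "j < M" for j
      using r that by (auto simp: list_all2_conv_all_nth)
    show "[sem g (x # os) r = sem g (x # os) r'] (mod p)"
      using Cons.prems assms(1) r
      by (cases x) (auto simp: pcong_def intro!: cong_add cong_mult cong_diff upd nth)
  qed
qed (use assms(1) in \<open>simp add: pcong_def\<close>)

section \<open>Degrees of the univariate restrictions\<close>

definition lin :: "nat \<Rightarrow> (int list \<Rightarrow> int) \<Rightarrow> nat \<Rightarrow> bool" where
  "lin M f i \<longleftrightarrow> (\<forall>r X. length r = M \<longrightarrow> f (r[i := X]) = f (r[i := 0]) + X * (f (r[i := 1]) - f (r[i := 0])))"

definition quad :: "nat \<Rightarrow> (int list \<Rightarrow> int) \<Rightarrow> nat \<Rightarrow> bool" where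
  "quad M f i \<longleftrightarrow> (\<forall>r. length r = M \<longrightarrow> (\<exists>a b c. \<forall>X. f (r[i := X]) = a + b * X + c * X\<^sup>2))"

lemma linD: "lin M f i \<Longrightarrow> length r = M \<Longrightarrow> f (r[i := X]) = f (r[i := 0]) + X * (f (r[i := 1]) - f (r[i := 0]))"
  unfolding lin_def by blast

lemma quadI_lin:
  assumes "lin M f i" shows "quad M f i"
  unfolding quad_def
proof (intro allI impI)
  fix r :: "int list" assume r: "length r = M"
  have "f (r[i := X]) = f (r[i := 0]) + (f (r[i := 1]) - f (r[i := 0])) * X + 0 * X\<^sup>2" for X
    unfolding linD[OF assms r, of X] by simp
  then show "\<exists>a b c. \<forall>X. f (r[i := X]) = a + b * X + c * X\<^sup>2" by blast
qed

text \<open>\<open>f\<close> is affine separately in the variables \<open>i\<close> and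
  \<open>z\<close>. Putting the affine \<open>u + v * X\<close> for \<open>z\<close> and
  \<open>X\<close> for \<open>i\<close> gives degree at most 2 in \<open>X\<close>; this is the
  degree bound for a multiplexer.\<close>

lemma quadI_two_lin:
  assumes "lin M f i" "lin M f z" "i \<noteq> z"
    and h: "\<And>r. length r = M \<Longrightarrow> \<exists>u v. \<forall>X. h (r[i := X]) = u + v * X"
  shows "quad M (\<lambda>r. f (r[z := h r])) i"
  unfolding quad_def
proof (intro allI impI)
  fix r :: "int list" assume r: "length r = M"
  obtain u v where uv: "\<And>X. h (r[i := X]) = u + v * X" using h[OF r] by blast
  define F where "F X Y = f (r[i := X, z := Y])" for X Y
  have 1: "F X Y = F X 0 + Y * (F X 1 - F X 0)" for X Y
    unfolding F_def by (rule linD[OF assms(2)]) (simp add: r)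
  have 2: "F X Y = F 0 Y + X * (F 1 Y - F 0 Y)" for X Y
    unfolding F_def list_update_swap[OF \<open>i \<noteq> z\<close>] by (rule linD[OF assms(1)]) (simp add: r)
  have "F X (u + v * X) = F 0 0 + X * (F 1 0 - F 0 0) + (u + v * X) *
     ((F 0 1 + X * (F 1 1 - F 0 1)) - (F 0 0 + X * (F 1 0 - F 0 0)))" for X
    using 1[of X "u + v * X"] 2[of X 0] 2[of X 1] by simp
  then have "f (r[i := X, z := h (r[i := X])]) =
      (F 0 0 + u * (F 0 1 - F 0 0))
      + (F 1 0 - F 0 0 + u * (F 1 1 - F 0 1 - F 1 0 + F 0 0) + v * (F 0 1 - F 0 0)) * X
      + (v * (F 1 1 - F 0 1 - F 1 0 + F 0 0)) * X\<^sup>2" for X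
    unfolding uv F_def[symmetric] by (simp add: algebra_simps power2_eq_square)
  then show "\<exists>a b c. \<forall>X. f (r[i := X, z := h (r[i := X])]) = a + b * X + c * X\<^sup>2" by blast
qed

lemma lin_Lin_same:
  assumes "j < M" shows "lin M (sem g (Lin j # os)) j"
  using assms unfolding lin_def by (auto simp: algebra_simps)

lemma lin_Lin_other:
  assumes "lin M (sem g os) i" "i \<noteq> j" shows "lin M (sem g (Lin j # os)) i"
  unfolding lin_def
proof (intro allI impI)
  fix r :: "int list" and X assume r: "length r = M"
  have "sem g os (r[i := X, j := y]) = sem g os (r[i := 0, j := y]) +
      X * (sem g os (r[i := 1, j := y]) - sem g os (r[i := 0, j := y]))" for y
    unfolding list_update_swap[OF assms(2)] by (rule linD[OF assms(1)]) (simp add: r)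
  from this[of 0] this[of 1] show "sem g (Lin j # os) (r[i := X]) = sem g (Lin j # os) (r[i := 0]) +
      X * (sem g (Lin j # os) (r[i := 1]) - sem g (Lin j # os) (r[i := 0]))"
    using assms(2) by (simp add: nth_list_update) (simp add: algebra_simps)
qed

lemma quad_Lin_other:
  assumes "quad M (sem g os) i" "i \<noteq> j" shows "quad M (sem g (Lin j # os)) i"
  unfolding quad_def
proof (intro allI impI)
  fix r :: "int list" assume r: "length r = M"
  have "\<exists>a b c. \<forall>X. sem g os (r[i := X, j := y]) = a + b * X + c * X\<^sup>2" for y
    using assms(1) r unfolding list_update_swap[OF assms(2)] quad_def by simp
  then obtain a b c where abc: "\<And>y X. sem g os (r[i := X, j := y]) = a y + b y * X + c y * X\<^sup>2" by metis
  have "sem g (Lin j # os) (r[i := X]) = ((1 - r ! j) * a 0 + r ! j * a 1)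
      + ((1 - r ! j) * b 0 + r ! j * b 1) * X + ((1 - r ! j) * c 0 + r ! j * c 1) * X\<^sup>2" for X
    using assms(2) abc by (simp add: nth_list_update) (simp add: algebra_simps)
  then show "\<exists>a b c. \<forall>X. sem g (Lin j # os) (r[i := X]) = a + b * X + c * X\<^sup>2" by blast
qed

lemma lin_update_pair:
  assumes "lin M f i" "length r = M" "i \<noteq> j"
  shows "f (r[i := X, j := y]) = f (r[i := 0, j := y]) + (f (r[i := 1, j := y]) - f (r[i := 0, j := y])) * X"
proof -
  have "f (r[j := y, i := X]) = f (r[j := y, i := 0]) + X * (f (r[j := y, i := 1]) - f (r[j := y, i := 0]))"
    by (rule linD[OF assms(1)]) (simp add: assms(2))
  then show ?thesis unfolding list_update_swap[OF assms(3)] by (simp only: mult.commute)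
qed

text \<open>A quantifier combines two slices that are affine in \<open>i\<close>, at worst by a
  product. A multiplexer substitutes an expression that is affine in each variable, since the
  selector \<open>b\<close> differs from \<open>a\<close> and \<open>c\<close>.\<close>

lemma quad_op:
  assumes lin: "\<And>i. i < M \<Longrightarrow> lin M (sem g os) i" and x: "op_below M x" "x \<noteq> Check" "\<nexists>j. x = Lin j"
    and mux: "\<And>z a c b. x = Mux z a c b \<Longrightarrow> a \<noteq> b \<and> c \<noteq> b \<and> z \<noteq> b"
    and "i < M"
  shows "quad M (sem g (x # os)) i"
proof -
  \<comment> \<open>Covers both quantifiers: \<open>All\<close> is the product \<open>u * v\<close>
    (\<open>\<gamma> = 0\<close>, \<open>\<delta> = 1\<close>) and \<open>Ex\<close> is
    \<open>u + v - u * v\<close> (\<open>\<gamma> = 1\<close>,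
    \<open>\<delta> = -1\<close>).\<close>
  have quant: "quad M (sem g (x # os)) i"
    if comb: "\<And>r. sem g (x # os) r = \<gamma> * (sem g os (r[j := 0]) + sem g os (r[j := 1])) + \<delta> * (sem g os (r[j := 0]) * sem g os (r[j := 1]))"
    for \<gamma> \<delta> j
    unfolding quad_def
  proof (intro allI impI)
    fix r :: "int list" assume r: "length r = M"
    \<comment> \<open>For \<open>i = j\<close> both slices overwrite the variable, so they are
      constant in \<open>X\<close> and the slope \<open>B\<close> is 0.\<close>
    define A B where "A = (\<lambda>y. sem g os (r[i := 0, j := y]))"
      and "B = (\<lambda>y. if i = j then 0 else sem g os (r[i := 1, j := y]) - sem g os (r[i := 0, j := y]))"
    have "sem g os (r[i := X, j := y]) = A y + B y * X" for X y
      unfolding A_def B_def using lin_update_pair[OF lin[OF \<open>i < M\<close>] r, of j X y] by (cases "i = j") auto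
    then have "sem g (x # os) (r[i := X]) = (\<gamma> * (A 0 + A 1) + \<delta> * (A 0 * A 1)) +
        (\<gamma> * (B 0 + B 1) + \<delta> * (A 0 * B 1 + A 1 * B 0)) * X + \<delta> * (B 0 * B 1) * X\<^sup>2" for X
      by (simp add: comb algebra_simps power2_eq_square)
    then show "\<exists>a b c. \<forall>X. sem g (x # os) (r[i := X]) = a + b * X + c * X\<^sup>2" by blast
  qed
  show ?thesis
  proof (cases x)
    case (All j)
    then show ?thesis by (intro quant[where \<gamma> = 0 and \<delta> = 1]) simp
  next
    case (Ex j)
    then show ?thesis by (intro quant[where \<gamma> = 1 and \<delta> = "-1"]) (simp add: algebra_simps)
  next
    case (Mux z a c b)
    have d: "a \<noteq> b" "c \<noteq> b" "z \<noteq> b" "z < M" "a < M" "c < M" "b < M" using mux[OF Mux] x Mux by auto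
    define h where "h = (\<lambda>r :: int list. (1 - r ! b) * r ! a + r ! b * r ! c)"
    have h: "\<exists>u v. \<forall>X. h (r[i := X]) = u + v * X" if "length r = M" for r
    proof (cases "i = b")
      case True
      have "h (r[i := X]) = r ! a + (r ! c - r ! a) * X" for X
        using d that True by (simp add: h_def algebra_simps)
      then show ?thesis by blast
    next
      case False
      define u v where "u = (if a = i then 0 else (1 - r ! b) * r ! a) + (if c = i then 0 else r ! b * r ! c)"
        and "v = (if a = i then 1 - r ! b else 0) + (if c = i then r ! b else 0)"
      have "h (r[i := X]) = u + v * X" for X
        using d that False by (auto simp: h_def u_def v_def nth_list_update algebra_simps)
      then show ?thesis by blast
    qed
    have eq: "sem g (x # os) = (\<lambda>r. sem g os (r[z := h r]))" using Mux by (auto simp: h_def fun_eq_iff)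
    show ?thesis
    \<comment> \<open>For \<open>i \<noteq> z\<close> the value \<open>X\<close> enters both
      directly and through \<open>h\<close>. For \<open>i = z\<close> the direct occurrence is
      overwritten and only \<open>h\<close> is left.\<close>
    proof (cases "i = z")
      case False
      then show ?thesis unfolding eq using lin \<open>i < M\<close> \<open>z < M\<close> h by (intro quadI_two_lin) auto
    next
      case True
      show ?thesis unfolding quad_def eq
      proof (intro allI impI)
        fix r :: "int list" assume r: "length r = M"
        obtain u v where uv: "\<And>X. h (r[i := X]) = u + v * X" using h[OF r] by blast
        have L: "sem g os (r[z := Y]) = sem g os (r[z := 0]) + Y * (sem g os (r[z := 1]) - sem g os (r[z := 0]))" for Y
          by (rule linD[OF lin[OF \<open>z < M\<close>] r])
        have "sem g os (r[i := X, z := h (r[i := X])]) =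
          (sem g os (r[z := 0]) + u * (sem g os (r[z := 1]) - sem g os (r[z := 0])))
          + (v * (sem g os (r[z := 1]) - sem g os (r[z := 0]))) * X + 0 * X\<^sup>2" for X
          unfolding True list_update_overwrite uv[unfolded True] by (subst L) (simp add: algebra_simps)
        then show "\<exists>a b c. \<forall>X. sem g os (r[i := X, z := h (r[i := X])]) = a + b * X + c * X\<^sup>2" by blast
      qed
    qed
  qed (use x in auto)
qed

text \<open>All univariate restrictions that occur in the course of the protocol are quadratic.\<close>

fun deg_ok :: "nat \<Rightarrow> (int list \<Rightarrow> int) \<Rightarrow> op list \<Rightarrow> bool" where
  "deg_ok M g [] = True"
| "deg_ok M g (x # os) = (deg_ok M g os \<and> op_below M x \<and> x \<noteq> Check \<and>
    (\<forall>j. x \<in> {Lin j, All j, Ex j} \<longrightarrow> quad M (sem g os) j))"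

lemma deg_ok_below: "deg_ok M g os \<Longrightarrow> \<forall>x \<in> set os. op_below M x"
  by (induction os) auto

lemma deg_ok_Check: "deg_ok M g os \<Longrightarrow> Check \<notin> set os"
  by (induction os) auto

text \<open>As outer operators come first, the \<open>Lin\<close> block behind an operator makes the
  polynomial on which it acts linear in every variable.\<close>

definition linearize :: "nat \<Rightarrow> op list \<Rightarrow> op list" where
  "linearize M os = concat (map (\<lambda>x. x # map Lin [0..<M]) os)"

text \<open>The induction goes down from \<open>M\<close>: \<open>Lin n\<close> stands outside the
  block for \<open>Suc n\<close>, makes variable \<open>n\<close> linear, and preserves both the
  linearity in the later variables and the degree 2 in the earlier ones.\<close>

lemma Lin_block:
  assumes q: "\<And>i. i < M \<Longrightarrow> quad M (sem g os) i" and ok: "deg_ok M g os" and "n \<le> M"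
  shows "deg_ok M g (map Lin [n..<M] @ os) \<and>
    (\<forall>i<M. quad M (sem g (map Lin [n..<M] @ os)) i) \<and>
    (\<forall>i<M. n \<le> i \<longrightarrow> lin M (sem g (map Lin [n..<M] @ os)) i)"
  using \<open>n \<le> M\<close>
proof (induction n rule: inc_induct)
  case (step n)
  have eq: "map Lin [n..<M] @ os = Lin n # map Lin [Suc n..<M] @ os"
    using step.hyps by (simp add: upt_conv_Cons)
  let ?f = "map Lin [Suc n..<M] @ os"
  have "lin M (sem g (Lin n # ?f)) i" if "i < M" "n \<le> i" for i
    using lin_Lin_same[of n M g ?f] lin_Lin_other[of M g ?f i n] step that by (cases "i = n") auto
  moreover have "quad M (sem g (Lin n # ?f)) i" if "i < M" for i
    using quadI_lin[OF lin_Lin_same[of n M g ?f]] quad_Lin_other[of M g ?f i n] step that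
    by (cases "i = n") auto
  moreover have "deg_ok M g (Lin n # ?f)" using step by simp
  ultimately show ?case unfolding eq by blast
qed (use q ok in auto)

fun proper_op :: "nat \<Rightarrow> op \<Rightarrow> bool" where
  "proper_op M (All j) = (j < M)"
| "proper_op M (Ex j) = (j < M)"
| "proper_op M (Mux z a c b) = (z < M \<and> a < M \<and> c < M \<and> b < M \<and> a \<noteq> b \<and> c \<noteq> b \<and> z \<noteq> b)"
| "proper_op M x = False"

lemma deg_ok_linearize:
  assumes "\<And>i. i < M \<Longrightarrow> lin M g i"
    and "\<forall>x \<in> set os. proper_op M x"
  shows "deg_ok M g (linearize M os) \<and> (\<forall>i<M. quad M (sem g (linearize M os)) i)"
proof -
  \<comment> \<open>Strengthened for the induction: behind a further \<open>Lin\<close> block the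
    polynomial is linear in all variables, as the next outer operator requires.\<close>
  have "deg_ok M g (map Lin [0..<M] @ linearize M os) \<and>
      (\<forall>i<M. lin M (sem g (map Lin [0..<M] @ linearize M os)) i) \<and> deg_ok M g (linearize M os) \<and>
      (\<forall>i<M. quad M (sem g (linearize M os)) i)"
    using assms(2)
  proof (induction os)
    case Nil
    have "quad M (sem g []) i" if "i < M" for i
      using quadI_lin[OF assms(1)[OF that]] by (simp add: quad_def)
    moreover have "sem g [] = g" by (simp add: fun_eq_iff)
    ultimately show ?case using Lin_block[of M g "[]" 0] by (simp add: linearize_def)
  next
    case (Cons x os)
    let ?l = "map Lin [0..<M] @ linearize M os"
    have "proper_op M x" using Cons.prems by simp
    then have x: "op_below M x" "x \<noteq> Check" "\<nexists>j. x = Lin j"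
      "\<And>z a c b. x = Mux z a c b \<Longrightarrow> a \<noteq> b \<and> c \<noteq> b \<and> z \<noteq> b" by (cases x; simp)+
    have "deg_ok M g ?l \<and> (\<forall>i<M. lin M (sem g ?l) i)" using Cons.IH Cons.prems by (meson list.set_intros(2))
    then have lin: "\<And>i. i < M \<Longrightarrow> lin M (sem g ?l) i" and ok: "deg_ok M g ?l" by blast+
    have eq: "linearize M (x # os) = x # ?l" by (simp add: linearize_def)
    have q: "quad M (sem g (linearize M (x # os))) i" if "i < M" for i
      unfolding eq by (rule quad_op[OF lin x(1-3) _ that]) (assumption | erule x(4))+
    have ok': "deg_ok M g (linearize M (x # os))"
      unfolding eq using ok \<open>proper_op M x\<close> quadI_lin[OF lin] by (cases x) auto
    show ?case using Lin_block[OF q ok' le0] q ok' by blast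
  qed
  then show ?thesis by blast
qed

lemma bsem_Lin_append [simp]: "bsem G (map Lin xs @ os) y = bsem G os y"
  by (induction xs) auto

lemma bsem_linearize: "bsem G (linearize M os) y = bsem G os y"
proof (induction os arbitrary: y)
  case (Cons x os)
  have "linearize M (x # os) = x # map Lin [0..<M] @ linearize M os" by (simp add: linearize_def)
  then show ?case using Cons by (cases x) auto
qed (simp add: linearize_def)

section \<open>Multilinear extensions\<close>

fun mle :: "(bool list \<Rightarrow> int) \<Rightarrow> int list \<Rightarrow> int" where
  "mle G [] = G []"
| "mle G (x # r) = (1 - x) * mle (\<lambda>y. G (False # y)) r + x * mle (\<lambda>y. G (True # y)) r"

lemma mle_of_bool: "mle G (map of_bool y) = G y"
  by (induction y arbitrary: G) (auto split: if_splits)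

lemma mle_add: "mle (\<lambda>y. G y + H y) r = mle G r + mle H r"
  by (induction r arbitrary: G H) (auto simp: algebra_simps)

lemma lin_mle: "lin M (mle G) i"
proof -
  have "mle G (r[i := X]) = mle G (r[i := 0]) + X * (mle G (r[i := 1]) - mle G (r[i := 0]))" if "i < length r" for r X
    using that
  proof (induction r arbitrary: i G)
    case (Cons x r)
    show ?case
    proof (cases i)
      case 0
      then show ?thesis by (simp add: algebra_simps)
    next
      case (Suc k)
      then have k: "k < length r" using Cons.prems by simp
      show ?thesis
        unfolding Suc list_update.simps nat.case mle.simps Cons.IH[OF k] by (simp add: algebra_simps)
    qed
  qed simp
  \<comment> \<open>For \<open>i\<close> beyond the end of the list the updates have no effect, and
    the equation becomes trivial.\<close>
  then show ?thesis unfolding lin_def by (metis add.right_neutral cancel_comm_monoid_add_class.diff_cancel list_update_beyond mult_zero_right not_le_imp_less)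
qed

lemma pcong_mle: "pcong p M (mle G)"
proof -
  have "[mle G r = mle G r'] (mod p)" if "list_all2 (\<lambda>a b. [a = b] (mod p)) r r'" for r r'
    using that by (induction arbitrary: G rule: list_all2_induct) (auto intro!: cong_add cong_mult cong_diff)
  then show ?thesis unfolding pcong_def by blast
qed

fun cube :: "nat \<Rightarrow> bool list list" where
  "cube 0 = [[]]"
| "cube (Suc n) = map (Cons False) (cube n) @ map (Cons True) (cube n)"

fun weight :: "int list \<Rightarrow> bool list \<Rightarrow> int" where
  "weight (x # r) (b # y) = (if b then x else 1 - x) * weight r y"
| "weight _ _ = 1"

text \<open>The Lagrange form on the right is what a party evaluates. It has
  \<open>2 ^ length r\<close> terms, which is affordable because a point has only logarithmically
  many coordinates.\<close>

lemma mle_eq_sum: "mle G r = (\<Sum>y\<leftarrow>cube (length r). weight r y * G y)"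
  by (induction r arbitrary: G) (auto simp: o_def sum_list_const_mult mult.assoc)

subsection \<open>The operators for reachability\<close>

text \<open>The most significant bit comes first, so that fixing the leading index bits selects an
  aligned interval of layers.\<close>

definition bin :: "bool list \<Rightarrow> nat" where
  "bin bs = foldl (\<lambda>a b. 2 * a + of_bool b) 0 bs"

lemma bin_Nil [simp]: "bin [] = 0"
  and bin_snoc: "bin (bs @ [b]) = 2 * bin bs + of_bool b"
  by (simp_all add: bin_def)

lemma bin_append: "bin (xs @ ys) = bin xs * 2 ^ length ys + bin ys"
  by (induction ys rule: rev_induct) (simp_all add: bin_snoc flip: append_assoc)

lemma bin_Cons: "bin (b # bs) = of_bool b * 2 ^ length bs + bin bs"
  using bin_append[of "[b]" bs] by (simp add: bin_def)

lemma bin_less: "bin bs < 2 ^ length bs"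
proof (induction bs rule: rev_induct)
  case (snoc b bs)
  then show ?case by (cases b) (simp_all add: bin_snoc)
qed simp

lemma bin_replicate_False [simp]: "bin (replicate n False) = 0"
  by (induction n) (simp_all add: bin_snoc replicate_append_same[symmetric])

lemma bin_surj: "n < 2 ^ l \<Longrightarrow> \<exists>bs. length bs = l \<and> bin bs = n"
proof (induction l arbitrary: n)
  case (Suc l)
  then obtain bs where "length bs = l" "bin bs = n div 2" by (metis less_mult_imp_div_less power_Suc2)
  then show ?case by (intro exI[of _ "bs @ [odd n]"]) (simp add: bin_snoc)
qed simp

lemma bin_inj: "length xs = length ys \<Longrightarrow> bin xs = bin ys \<Longrightarrow> xs = ys"
proof (induction xs arbitrary: ys rule: rev_induct)
  case (snoc x xs)
  then obtain y zs where ys: "ys = zs @ [y]" by (metis append_Nil2 length_append_singleton length_0_conv nat.simps(3) rev_exhaust)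
  have "2 * bin xs + of_bool x = 2 * bin zs + of_bool y" using snoc.prems ys by (simp add: bin_snoc)
  then have "bin xs = bin zs" "x = y" by (cases x; cases y; simp; presburger)+
  then show ?case using snoc ys by simp
qed simp

text \<open>The variables are \<open>K\<close> index bits followed by \<open>L\<close> bits each for
  \<open>s\<close>, \<open>t\<close> and \<open>w\<close>. After guessing \<open>w\<close> and
  branching on index bit \<open>k\<close>, the multiplexers replace \<open>s\<close> by
  \<open>w\<close> in the second half and \<open>t\<close> by \<open>w\<close> in the first.\<close>

definition block :: "nat \<Rightarrow> nat \<Rightarrow> nat \<Rightarrow> op list" where
  "block K L k = map (\<lambda>j. Ex (K + 2 * L + j)) [0..<L] @ [All k]
     @ map (\<lambda>j. Mux (K + j) (K + j) (K + 2 * L + j) k) [0..<L]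
     @ map (\<lambda>j. Mux (K + L + j) (K + 2 * L + j) (K + L + j) k) [0..<L]"

lemma bsem_Ex_block:
  assumes "length u = c" "length w = n"
  shows "bsem G (map (\<lambda>j. Ex (c + j)) [0..<n] @ os) (u @ w) \<longleftrightarrow>
    (\<exists>w'. length w' = n \<and> bsem G os (u @ w'))"
  using assms
proof (induction n arbitrary: u c w)
  case (Suc n)
  obtain a v where w: "w = a # v" "length v = n" using Suc.prems by (cases w) auto
  have eq: "map (\<lambda>j. Ex (c + j)) [0..<Suc n] = Ex c # map (\<lambda>j. Ex (Suc c + j)) [0..<n]"
    using map_upt_Suc[of "\<lambda>j. Ex (c + j)" n] by simp
  have upd: "(u @ w)[c := b] = (u @ [b]) @ v" for b using w Suc.prems by (simp add: list_update_append)
  have "bsem G (map (\<lambda>j. Ex (Suc c + j)) [0..<n] @ os) ((u @ w)[c := b]) \<longleftrightarrow>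
      (\<exists>w'. length w' = n \<and> bsem G os (u @ b # w'))" for b
    unfolding upd using Suc.IH[of "u @ [b]" "Suc c" v] w Suc.prems by simp
  then have "bsem G (map (\<lambda>j. Ex (c + j)) [0..<Suc n] @ os) (u @ w) \<longleftrightarrow>
      (\<exists>b w'. length w' = n \<and> bsem G os (u @ b # w'))"
    unfolding eq by (simp del: upt_Suc) (metis (full_types))
  also have "\<dots> \<longleftrightarrow> (\<exists>w'. length w' = Suc n \<and> bsem G os (u @ w'))"
    by (metis length_Suc_conv)
  finally show ?case .
qed simp

text \<open>The assignments are made one after the other. They amount to a simultaneous one because
  a source block is either disjoint from the target or equal to it, and then each cell is read just
  before it is overwritten.\<close>

lemma bsem_Mux_block:
  assumes "z + n \<le> length y" "a + n \<le> length y" "c + n \<le> length y"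
    and "a = z \<or> a + n \<le> z \<or> z + n \<le> a" "c = z \<or> c + n \<le> z \<or> z + n \<le> c" "b < z"
    and d: "d = (if y ! b then c else a)"
  shows "bsem G (map (\<lambda>j. Mux (z + j) (a + j) (c + j) b) [0..<n] @ os) y \<longleftrightarrow>
    bsem G os (take z y @ take n (drop d y) @ drop (z + n) y)"
  using assms(1-6)
proof (induction n arbitrary: os)
  case (Suc n)
  have len: "length (take z y) = z" "length (take n (drop d y)) = n" using Suc.prems d by auto
  let ?y = "take z y @ take n (drop d y) @ drop (z + n) y"
  have "bsem G (map (\<lambda>j. Mux (z + j) (a + j) (c + j) b) [0..<Suc n] @ os) y \<longleftrightarrow>
     bsem G (map (\<lambda>j. Mux (z + j) (a + j) (c + j) b) [0..<n] @ Mux (z + n) (a + n) (c + n) b # os) y"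
    by simp
  also have "\<dots> \<longleftrightarrow> bsem G (Mux (z + n) (a + n) (c + n) b # os) ?y"
    by (rule Suc.IH) (use Suc.prems in linarith)+
  also have "\<dots> \<longleftrightarrow> bsem G os (?y[z + n := (if ?y ! b then ?y ! (c + n) else ?y ! (a + n))])" by simp
  also have "?y[z + n := (if ?y ! b then ?y ! (c + n) else ?y ! (a + n))] =
      take z y @ take (Suc n) (drop d y) @ drop (z + Suc n) y"
  proof -
    have b: "?y ! b = y ! b" unfolding nth_append len using Suc.prems by simp
    have src: "?y ! (e + n) = y ! (e + n)"
      if e: "e = z \<or> e + Suc n \<le> z \<or> z + Suc n \<le> e" "e + Suc n \<le> length y" for e
    proof (cases "e + n < z")
      case True
      then show ?thesis unfolding nth_append len by simp
    next
      case False
      then have "\<not> e + n < z" "\<not> e + n - z < n" "z + n + (e + n - z - n) = e + n" using e by auto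
      then show ?thesis unfolding nth_append len using Suc.prems by (simp add: add.commute)
    qed
    have "(if ?y ! b then ?y ! (c + n) else ?y ! (a + n)) = y ! (d + n)"
      unfolding b src[OF Suc.prems(4,2)] src[OF Suc.prems(5,3)] using d by simp
    then have "?y[z + n := (if ?y ! b then ?y ! (c + n) else ?y ! (a + n))] = ?y[z + n := y ! (d + n)]"
      by (rule arg_cong)
    also have "\<dots> = take z y @ (take n (drop d y) @ [y ! (d + n)]) @ drop (z + Suc n) y"
    proof -
      have "drop (z + n) y = y ! (z + n) # drop (z + Suc n) y"
        using Suc.prems by (simp add: Cons_nth_drop_Suc)
      then show ?thesis unfolding list_update_append len by simp
    qed
    also have "take n (drop d y) @ [y ! (d + n)] = take (Suc n) (drop d y)"
      using Suc.prems d by (subst take_Suc_conv_app_nth) auto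
    finally show ?thesis .
  qed
  finally show ?case .
qed simp

text \<open>This is Savitch's step. The midpoint \<open>w'\<close> stays behind in the last
  \<open>L\<close> variables, where the next block quantifies it anew.\<close>

lemma bsem_block:
  assumes "length I = K" "length s = L" "length t = L" "length w = L" "k < K"
  shows "bsem G (block K L k @ os) (I @ s @ t @ w) \<longleftrightarrow>
    (\<exists>w'. length w' = L \<and> bsem G os (I[k := False] @ s @ w' @ w') \<and> bsem G os (I[k := True] @ w' @ t @ w'))"
proof -
  have mux: "bsem G (map (\<lambda>j. Mux (K + j) (K + j) (K + 2 * L + j) k) [0..<L]
     @ map (\<lambda>j. Mux (K + L + j) (K + 2 * L + j) (K + L + j) k) [0..<L] @ os) (J @ s @ t @ w') \<longleftrightarrow>
      bsem G os (J @ (if J ! k then w' else s) @ (if J ! k then t else w') @ w')"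
    if "length J = K" "length w' = L" for J w'
    using assms that
    by (subst bsem_Mux_block[OF _ _ _ _ _ _ refl]; simp add: nth_append)+
  let ?u = "I @ s @ t"
  have "bsem G (block K L k @ os) (?u @ w) \<longleftrightarrow> (\<exists>w'. length w' = L \<and>
     bsem G (All k # map (\<lambda>j. Mux (K + j) (K + j) (K + 2 * L + j) k) [0..<L]
     @ map (\<lambda>j. Mux (K + L + j) (K + 2 * L + j) (K + L + j) k) [0..<L] @ os) (?u @ w'))"
    using bsem_Ex_block[of ?u "K + 2 * L" w L G] assms by (simp add: block_def)
  also have "\<dots> \<longleftrightarrow> (\<exists>w'. length w' = L \<and> bsem G os (I[k := False] @ s @ w' @ w') \<and>
      bsem G os (I[k := True] @ w' @ t @ w'))"
  proof -
    have "bsem G (All k # map (\<lambda>j. Mux (K + j) (K + j) (K + 2 * L + j) k) [0..<L]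
     @ map (\<lambda>j. Mux (K + L + j) (K + 2 * L + j) (K + L + j) k) [0..<L] @ os) (?u @ w') \<longleftrightarrow>
       bsem G os (I[k := False] @ s @ w' @ w') \<and> bsem G os (I[k := True] @ w' @ t @ w')"
      if "length w' = L" for w'
      using mux[of "I[k := False]" w'] mux[of "I[k := True]" w'] assms that
      by (simp add: list_update_append)
    then show ?thesis by blast
  qed
  finally show ?thesis by simp
qed

fun reach :: "(nat \<Rightarrow> nat \<Rightarrow> nat \<Rightarrow> bool) \<Rightarrow> nat \<Rightarrow> nat \<Rightarrow> nat \<Rightarrow> nat \<Rightarrow> bool" where
  "reach A i 0 u v = (u = v)"
| "reach A i (Suc n) u v = (\<exists>w. A i u w \<and> reach A (Suc i) n w v)"

lemma reach_add: "reach A i (m + n) u v \<longleftrightarrow> (\<exists>w. reach A i m u w \<and> reach A (i + m) n w v)"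
  by (induction m arbitrary: i u) auto

text \<open>With \<open>j\<close> index bits fixed and the others 0, the index names the start of an
  aligned interval of \<open>2 ^ (K - j)\<close> steps, which the next block halves. The induction
  runs down from \<open>j = K\<close>, where a single step is read off from
  \<open>G\<close>.\<close>

lemma bsem_core:
  assumes A: "\<And>i u v. A i u v \<Longrightarrow> v < 2 ^ L"
    and G: "\<And>I s t w. length I = K \<Longrightarrow> length s = L \<Longrightarrow> length t = L \<Longrightarrow> length w = L \<Longrightarrow>
      G (I @ s @ t @ w) \<longleftrightarrow> A (bin I) (bin s) (bin t)"
    and "j \<le> K" "length I = K" "length s = L" "length t = L" "length w = L"
  shows "bsem G (concat (map (block K L) [j..<K])) (I @ s @ t @ w) \<longleftrightarrow>
    reach A (bin (take j I @ replicate (K - j) False)) (2 ^ (K - j)) (bin s) (bin t)"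
  using assms(3-)
proof (induction j arbitrary: I s t w rule: inc_induct)
  case base
  then show ?case using G by simp
next
  case (step k)
  let ?n = "K - Suc k"
  have n: "K - k = Suc ?n" using step.hyps by simp
  let ?i = "bin (take k I @ replicate (K - k) False)"
  have i0: "bin (take (Suc k) (I[k := False]) @ replicate ?n False) = ?i"
    using step n by (simp add: take_Suc_conv_app_nth)
  have i1: "bin (take (Suc k) (I[k := True]) @ replicate ?n False) = ?i + 2 ^ ?n"
    using step n by (simp add: take_Suc_conv_app_nth bin_append bin_Cons)
  \<comment> \<open>A node reached by at least one step is below \<open>2 ^ L\<close>, so
    quantifying midpoints over \<open>L\<close> bits misses none.\<close>
  have reach_less: "v < 2 ^ L" if "reach A i n u v" "n > 0" for i n u v
    using that by (induction n arbitrary: i u) (use A in \<open>auto, metis gr0I reach.simps(1)\<close>)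
  have "bsem G (concat (map (block K L) [k..<K])) (I @ s @ t @ w) \<longleftrightarrow>
    (\<exists>w'. length w' = L \<and> reach A ?i (2 ^ ?n) (bin s) (bin w') \<and> reach A (?i + 2 ^ ?n) (2 ^ ?n) (bin w') (bin t))"
    using step by (simp add: upt_conv_Cons bsem_block i0 i1 cong: conj_cong)
  also have "\<dots> \<longleftrightarrow> (\<exists>v. reach A ?i (2 ^ ?n) (bin s) v \<and> reach A (?i + 2 ^ ?n) (2 ^ ?n) v (bin t))"
    using bin_surj reach_less by (metis zero_less_numeral zero_less_power)
  also have "\<dots> \<longleftrightarrow> reach A ?i (2 ^ (K - k)) (bin s) (bin t)"
    unfolding n power_Suc mult_2 reach_add ..
  finally show ?case .
qed

section \<open>The parties' computations\<close>

subsection \<open>Arithmetic modulo \<open>Suc q\<close>\<close>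

text \<open>\<open>neg q x\<close> represents \<open>1 - x\<close>, avoiding truncated subtraction for \<open>x \<le> q\<close>.\<close>

definition neg :: "nat \<Rightarrow> nat \<Rightarrow> nat" where
  "neg q x = Suc (Suc q) - x"

text \<open>Reduction after every bit keeps the unary intermediate values small; a reduction only at
  the end would pass through numbers exponential in the length.\<close>

definition dec :: "nat \<Rightarrow> bits \<Rightarrow> nat" where
  "dec q bs = foldl (\<lambda>a b. (2 * a + of_bool b) mod Suc q) 0 bs"

definition enc :: "nat \<Rightarrow> nat \<Rightarrow> bits" where
  "enc l n = snd (((\<lambda>z. (fst z div 2, (fst z mod 2 = 1) # snd z)) ^^ l) (n, []))"

definition wt :: "nat \<Rightarrow> nat list \<Rightarrow> bits \<Rightarrow> nat" where
  "wt q r y = foldl (\<lambda>acc z. (acc * (if snd z then fst z else neg q (fst z))) mod Suc q) 1 (zip r y)"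

definition nd :: "nat list \<Rightarrow> nat \<Rightarrow> nat" where
  "nd r i = nth_default 0 r i"

text \<open>The point moves independently of Merlin's replies and of the input, so Bob can trace it
  from the coins. At \<open>Check\<close> it returns to 0 for the next repetition.\<close>

fun move :: "nat \<Rightarrow> op \<Rightarrow> nat \<Rightarrow> nat list \<Rightarrow> nat list" where
  "move q (Lin j) v r = r[j := v]"
| "move q (All j) v r = r[j := v]"
| "move q (Ex j) v r = r[j := v]"
| "move q (Mux z a c b) v r = r[z := (neg q (nd r b) * nd r a + nd r b * nd r c) mod Suc q]"
| "move q Check v r = map (\<lambda>_. 0) r"

fun test :: "nat \<Rightarrow> op \<Rightarrow> nat list \<Rightarrow> nat \<Rightarrow> nat \<Rightarrow> nat \<Rightarrow> bool" where
  "test q (Lin j) r c s0 s1 = ((neg q (nd r j) * s0 + nd r j * s1) mod Suc q = c)"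
| "test q (All j) r c s0 s1 = ((s0 * s1) mod Suc q = c)"
| "test q (Ex j) r c s0 s1 = ((s0 + neg q s0 * s1) mod Suc q = c)"
| "test q (Mux z a d b) r c s0 s1 = True"
| "test q Check r c s0 s1 = True"

text \<open>The new claim is Merlin's polynomial at the random \<open>v\<close>. A multiplexer
  changes only the point, and after \<open>Check\<close> the next repetition starts from the claim
  that the formula has value 1.\<close>

fun claim :: "nat \<Rightarrow> op \<Rightarrow> nat \<Rightarrow> nat \<Rightarrow> nat \<Rightarrow> nat \<Rightarrow> nat \<Rightarrow> nat" where
  "claim q (Mux z a d b) v c a0 a1 a2 = c"
| "claim q Check v c a0 a1 a2 = 1"
| "claim q x v c a0 a1 a2 = (a0 + a1 * v + a2 * v * v) mod Suc q"

definition coef :: "nat \<Rightarrow> nat \<Rightarrow> nat \<Rightarrow> bits \<Rightarrow> nat" where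
  "coef q l i m = dec q (take l (drop (i * l) m))"

type_synonym table = "(nat \<times> (bool \<times> bool) list list) list"
type_synonym inst = "(nat \<times> nat \<times> nat \<times> table) \<times> nat"

definition inst_table :: "inst \<Rightarrow> table" where "inst_table I = snd (snd (snd (fst I)))"
definition inst_K :: "inst \<Rightarrow> nat" where "inst_K I = floorlog 2 (fst (snd (fst I)))"
definition inst_L :: "inst \<Rightarrow> nat" where "inst_L I = floorlog 2 (fst (snd (snd (fst I))))"
definition inst_M :: "inst \<Rightarrow> nat" where "inst_M I = inst_K I + 3 * inst_L I"
text \<open>\<open>K\<close> blocks of \<open>3 * L + 1\<close> operators, each operator followed by
  \<open>M\<close> linearizations.\<close>

definition inst_N :: "inst \<Rightarrow> nat" where
  "inst_N I = inst_K I * (3 * inst_L I + 1) * (inst_M I + 1)"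
definition inst_h :: "inst \<Rightarrow> nat" where "inst_h I = floorlog 2 (2 * inst_N I)"
text \<open>This power of two is at most \<open>2 * n + 1\<close> and hence computable in unary,
  whereas \<open>2 ^ n\<close> in general is not.\<close>

definition pow_floorlog :: "nat \<Rightarrow> nat" where "pow_floorlog n = 2 ^ floorlog 2 n"

definition primes_from_to :: "nat \<Rightarrow> nat \<Rightarrow> nat list" where
  "primes_from_to a b = filter (\<lambda>n. 2 \<le> n \<and> list_all (\<lambda>d. n mod d \<noteq> 0) [2..<n]) [a..<b]"

text \<open>Here \<open>s = 2 ^ inst_h I\<close>. Above \<open>s\<^sup>2\<close> the residues
  outnumber the strings of \<open>2 * inst_h I\<close> coins, and below \<open>s ^ 5\<close> a
  residue fits into \<open>5 * inst_h I\<close> bits. The default 2 fills in where the search finds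
  nothing.\<close>

definition inst_q :: "inst \<Rightarrow> nat" where
  "inst_q I = (let s = pow_floorlog (2 * inst_N I) in
     nth_default 2 (primes_from_to (Suc (s * s)) (s * s * s * s * s)) 0 - 1)"

text \<open>One more than the quotient, so that for positive \<open>inst_h I\<close> the product of
  the two exceeds \<open>snd I\<close>, which stands for \<open>log 2 (1 / \<epsilon>)\<close>
  rounded up.\<close>

definition inst_reps :: "inst \<Rightarrow> nat" where "inst_reps I = Suc (snd I div inst_h I)"

definition inst_body :: "inst \<Rightarrow> op list" where
  "inst_body I = linearize (inst_M I) (concat (map (block (inst_K I) (inst_L I)) [0..<inst_K I]))"

definition reps :: "nat \<Rightarrow> op list \<Rightarrow> op list" where
  "reps n os = concat (replicate n (os @ [Check]))"

lemma reps_simps [simp]: "reps 0 os = []" "reps (Suc n) os = os @ Check # reps n os"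
  by (simp_all add: reps_def)

definition inst_ops :: "inst \<Rightarrow> op list" where
  "inst_ops I = reps (inst_reps I) (inst_body I)"

definition inst_schedule :: "inst \<Rightarrow> (nat \<times> nat) list" where
  "inst_schedule I = replicate (Suc (length (inst_ops I))) (2 * inst_h I, 15 * inst_h I)"

text \<open>A party holds the variables from \<open>off\<close> on, with values \<open>xs\<close>.  The padding layers, which are
  identity matrices, belong to the party with \<open>pad\<close> set.  The modulus \<open>Suc cap\<close> is too large to
  affect the decoded indices; it only keeps the intermediate values visibly small.\<close>

definition ent :: "inst \<Rightarrow> nat \<Rightarrow> bool \<Rightarrow> bits \<Rightarrow> bool list \<Rightarrow> bool" where
  "ent I off pad xs y =
     (let K = inst_K I; L = inst_L I;
        cap = pow_floorlog (fst (snd (fst I))) * pow_floorlog (fst (snd (snd (fst I))));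
        i = dec cap (take K y); u = dec cap (take L (drop K y)); v = dec cap (take L (drop (K + L) y));
        row = nth_default (0, []) (inst_table I) i;
        cell = nth_default (False, False) (nth_default [] (snd row) u) v
      in if i < length (inst_table I) then
           off \<le> fst row \<and> fst row < off + length xs \<and>
             (if nth_default False xs (fst row - off) then snd cell else fst cell)
         else pad \<and> u = v)"

definition party_eval :: "inst \<Rightarrow> nat \<Rightarrow> bool \<Rightarrow> bits \<Rightarrow> nat list \<Rightarrow> nat" where
  "party_eval I off pad xs r = foldl (\<lambda>acc y. (acc + (if ent I off pad xs y then wt (inst_q I) r y else 0))
     mod Suc (inst_q I)) 0 (cube (inst_M I))"

text \<open>The state holds the verdict so far, the claim, the point, and the unread part of Bob's
  message, from which each \<open>Check\<close> takes one residue. In \<open>z\<close> the operator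
  comes with the coins of the next round, Alice's message and Merlin's reply.\<close>

definition alice_step :: "inst \<Rightarrow> bits \<Rightarrow> bool \<times> nat \<times> nat list \<times> bits \<Rightarrow> op \<times> bits \<times> bits \<times> bits \<Rightarrow> bool \<times> nat \<times> nat list \<times> bits" where
  "alice_step I xa st z =
    (let q = inst_q I; l = 5 * inst_h I; ok = fst st; c = fst (snd st); r = fst (snd (snd st)); w = snd (snd (snd st));
       x = fst z; v = dec q (fst (snd z)); m = snd (snd (snd z));
       a0 = coef q l 0 m; a1 = coef q l 1 m; a2 = coef q l 2 m
     in (ok \<and> test q x r c a0 (a0 + a1 + a2) \<and>
           (x = Check \<longrightarrow> (party_eval I 0 True xa r + dec q (take l w)) mod Suc q = c),
         claim q x v c a0 a1 a2, move q x v r, if x = Check then drop l w else w))"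

text \<open>Merlin sees the coins of a round before he replies, so his reply is tested at the point given by
  the coins of the next round.\<close>

definition verdict :: "inst \<Rightarrow> bits \<Rightarrow> transcript \<Rightarrow> bits \<Rightarrow> bool" where
  "verdict I xa tr w = fst (foldl (alice_step I xa) (True, 1, replicate (inst_M I) 0, w)
     (zip (inst_ops I) (zip (map fst (drop 1 tr)) (map snd tr))))"

definition bob_step :: "inst \<Rightarrow> bits \<Rightarrow> nat list \<times> bits \<Rightarrow> op \<times> bits \<Rightarrow> nat list \<times> bits" where
  "bob_step I xb st z =
    (move (inst_q I) (fst z) (dec (inst_q I) (snd z)) (fst st),
     if fst z = Check then snd st @ enc (5 * inst_h I) (party_eval I (fst (fst I) div 2) False xb (fst st))
     else snd st)"

definition bob :: "inst \<Rightarrow> bits \<Rightarrow> bits list \<Rightarrow> bits" where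
  "bob I xb cs = snd (foldl (bob_step I xb) (replicate (inst_M I) 0, []) (zip (inst_ops I) (drop 1 cs)))"

subsection \<open>Polynomial running time\<close>

lemma pt_neg [pt_intros]: "pt q \<Longrightarrow> pt x \<Longrightarrow> pt (\<lambda>e. neg (q e) (x e))"
  unfolding neg_def by (intro pt_intros)

lemma pt_nd [pt_intros]: "pt r \<Longrightarrow> pt i \<Longrightarrow> pt (\<lambda>e. nd (r e) (i e))"
  unfolding nd_def by (intro pt_intros)

lemma foldl_invariant:
  assumes "P 0 a" "\<And>i a x. P i a \<Longrightarrow> P (Suc i) (f a x)"
  shows "P (length xs) (foldl f a xs)"
  by (induction xs rule: rev_induct) (use assms in auto)

lemma dec_le: "dec q bs \<le> q"
  unfolding dec_def by (rule foldl_invariant[where P = "\<lambda>_ a. a \<le> q"]) (auto simp: less_Suc_eq_le[symmetric])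

lemma pt_dec [pt_intros]:
  assumes "pt q" "pt bs" shows "pt (\<lambda>e. dec (q e) (bs e))"
  unfolding dec_def
proof (rule pt_foldl[where b = q])
  show "size (code (foldl (\<lambda>a b. (2 * a + of_bool b) mod Suc (q e)) 0 (take i (bs e)))) \<le> q e" for e i
    using dec_le[of "q e" "take i (bs e)"] by (simp add: dec_def)
qed (intro pt_intros assms pb_nat pt_comp[OF assms(1)])+

lemma enc_iterate:
  "((\<lambda>z. (fst z div 2, (fst z mod 2 = 1) # snd z)) ^^ i) (n, []) = (n div 2 ^ i, enc i n)"
proof -
  have "fst (((\<lambda>z. (fst z div 2, (fst z mod 2 = 1) # snd z)) ^^ i) (n, [])) = n div 2 ^ i"
    by (induction i) (simp_all add: div_mult2_eq power_Suc2 del: power_Suc)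
  then show ?thesis by (simp add: enc_def prod_eq_iff)
qed

lemma length_enc [simp]: "length (enc l n) = l"
  unfolding enc_def by (induction l) auto

lemma size_code_bits: "size (code (bs :: bits)) \<le> 2 * length bs"
  using size_code_list_le[of bs 1] size_code_bool by simp

lemma pt_enc [pt_intros]:
  assumes "pt l" "pt n" shows "pt (\<lambda>e. enc (l e) (n e))"
  unfolding enc_def
proof (intro pt_snd, rule pt_funpow[where b = "\<lambda>e. n e + 2 * l e + 1"])
  show "size (code (((\<lambda>z. (fst z div 2, (fst z mod 2 = 1) # snd z)) ^^ i) (n e, []))) \<le> n e + 2 * l e + 1"
    if "i \<le> l e" for e i
  proof -
    have "n e div 2 ^ i \<le> n e" by simp
    moreover have "size (code (enc i (n e))) \<le> 2 * l e" using size_code_bits[of "enc i (n e)"] that by simp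
    ultimately show ?thesis unfolding enc_iterate code_Pair sexp.size size_code_nat by linarith
  qed
qed (intro pt_intros assms pb_add pb_mult pb_const pb_nat)+

lemma wt_le: "wt q r y \<le> Suc q"
  unfolding wt_def by (rule foldl_invariant[where P = "\<lambda>_ a. a \<le> Suc q"]) auto

lemma pt_wt [pt_intros]:
  assumes "pt q" "pt r" "pt y" shows "pt (\<lambda>e. wt (q e) (r e) (y e))"
  unfolding wt_def
proof (rule pt_foldl[where b = "\<lambda>e. Suc (q e)"])
  show "size (code (foldl (\<lambda>acc z. (acc * (if snd z then fst z else neg (q e) (fst z))) mod Suc (q e)) 1
      (take i (zip (r e) (y e))))) \<le> Suc (q e)" for e i
    using wt_le[of "q e" "take i (r e)" "take i (y e)"] by (simp add: wt_def take_zip)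
qed (intro pt_intros assms pb_nat pt_comp[OF assms(1)])+

text \<open>The leading number is a tag, which turns case distinctions on operators into tests on
  numbers.\<close>

fun op_view :: "op \<Rightarrow> nat \<times> nat \<times> nat \<times> nat \<times> nat" where
  "op_view (Lin j) = (0, j, 0, 0, 0)"
| "op_view (All j) = (1, j, 0, 0, 0)"
| "op_view (Ex j) = (2, j, 0, 0, 0)"
| "op_view (Mux z a c b) = (3, z, a, c, b)"
| "op_view Check = (4, 0, 0, 0, 0)"

instantiation op :: codable
begin
definition code_op_inst: "code x = code (op_view x)"
instance ..
end

lemma pt_op_view [pt_intros]: "pt x \<Longrightarrow> pt (\<lambda>e. op_view (x e))"
  by (erule pt_recode) (simp add: code_op_inst)

lemma pt_from_op_view: "pt (\<lambda>e. op_view (x e)) \<Longrightarrow> pt x"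
  by (erule pt_recode) (simp add: code_op_inst)

lemma pt_op_constructors [pt_intros]:
  "pt j \<Longrightarrow> pt (\<lambda>e. Lin (j e))"
  "pt j \<Longrightarrow> pt (\<lambda>e. All (j e))"
  "pt j \<Longrightarrow> pt (\<lambda>e. Ex (j e))"
  "pt z \<Longrightarrow> pt a \<Longrightarrow> pt c \<Longrightarrow> pt b \<Longrightarrow> pt (\<lambda>e. Mux (z e) (a e) (c e) (b e))"
  by (rule pt_from_op_view, simp only: op_view.simps, intro pt_intros, assumption+)+

lemma pt_eq_Check [pt_intros]:
  assumes "pt x" shows "pt (\<lambda>e. x e = Check)"
proof -
  have "y = Check \<longleftrightarrow> fst (op_view y) = 4" for y by (cases y) auto
  then show ?thesis by (simp only:) (intro pt_intros assms)
qed

lemma pt_move [pt_intros]: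
  assumes "pt q" "pt x" "pt v" "pt r" shows "pt (\<lambda>e. move (q e) (x e) (v e) (r e))"
proof -
  have eq: "move q x v r = (let w = op_view x; b = nd r (snd (snd (snd (snd w)))) in
     if fst w = 3 then r[fst (snd w) := (neg q b * nd r (fst (snd (snd w))) + b * nd r (fst (snd (snd (snd w))))) mod Suc q]
     else if fst w = 4 then map (\<lambda>_. 0) r else r[fst (snd w) := v])" for q x v r
    by (cases x) (auto simp: Let_def)
  show ?thesis unfolding eq Let_def by (intro pt_intros assms)
qed

lemma pt_test [pt_intros]:
  assumes "pt q" "pt x" "pt r" "pt c" "pt s0" "pt s1"
  shows "pt (\<lambda>e. test (q e) (x e) (r e) (c e) (s0 e) (s1 e))"
proof -
  have eq: "test q x r c s0 s1 = (let w = op_view x; b = nd r (fst (snd w)) in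
     if fst w = 0 then (neg q b * s0 + b * s1) mod Suc q = c
     else if fst w = 1 then (s0 * s1) mod Suc q = c
     else if fst w = 2 then (s0 + neg q s0 * s1) mod Suc q = c else True)" for q x r c s0 s1
    by (cases x) (auto simp: Let_def)
  show ?thesis unfolding eq Let_def by (intro pt_intros assms)
qed

lemma pt_claim [pt_intros]:
  assumes "pt q" "pt x" "pt v" "pt c" "pt a0" "pt a1" "pt a2"
  shows "pt (\<lambda>e. claim (q e) (x e) (v e) (c e) (a0 e) (a1 e) (a2 e))"
proof -
  have eq: "claim q x v c a0 a1 a2 = (if fst (op_view x) = 3 then c else if fst (op_view x) = 4 then 1
     else (a0 + a1 * v + a2 * v * v) mod Suc q)" for q x v c a0 a1 a2
    by (cases x) auto
  show ?thesis unfolding eq by (intro pt_intros assms)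
qed

lemma pt_coef [pt_intros]:
  assumes "pt q" "pt l" "pt i" "pt m" shows "pt (\<lambda>e. coef (q e) (l e) (i e) (m e))"
  unfolding coef_def by (intro pt_intros assms)

lemma power_floorlog_le: "2 ^ floorlog 2 n \<le> 2 * n + 1"
proof (cases "n = 0")
  case False
  then have "2 ^ (floorlog 2 n - 1) \<le> n" using floorlog_bounds[of n 2] by simp
  moreover have "(2::nat) ^ floorlog 2 n = 2 * 2 ^ (floorlog 2 n - 1)"
    using False by (simp add: floorlog_def)
  ultimately show ?thesis by simp
qed (simp add: floorlog_def)

lemma floorlog_le: "floorlog 2 n \<le> n"
proof (induction n rule: less_induct)
  case (less n)
  show ?case
  proof (cases "n = 0")
    case False
    then have "floorlog 2 (n div 2) \<le> n div 2" using less by simp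
    then show ?thesis using False compute_floorlog[of 2 n] by simp
  qed (simp add: floorlog_def)
qed

lemma pt_floorlog [pt_intros]:
  assumes "pt n" shows "pt (\<lambda>e. floorlog 2 (n e))"
proof -
  let ?f = "\<lambda>z :: nat \<times> nat. if fst z = 0 then z else (fst z div 2, Suc (snd z))"
  \<comment> \<open>The \<open>floorlog\<close> of what is left plus the number of halvings is
    invariant, and after \<open>n\<close> rounds nothing is left.\<close>
  have inv: "floorlog 2 (fst ((?f ^^ i) (n, 0))) + snd ((?f ^^ i) (n, 0)) = floorlog 2 n \<and>
      fst ((?f ^^ i) (n, 0)) \<le> n - i" for n i
  proof (induction i)
    case (Suc i)
    obtain a b where ab: "(?f ^^ i) (n, 0) = (a, b)" by fastforce
    show ?case
    proof (cases "a = 0")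
      case False
      then have "floorlog 2 (a div 2) + Suc b = floorlog 2 a + b" using compute_floorlog[of 2 a] by simp
      moreover have "a div 2 \<le> n - Suc i"
      proof -
        have "a \<le> n - i" using Suc ab by simp
        moreover have "a div 2 \<le> a - 1" using False by linarith
        ultimately show ?thesis by linarith
      qed
      ultimately show ?thesis using Suc ab False by simp
    qed (use Suc ab in simp)
  qed simp
  have "pt (\<lambda>e. snd ((?f ^^ n e) (n e, 0)))"
  proof (rule pt_snd, rule pt_funpow[where b = "\<lambda>e. n e + n e + 1"])
    show "size (code ((?f ^^ i) (n e, 0))) \<le> n e + n e + 1" for e i
      using inv[of i "n e"] floorlog_le[of "n e"] by (auto simp: code_prod_inst)
  qed (intro pt_intros assms pb_add pb_const pb_nat)+
  moreover have "snd ((?f ^^ n) (n, 0)) = floorlog 2 n" for n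
    using inv[of n n] by (auto simp: floorlog_eq_zero_iff[THEN iffD2])
  ultimately show ?thesis by simp
qed

lemma pt_pow_floorlog [pt_intros]:
  assumes "pt n" shows "pt (\<lambda>e. pow_floorlog (n e))"
proof -
  have eq: "((\<lambda>a. a + a) ^^ i) 1 = (2::nat) ^ i" for i by (induction i) auto
  have "pt (\<lambda>e. ((\<lambda>a. a + a) ^^ floorlog 2 (n e)) (1::nat))"
  proof (rule pt_funpow[where b = "\<lambda>e. 2 * n e + 1"])
    show "size (code (((\<lambda>a. a + a) ^^ i) (1::nat))) \<le> 2 * n e + 1" if "i \<le> floorlog 2 (n e)" for e i
      unfolding eq size_code_nat
      by (rule order_trans[OF power_increasing[OF that] power_floorlog_le]) simp
  qed (intro pt_intros assms pb_add pb_mult pb_const pb_nat)+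
  then show ?thesis unfolding eq pow_floorlog_def .
qed

lemma pt_primes_from_to [pt_intros]: "pt a \<Longrightarrow> pt b \<Longrightarrow> pt (\<lambda>e. primes_from_to (a e) (b e))"
  unfolding primes_from_to_def by (intro pt_intros)

lemma pt_inst [pt_intros]:
  assumes "pt I"
  shows "pt (\<lambda>e. inst_table (I e))" "pt (\<lambda>e. inst_K (I e))" "pt (\<lambda>e. inst_L (I e))"
    "pt (\<lambda>e. inst_M (I e))" "pt (\<lambda>e. inst_N (I e))" "pt (\<lambda>e. inst_h (I e))"
  unfolding inst_table_def inst_K_def inst_L_def inst_M_def inst_N_def inst_h_def
  by (intro pt_intros assms)+

lemma pt_inst_q [pt_intros]: "pt I \<Longrightarrow> pt (\<lambda>e. inst_q (I e))"
  unfolding inst_q_def Let_def by (intro pt_intros)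

lemma pt_inst_reps [pt_intros]: "pt I \<Longrightarrow> pt (\<lambda>e. inst_reps (I e))"
  unfolding inst_reps_def by (intro pt_intros)

lemma pt_block [pt_intros]:
  assumes "pt K" "pt L" "pt k" shows "pt (\<lambda>e. block (K e) (L e) (k e))"
  unfolding block_def
  by (intro pt_intros assms pt_comp[OF assms(1)] pt_comp[OF assms(2)] pt_comp[OF assms(3)])

lemma pt_linearize [pt_intros]:
  assumes "pt M" "pt os" shows "pt (\<lambda>e. linearize (M e) (os e))"
  unfolding linearize_def by (intro pt_intros assms pt_comp[OF assms(1)])

lemma pt_inst_ops [pt_intros]:
  assumes "pt I" shows "pt (\<lambda>e. inst_ops (I e))"
  unfolding inst_ops_def reps_def inst_body_def by (intro pt_intros assms pt_comp[OF assms(1)])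

lemma pt_inst_schedule [pt_intros]:
  assumes "pt I" shows "pt (\<lambda>e. inst_schedule (I e))"
  unfolding inst_schedule_def by (intro pt_intros assms)

lemma length_cube [simp]: "length (cube n) = 2 ^ n"
  by (induction n) auto

lemma cube_mem_length: "y \<in> set (cube n) \<Longrightarrow> length y = n"
  by (induction n arbitrary: y) auto

lemma size_code_cube: "size (code (cube n)) \<le> 2 ^ n * (2 * n + 1)"
  using size_code_list_le[of "cube n" "2 * n"] size_code_bits cube_mem_length by fastforce

text \<open>The cube is exponential in its dimension, but
  \<open>2 ^ inst_M I = 2 ^ inst_K I * (2 ^ inst_L I) ^ 3\<close> is polynomial in the length and
  the width, which the instance contains in unary.\<close>

lemma pt_cube_inst_M [pt_intros]:
  assumes "pt I" shows "pt (\<lambda>e. cube (inst_M (I e)))"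
proof -
  let ?f = "\<lambda>c. map (Cons False) c @ map (Cons True) c"
  have eq: "(?f ^^ n) [[]] = cube n" for n by (induction n) auto
  have M: "2 ^ inst_M I \<le> (2 * fst (snd (fst I)) + 1) * (2 * fst (snd (snd (fst I))) + 1) ^ 3" for I
  proof -
    have "2 ^ inst_M I = (2::nat) ^ inst_K I * (2 ^ inst_L I) ^ 3"
      unfolding inst_M_def power_add power_mult[symmetric] by (simp only: mult.commute)
    also have "\<dots> \<le> (2 * fst (snd (fst I)) + 1) * (2 * fst (snd (snd (fst I))) + 1) ^ 3"
      unfolding inst_K_def inst_L_def by (intro mult_mono power_mono power_floorlog_le) auto
    finally show ?thesis .
  qed
  let ?b = "\<lambda>e. (2 * fst (snd (fst (I e))) + 1) * (2 * fst (snd (snd (fst (I e)))) + 1) ^ 3 * (2 * inst_M (I e) + 1)"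
  have "pt (\<lambda>e. (?f ^^ inst_M (I e)) [[]])"
  proof (rule pt_funpow[where b = ?b])
    show "pb ?b" by (intro pb_mult pb_add pb_const pb_power pb_nat pt_intros assms)
    fix e i assume i: "i \<le> inst_M (I e)"
    have "size (code (cube i)) \<le> 2 ^ i * (2 * i + 1)" by (rule size_code_cube)
    also have "\<dots> \<le> 2 ^ inst_M (I e) * (2 * inst_M (I e) + 1)"
      using i by (intro mult_mono power_increasing) auto
    also have "\<dots> \<le> ?b e" by (intro mult_right_mono M) auto
    finally show "size (code ((?f ^^ i) [[]])) \<le> ?b e" unfolding eq .
  qed (intro pt_intros assms)+
  then show ?thesis unfolding eq .
qed

lemma pt_ent [pt_intros]:
  assumes "pt I" "pt off" "pt pad" "pt xs" "pt y"
  shows "pt (\<lambda>e. ent (I e) (off e) (pad e) (xs e) (y e))"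
  unfolding ent_def Let_def by (intro pt_intros assms)

lemma pt_party_eval [pt_intros]:
  assumes "pt I" "pt off" "pt pad" "pt xs" "pt r"
  shows "pt (\<lambda>e. party_eval (I e) (off e) (pad e) (xs e) (r e))"
  unfolding party_eval_def
proof (rule pt_foldl[where b = "\<lambda>e. inst_q (I e)"])
  show "size (code (foldl (\<lambda>acc y. (acc + (if ent (I e) (off e) (pad e) (xs e) y then wt (inst_q (I e)) (r e) y else 0))
     mod Suc (inst_q (I e))) 0 (take i (cube (inst_M (I e)))))) \<le> inst_q (I e)" for e i
    unfolding size_code_nat
    by (rule foldl_invariant[where P = "\<lambda>_ a. a \<le> inst_q (I e)"]) (auto simp: less_Suc_eq_le[symmetric])
qed (intro pt_intros assms pb_nat pt_comp[OF assms(1)] pt_comp[OF assms(2)] pt_comp[OF assms(3)]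
   pt_comp[OF assms(4)] pt_comp[OF assms(5)])+

lemma pt_alice_step [pt_intros]:
  assumes "pt I" "pt xa" "pt st" "pt z"
  shows "pt (\<lambda>e. alice_step (I e) (xa e) (st e) (z e))"
  unfolding alice_step_def Let_def imp_conv_disj by (intro pt_intros assms)

lemma move_bounded:
  assumes "v \<le> q" "\<forall>a \<in> set r. a \<le> q"
  shows "\<forall>a \<in> set (move q x v r). a \<le> q" "length (move q x v r) = length r"
  using assms by (cases x; auto dest!: set_update_subset_insert[THEN subsetD] simp: less_Suc_eq_le[symmetric])+

lemma size_code_point:
  assumes "\<forall>a \<in> set r. a \<le> q" "length r = M"
  shows "size (code (r :: nat list)) \<le> M * (q + 1)"
  using size_code_list_le[of r q] assms by simp

lemma pt_verdict [pt_intros]: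
  assumes "pt I" "pt xa" "pt tr" "pt w"
  shows "pt (\<lambda>e. verdict (I e) (xa e) (tr e) (w e))"
  unfolding verdict_def
proof (intro pt_fst pt_foldl[where b = "\<lambda>e. 1 + (inst_q (I e) + 1 + (inst_M (I e) * (inst_q (I e) + 1) + size (code (w e)) + 1) + 1) + 1"])
  show "pb (\<lambda>e. 1 + (inst_q (I e) + 1 + (inst_M (I e) * (inst_q (I e) + 1) + size (code (w e)) + 1) + 1) + 1)"
    by (intro pb_mult pb_add pb_const pb_nat pb_size_pt pt_intros assms)
  fix e i
  let ?q = "inst_q (I e)" and ?M = "inst_M (I e)"
  let ?P = "\<lambda>(_::nat) (st :: bool \<times> nat \<times> nat list \<times> bits). fst (snd st) \<le> ?q + 1 \<and> (\<forall>a \<in> set (fst (snd (snd st))). a \<le> ?q) \<and>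
     length (fst (snd (snd st))) = ?M \<and> size (code (snd (snd (snd st)))) \<le> size (code (w e))"
  have drop: "size (code (drop k ys)) \<le> size (code ys)" for k and ys :: bits
    by (metis append_take_drop_id le_add2 size_code_append)
  let ?st = "foldl (alice_step (I e) (xa e)) (True, 1, replicate ?M 0, w e) (take i (zip (inst_ops (I e)) (zip (map fst (drop 1 (tr e))) (map snd (tr e)))))"
  have "?P (length (take i (zip (inst_ops (I e)) (zip (map fst (drop 1 (tr e))) (map snd (tr e)))))) ?st"
  proof (rule foldl_invariant)
    fix i st z assume st: "?P i st"
    have "claim ?q x v c a0 a1 a2 \<le> ?q + 1" if "c \<le> ?q + 1" for x v c a0 a1 a2
      using that by (cases x) auto
    then show "?P (Suc i) (alice_step (I e) (xa e) st z)"
      using st move_bounded[OF dec_le, of "fst (snd (snd st))" ?q] drop order_trans[OF drop]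
      by (auto simp: alice_step_def Let_def)
  qed auto
  then have "fst (snd ?st) \<le> ?q + 1" "size (code (fst (snd (snd ?st)))) \<le> ?M * (?q + 1)"
    "size (code (snd (snd (snd ?st)))) \<le> size (code (w e))" "size (code (fst ?st)) \<le> 1"
    using size_code_point size_code_bool by auto
  then show "size (code ?st) \<le> 1 + (?q + 1 + (?M * (?q + 1) + size (code (w e)) + 1) + 1) + 1"
    unfolding code_prod_inst sexp.size size_code_nat by linarith
qed (intro pt_intros assms pt_comp[OF assms(1)] pt_comp[OF assms(2)])+

lemma pt_bob_step [pt_intros]:
  assumes "pt I" "pt xb" "pt st" "pt z"
  shows "pt (\<lambda>e. bob_step (I e) (xb e) (st e) (z e))"
  unfolding bob_step_def by (intro pt_intros assms)

lemma pt_bob [pt_intros]: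
  assumes "pt I" "pt xb" "pt cs"
  shows "pt (\<lambda>e. bob (I e) (xb e) (cs e))"
  unfolding bob_def
proof (intro pt_snd pt_foldl[where b = "\<lambda>e. inst_M (I e) * (inst_q (I e) + 1) + length (inst_ops (I e)) * (10 * inst_h (I e)) + 1"])
  show "pb (\<lambda>e. inst_M (I e) * (inst_q (I e) + 1) + length (inst_ops (I e)) * (10 * inst_h (I e)) + 1)"
    by (intro pb_mult pb_add pb_const pb_nat pb_length pt_intros assms)
  fix e i
  let ?q = "inst_q (I e)" and ?M = "inst_M (I e)" and ?h = "inst_h (I e)"
  let ?P = "\<lambda>i (st :: nat list \<times> bits). (\<forall>a \<in> set (fst st). a \<le> ?q) \<and> length (fst st) = ?M \<and> length (snd st) \<le> i * (5 * ?h)"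
  let ?zs = "take i (zip (inst_ops (I e)) (drop 1 (cs e)))"
  let ?st = "foldl (bob_step (I e) (xb e)) (replicate ?M 0, []) ?zs"
  have "?P (length ?zs) ?st"
  proof (rule foldl_invariant)
    fix i st z assume st: "?P i st"
    then show "?P (Suc i) (bob_step (I e) (xb e) st z)"
      using move_bounded[OF dec_le, of "fst st" ?q] by (auto simp: bob_step_def)
  qed auto
  moreover have "length ?zs \<le> length (inst_ops (I e))" by simp
  ultimately have "size (code (fst ?st)) \<le> ?M * (?q + 1)" "length (snd ?st) \<le> length (inst_ops (I e)) * (5 * ?h)"
    using size_code_point by (auto elim: order_trans intro!: mult_right_mono)
  then show "size (code ?st) \<le> ?M * (?q + 1) + length (inst_ops (I e)) * (10 * ?h) + 1"
    using size_code_bits[of "snd ?st"] unfolding code_prod_inst sexp.size by linarith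
qed (intro pt_intros assms pt_comp[OF assms(1)] pt_comp[OF assms(2)])+

section \<open>Soundness and completeness of the interaction\<close>

definition astep :: "nat \<Rightarrow> nat \<Rightarrow> (nat list \<Rightarrow> nat) \<Rightarrow> op \<Rightarrow> bits \<Rightarrow> bits \<Rightarrow> bool \<times> nat \<times> nat list \<Rightarrow> bool \<times> nat \<times> nat list" where
  "astep q l base x cn m st =
    (let ok = fst st; c = fst (snd st); r = snd (snd st); v = dec q cn;
       a0 = coef q l 0 m; a1 = coef q l 1 m; a2 = coef q l 2 m
     in (ok \<and> test q x r c a0 (a0 + a1 + a2) \<and> (x = Check \<longrightarrow> base r = c),
         claim q x v c a0 a1 a2, move q x v r))"

text \<open>The run of Alice's verdict with Bob's messages replaced by direct access to \<open>base\<close>.\<close>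

fun arun :: "nat \<Rightarrow> nat \<Rightarrow> (nat list \<Rightarrow> nat) \<Rightarrow> strategy \<Rightarrow> transcript \<Rightarrow> bits \<Rightarrow> bool \<times> nat \<times> nat list \<Rightarrow> op list \<Rightarrow> bits list \<Rightarrow> bool" where
  "arun q l base m tr c0 st (x # os) (cn # cs) =
     arun q l base m (tr @ [(c0, [], m tr c0 [])]) cn (astep q l base x cn (m tr c0 []) st) os cs"
| "arun q l base m tr c0 st _ _ = fst st"

text \<open>Round 0 serves to obtain the first reply. Test points are the coins from round 1 on,
  which \<open>drop 1\<close> aligns with the operators.\<close>

definition coins_of :: "transcript \<Rightarrow> bits \<Rightarrow> bits list" where
  "coins_of tr c0 = drop 1 (map fst tr @ [c0])"

lemma arun_dead: "\<not> fst st \<Longrightarrow> \<not> arun q l base m tr c0 st os cs"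
  by (induction q l base m tr c0 st os cs rule: arun.induct) (auto simp: astep_def Let_def)

text \<open>Keeps the modulus \<open>int (Suc q)\<close> in one piece.\<close>

declare of_nat_Suc [simp del]

lemma dec_eq_bin: "dec q bs = bin bs mod Suc q"
proof -
  have "(2 * (a mod n) + b) mod n = (2 * a + b) mod n" for a b n :: nat
    by (metis mod_add_left_eq mod_mult_right_eq)
  then show ?thesis by (induction bs rule: rev_induct) (simp_all add: dec_def bin_def)
qed

lemma int_neg: "x \<le> Suc (Suc q) \<Longrightarrow> [int (neg q x) = 1 - int x] (mod int (Suc q))"
proof -
  assume "x \<le> Suc (Suc q)"
  then have "int (neg q x) = (1 - int x) + int (Suc q)" by (simp add: neg_def of_nat_diff of_nat_Suc)
  then show ?thesis by (simp add: cong_def)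
qed

lemma mod_Suc_eq_iff: "c \<le> q \<Longrightarrow> a mod Suc q = c \<longleftrightarrow> [int c = int a] (mod int (Suc q))"
  using cong_int_iff[of c a "Suc q"] by (auto simp: cong_def)

text \<open>Divided differences do the work: for two roots \<open>u\<close> and \<open>v\<close> the
  prime divides \<open>b + c * (u + v)\<close>, as it does not divide \<open>u - v\<close>. Two such
  slopes show that it divides \<open>c\<close>, and then \<open>b\<close> and
  \<open>a\<close>.\<close>

lemma quad_roots:
  fixes a b c :: int
  assumes p: "prime (Suc q)" and n: "\<not> ([a = 0] (mod int (Suc q)) \<and> [b = 0] (mod int (Suc q)) \<and> [c = 0] (mod int (Suc q)))"
  shows "card {v. v \<le> q \<and> [a + b * int v + c * (int v)\<^sup>2 = 0] (mod int (Suc q))} \<le> 2"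
proof (rule ccontr)
  let ?p = "int (Suc q)"
  let ?S = "{v. v \<le> q \<and> [a + b * int v + c * (int v)\<^sup>2 = 0] (mod ?p)}"
  assume "\<not> card ?S \<le> 2"
  then have "3 \<le> card ?S" by simp
  then obtain T where "T \<subseteq> ?S" "card T = 3" by (meson obtain_subset_with_card_n)
  then obtain x y z where xyz: "x \<in> ?S" "y \<in> ?S" "z \<in> ?S" "x \<noteq> y" "x \<noteq> z" "y \<noteq> z"
    by (auto simp: card_3_iff)
  have pp: "prime ?p" using p by (simp only: prime_nat_int_transfer)
  have nd: "\<not> ?p dvd int u - int v" if "u \<in> ?S" "v \<in> ?S" "u \<noteq> v" for u v
  proof
    assume "?p dvd int u - int v"
    moreover have "\<bar>int u - int v\<bar> < ?p"
    proof -
      have "u \<le> q" "v \<le> q" using that by auto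
      then show ?thesis unfolding of_nat_Suc by linarith
    qed
    ultimately have "int u - int v = 0" using zdvd_not_zless[of "\<bar>int u - int v\<bar>" ?p] by force
    then show False using that by simp
  qed
  have root: "?p dvd a + b * int v + c * (int v)\<^sup>2" if "v \<in> ?S" for v
    using that by (simp add: cong_0_iff)
  have slope: "?p dvd b + c * (int u + int v)" if "u \<in> ?S" "v \<in> ?S" "u \<noteq> v" for u v
  proof -
    have "?p dvd (a + b * int u + c * (int u)\<^sup>2) - (a + b * int v + c * (int v)\<^sup>2)"
      using root that by (intro dvd_diff) auto
    also have "\<dots> = (int u - int v) * (b + c * (int u + int v))" by (simp add: algebra_simps power2_eq_square)
    finally show ?thesis using nd[OF that] pp by (simp add: prime_dvd_mult_iff)
  qed
  have "?p dvd (b + c * (int x + int y)) - (b + c * (int x + int z))"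
    using slope xyz by (intro dvd_diff) auto
  also have "\<dots> = c * (int y - int z)" by (simp add: algebra_simps)
  finally have c: "?p dvd c" using nd xyz pp by (simp add: prime_dvd_mult_iff)
  have b: "?p dvd b" using slope[of x y] xyz c by (simp add: dvd_add_left_iff)
  have "?p dvd a" using root[of x] xyz b c by (simp add: dvd_add_left_iff add.assoc)
  then show False using n b c by (simp add: cong_0_iff)
qed

text \<open>\<open>g\<close> is the innermost polynomial and \<open>base\<close> its reduced value
  as computed by the parties. By \<open>coins\<close> different strings of \<open>k\<close> coins
  name different residues, and by \<open>room\<close> every residue can be sent in \<open>l\<close>
  bits.\<close>

locale game =
  fixes q k l M :: nat and g :: "int list \<Rightarrow> int" and base :: "nat list \<Rightarrow> nat"
  assumes prime: "prime (Suc q)" and coins: "2 ^ k \<le> Suc q" and room: "Suc q \<le> 2 ^ l"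
    and pcong: "pcong (int (Suc q)) M g"
    and base_le: "base r \<le> q"
    and base: "length r = M \<Longrightarrow> \<forall>a \<in> set r. a \<le> q \<Longrightarrow> [int (base r) = g (map int r)] (mod int (Suc q))"
begin

abbreviation "p \<equiv> int (Suc q)"

definition valid :: "nat list \<Rightarrow> bool" where
  "valid r \<longleftrightarrow> length r = M \<and> (\<forall>a \<in> set r. a \<le> q)"

definition tru :: "nat \<Rightarrow> nat list \<Rightarrow> op list \<Rightarrow> bool" where
  "tru c r os \<longleftrightarrow> [int c = sem g os (map int r)] (mod p)"

lemma valid_move: "valid r \<Longrightarrow> valid (move q x (dec q cn) r)"
  using move_bounded[OF dec_le] by (auto simp: valid_def)

lemma valid_zeros: "valid (replicate M 0)"
  by (auto simp: valid_def)

lemma nd_eq: "valid r \<Longrightarrow> j < M \<Longrightarrow> nd r j = r ! j \<and> r ! j \<le> q \<and> map int r ! j = int (r ! j)"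
  by (auto simp: valid_def nd_def nth_default_nth)

lemma test_iff:
  assumes "valid r" "j < M" "x \<in> {Lin j, All j, Ex j}" "s0 \<le> q" "c \<le> q"
    and "[int s0 = sem g os ((map int r)[j := 0])] (mod p)" "[int s1 = sem g os ((map int r)[j := 1])] (mod p)"
  shows "test q x r c s0 s1 \<longleftrightarrow> tru c r (x # os)"
proof -
  note nd = nd_eq[OF assms(1,2)]
  have "\<exists>A. (test q x r c s0 s1 \<longleftrightarrow> A mod Suc q = c) \<and> [int A = sem g (x # os) (map int r)] (mod p)"
  proof -
    consider "x = Lin j" | "x = All j" | "x = Ex j" using assms(3) by auto
    then show ?thesis
    proof cases
      case 1
      have "[int (neg q (r ! j) * s0 + r ! j * s1) = sem g (x # os) (map int r)] (mod p)"
        unfolding 1 sem.simps of_nat_add of_nat_mult using nd assms(6,7)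
        by (intro cong_add cong_mult) (auto intro: int_neg)
      moreover have "test q x r c s0 s1 \<longleftrightarrow> (neg q (r ! j) * s0 + r ! j * s1) mod Suc q = c" using 1 nd by simp
      ultimately show ?thesis by blast
    next
      case 2
      have "[int (s0 * s1) = sem g (x # os) (map int r)] (mod p)"
        unfolding 2 sem.simps of_nat_mult using assms(6,7) by (intro cong_mult)
      moreover have "test q x r c s0 s1 \<longleftrightarrow> (s0 * s1) mod Suc q = c" using 2 by simp
      ultimately show ?thesis by blast
    next
      case 3
      have "[int (neg q s0) = 1 - sem g os ((map int r)[j := 0])] (mod p)"
        using int_neg[of s0 q] assms(4,6) by (meson cong_diff cong_refl cong_trans le_Suc_eq)
      then have "[int (s0 + neg q s0 * s1) = sem g (x # os) (map int r)] (mod p)"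
        unfolding 3 sem.simps of_nat_add of_nat_mult using assms(6,7)
        by (intro cong_add cong_mult)
      moreover have "test q x r c s0 s1 \<longleftrightarrow> (s0 + neg q s0 * s1) mod Suc q = c" using 3 by simp
      ultimately show ?thesis by blast
    qed
  qed
  then obtain A where A: "test q x r c s0 s1 \<longleftrightarrow> A mod Suc q = c" "[int A = sem g (x # os) (map int r)] (mod p)" by blast
  then show ?thesis unfolding A(1) mod_Suc_eq_iff[OF assms(5)] tru_def by (meson cong_sym cong_trans)
qed

lemma tru_claim:
  assumes "x \<in> {Lin j, All j, Ex j}"
  shows "tru (claim q x v c a0 a1 a2) (move q x v r) os \<longleftrightarrow>
    [int a0 + int a1 * int v + int a2 * (int v)\<^sup>2 = sem g os ((map int r)[j := int v])] (mod p)"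
proof -
  have a: "claim q x v c a0 a1 a2 = (a0 + a1 * v + a2 * v * v) mod Suc q"
    and b: "map int (move q x v r) = (map int r)[j := int v]"
    using assms by (auto simp: map_update)
  have c: "int ((a0 + a1 * v + a2 * v * v) mod Suc q) mod p = (int a0 + int a1 * int v + int a2 * (int v)\<^sup>2) mod p"
    by (simp add: zmod_int power2_eq_square mult.assoc)
  show ?thesis unfolding tru_def a b cong_def c ..
qed

text \<open>If Merlin's coefficients agreed with the true ones modulo \<open>p\<close>, the passed
  test would make the old claim true. So the two quadratics differ, and the new claim is true only
  at a root of their difference.\<close>

lemma false_step:
  assumes r: "valid r" "j < M" and x: "x \<in> {Lin j, All j, Ex j}" and quad: "quad M (sem g os) j"
    and "c \<le> q" "a0 \<le> q" "\<not> tru c r (x # os)" "test q x r c a0 (a0 + a1 + a2)"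
  shows "card {v. v \<le> q \<and> tru (claim q x v c a0 a1 a2) (move q x v r) os} \<le> 2"
proof -
  have "length (map int r) = M" using r by (simp add: valid_def)
  then obtain A B C where ABC: "\<And>X. sem g os ((map int r)[j := X]) = A + B * X + C * X\<^sup>2"
    using quad unfolding quad_def by blast
  have "\<not> ([int a0 - A = 0] (mod p) \<and> [int a1 - B = 0] (mod p) \<and> [int a2 - C = 0] (mod p))"
  proof
    assume "[int a0 - A = 0] (mod p) \<and> [int a1 - B = 0] (mod p) \<and> [int a2 - C = 0] (mod p)"
    then have c: "[int a0 = A] (mod p)" "[int a1 = B] (mod p)" "[int a2 = C] (mod p)"
      by (auto simp: cong_diff_iff_cong_0)
    have "tru c r (x # os)"
      by (rule test_iff[THEN iffD1, OF r x \<open>a0 \<le> q\<close> \<open>c \<le> q\<close> _ _ assms(8)])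
         (use c in \<open>auto simp: ABC intro!: cong_add\<close>)
    then show False using assms(7) by blast
  qed
  note roots = quad_roots[OF prime this]
  have eq: "[int a0 + int a1 * int v + int a2 * (int v)\<^sup>2 = A + B * int v + C * (int v)\<^sup>2] (mod p) \<longleftrightarrow>
      [(int a0 - A) + (int a1 - B) * int v + (int a2 - C) * (int v)\<^sup>2 = 0] (mod p)" for v
  proof -
    have "(int a0 - A) + (int a1 - B) * int v + (int a2 - C) * (int v)\<^sup>2 =
      (int a0 + int a1 * int v + int a2 * (int v)\<^sup>2) - (A + B * int v + C * (int v)\<^sup>2)"
      by (simp add: algebra_simps)
    then show ?thesis by (simp only: cong_diff_iff_cong_0)
  qed
  show ?thesis unfolding tru_claim[OF x] ABC eq by (rule roots)
qed

text \<open>A multiplexer needs no message: the new point is congruent to the one that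
  \<open>sem\<close> substitutes, so the truth of the claim carries over in both directions.\<close>

lemma tru_Mux:
  assumes "valid r" "op_below M (Mux z a d b)" "\<forall>y \<in> set os. op_below M y"
  shows "tru c (move q (Mux z a d b) v r) os \<longleftrightarrow> tru c r (Mux z a d b # os)"
proof -
  let ?v = "(neg q (r ! b) * r ! a + r ! b * r ! d) mod Suc q"
  note nd = nd_eq[OF assms(1)]
  have "[int ?v = (1 - map int r ! b) * map int r ! a + map int r ! b * map int r ! d] (mod p)"
  proof -
    have "[int ?v = int (neg q (r ! b)) * int (r ! a) + int (r ! b) * int (r ! d)] (mod p)"
      by (simp add: cong_def zmod_int)
    moreover have "[int (neg q (r ! b)) * int (r ! a) + int (r ! b) * int (r ! d) =
        (1 - int (r ! b)) * int (r ! a) + int (r ! b) * int (r ! d)] (mod p)"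
      using nd[of b] assms(2) by (intro cong_add cong_mult int_neg) auto
    ultimately have "[int ?v = (1 - int (r ! b)) * int (r ! a) + int (r ! b) * int (r ! d)] (mod p)"
      by (rule cong_trans)
    then show ?thesis using nd assms(2) by simp
  qed
  then have "list_all2 (\<lambda>a b. [a = b] (mod p)) (map int (move q (Mux z a d b) v r))
     ((map int r)[z := (1 - map int r ! b) * map int r ! a + map int r ! b * map int r ! d])"
    using nd assms(2) by (auto simp: map_update intro!: list_all2_update_cong list.rel_refl)
  moreover have "length (map int (move q (Mux z a d b) v r)) = M" using assms(1) by (simp add: valid_def)
  ultimately have "[sem g os (map int (move q (Mux z a d b) v r)) = sem g (Mux z a d b # os) (map int r)] (mod p)"
    using pcong_sem[OF pcong assms(3)] unfolding pcong_def sem.simps by blast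
  then show ?thesis unfolding tru_def by (meson cong_sym cong_trans)
qed

subsection \<open>Counting coins\<close>

definition coinset :: "bits set" where "coinset = {cn. length cn = k}"

lemma finite_coinset: "finite coinset" and card_coinset: "card coinset = 2 ^ k"
proof -
  have "coinset = {xs. set xs \<subseteq> UNIV \<and> length xs = k}" by (auto simp: coinset_def)
  then show "finite coinset" "card coinset = 2 ^ k"
    using finite_lists_length_eq[of "UNIV :: bool set" k] card_lists_length_eq[of "UNIV :: bool set" k] by auto
qed

definition coinlists :: "nat \<Rightarrow> bits list set" where
  "coinlists n = {cs. set cs \<subseteq> coinset \<and> length cs = n}"

lemma finite_coinlists: "finite (coinlists n)" and card_coinlists: "card (coinlists n) = (2 ^ k) ^ n"
  unfolding coinlists_def
  using finite_lists_length_eq[OF finite_coinset] card_lists_length_eq[OF finite_coinset] card_coinset by auto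

definition frac :: "nat \<Rightarrow> (bits list \<Rightarrow> bool) \<Rightarrow> real" where
  "frac n Q = real (card {cs \<in> coinlists n. Q cs}) / (2 ^ k) ^ n"

lemma frac_0_le: "frac 0 Q \<le> 1"
proof -
  have "card {cs \<in> coinlists 0. Q cs} \<le> card (coinlists 0)"
    by (intro card_mono finite_coinlists) auto
  then show ?thesis unfolding frac_def card_coinlists by simp
qed

lemma frac_Suc: "frac (Suc n) Q = (\<Sum>cn \<in> coinset. frac n (\<lambda>cs. Q (cn # cs))) / 2 ^ k"
proof -
  let ?S = "Sigma coinset (\<lambda>cn. {cs \<in> coinlists n. Q (cn # cs)})"
  have "bij_betw (\<lambda>z. fst z # snd z) ?S {cs \<in> coinlists (Suc n). Q cs}"
    by (rule bij_betwI[where g = "\<lambda>cs. (hd cs, tl cs)"])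
      (auto simp: coinlists_def length_Suc_conv)
  then have "card {cs \<in> coinlists (Suc n). Q cs} = card ?S" by (simp add: bij_betw_same_card)
  also have "\<dots> = (\<Sum>cn \<in> coinset. card {cs \<in> coinlists n. Q (cn # cs)})"
    by (rule card_SigmaI) (auto intro: finite_coinset finite_subset[OF _ finite_coinlists[of n]])
  finally show ?thesis by (simp add: frac_def sum_divide_distrib mult.commute)
qed

lemma frac_Suc_le:
  assumes "\<And>cn. cn \<in> coinset \<Longrightarrow> frac n (\<lambda>cs. Q (cn # cs)) \<le> b"
  shows "frac (Suc n) Q \<le> b"
proof -
  have "(\<Sum>cn \<in> coinset. frac n (\<lambda>cs. Q (cn # cs))) \<le> (\<Sum>cn \<in> coinset. b)" by (intro sum_mono assms)
  then show ?thesis unfolding frac_Suc by (simp add: card_coinset field_simps)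
qed

text \<open>The at most two bad strings are charged \<open>b\<close> and every string is charged
  \<open>b'\<close>. This crude form makes the errors of successive rounds add up.\<close>

lemma frac_Suc_le_bad:
  assumes "card {cn \<in> coinset. bad cn} \<le> 2" "0 \<le> b" "0 \<le> b'"
    and "\<And>cn. cn \<in> coinset \<Longrightarrow> frac n (\<lambda>cs. Q (cn # cs)) \<le> b"
    and "\<And>cn. cn \<in> coinset \<Longrightarrow> \<not> bad cn \<Longrightarrow> frac n (\<lambda>cs. Q (cn # cs)) \<le> b'"
  shows "frac (Suc n) Q \<le> 2 / 2 ^ k * b + b'"
proof -
  have "(\<Sum>cn \<in> coinset. frac n (\<lambda>cs. Q (cn # cs))) \<le> (\<Sum>cn \<in> coinset. (if bad cn then b else 0) + b')"
    by (intro sum_mono) (use assms in \<open>auto simp: add_increasing2\<close>)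
  also have "\<dots> = real (card {cn \<in> coinset. bad cn}) * b + 2 ^ k * b'"
    by (simp add: sum.distrib sum.If_cases finite_coinset card_coinset Int_def)
  also have "\<dots> \<le> 2 * b + 2 ^ k * b'"
    using assms(1,2) by (intro add_right_mono mult_right_mono) auto
  finally show ?thesis unfolding frac_Suc by (simp add: field_simps)
qed

abbreviation "run \<equiv> arun q l base"

lemma dead_frac: "\<not> fst st \<Longrightarrow> frac n (run m tr c0 st os) = 0"
  using arun_dead[of st q l base m tr c0 os] by (simp add: frac_def)

lemma inj_dec: "inj_on (dec q) coinset"
proof (rule inj_onI)
  fix xs ys assume xy: "xs \<in> coinset" "ys \<in> coinset" "dec q xs = dec q ys"
  have "bin cn < Suc q" if "cn \<in> coinset" for cn
    using bin_less[of cn] that coins by (auto simp: coinset_def)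
  then show "xs = ys" using xy by (intro bin_inj) (auto simp: dec_eq_bin coinset_def)
qed

text \<open>When a false claim has become true by luck, the rest of the repetition may pass. But
  \<open>Check\<close> resets claim and point, so the bound \<open>G\<close> for the later
  repetitions still applies.\<close>

lemma any_frac:
  assumes H: "\<And>tr c0 ok. frac (length rest) (run m tr c0 (ok, 1, replicate M 0) rest) \<le> G"
    and "length r = M" "Check \<notin> set os"
  shows "frac (length (os @ Check # rest)) (run m tr c0 (ok, c, r) (os @ Check # rest)) \<le> G"
  using assms(2-)
proof (induction os arbitrary: tr c0 ok c r)
  case Nil
  have zeros: "map (\<lambda>_. 0) r = replicate M (0::nat)" using Nil by (simp add: map_replicate_const)
  show ?case unfolding append_Nil list.size(4) add_Suc_right add_0_right
    by (rule frac_Suc_le) (simp add: astep_def Let_def zeros H[unfolded One_nat_def])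
next
  case (Cons x os)
  have "length (move q x v r) = M" for v using Cons.prems by (cases x) auto
  then show ?case unfolding append_Cons list.size(4) add_Suc_right add_0_right
    using Cons.IH Cons.prems by (intro frac_Suc_le) (auto simp: astep_def Let_def)
qed

text \<open>A union bound over the operators: in each round at most two of the \<open>2 ^ k\<close>
  coin strings make a false claim true, after which \<open>any_frac\<close> leaves \<open>G\<close>.
  A claim still false at \<open>Check\<close> is exposed by \<open>base\<close>.\<close>

lemma false_frac:
  assumes H: "\<And>tr c0 ok. frac (length rest) (run m tr c0 (ok, 1, replicate M 0) rest) \<le> G" and "0 \<le> G"
    and "valid r" "c \<le> q" "deg_ok M g os" "\<not> tru c r os"
  shows "frac (length (os @ Check # rest)) (run m tr c0 (ok, c, r) (os @ Check # rest)) \<le> real (length os) * (2 / 2 ^ k * G)"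
  using assms(3-)
proof (induction os arbitrary: tr c0 ok c r)
  case Nil
  have "base r \<noteq> c"
  proof
    assume "base r = c"
    then show False using Nil base[of r] by (simp add: valid_def tru_def)
  qed
  then show ?case unfolding append_Nil list.size(4) add_Suc_right add_0_right
    by (intro frac_Suc_le) (simp add: astep_def Let_def dead_frac)
next
  case (Cons x os)
  let ?b = "real (length os) * (2 / 2 ^ k * G)" and ?os = "os @ Check # rest"
  let ?m = "m tr c0 []" let ?a = "\<lambda>i. coef q l i ?m" let ?tr = "tr @ [(c0, [], ?m)]"
  let ?st = "\<lambda>cn. astep q l base x cn ?m (ok, c, r)"
  let ?run = "run m tr c0 (ok, c, r) (x # ?os)"
  have b: "0 \<le> ?b" using \<open>0 \<le> G\<close> by simp
  have ok: "deg_ok M g os" "op_below M x" "x \<noteq> Check" using Cons.prems by auto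
  have le: "claim q x v c a0 a1 a2 \<le> q" for v a0 a1 a2
    using ok(3) Cons.prems(2) by (cases x) (auto simp: less_Suc_eq_le[symmetric])
  have IH: "frac (length ?os) (run m ?tr cn (?st cn) ?os) \<le> ?b"
    if "\<not> fst (?st cn) \<or> \<not> tru (fst (snd (?st cn))) (snd (snd (?st cn))) os" for cn
  proof (cases "fst (?st cn)")
    case False
    then show ?thesis using dead_frac b by simp
  next
    case True
    have "frac (length ?os) (run m ?tr cn (fst (?st cn), fst (snd (?st cn)), snd (snd (?st cn))) ?os) \<le> ?b"
      by (rule Cons.IH) (use True that Cons.prems ok le valid_move in \<open>auto simp: astep_def Let_def\<close>)
    then show ?thesis by simp
  qed
  show ?case
  proof (cases "\<exists>j. x \<in> {Lin j, All j, Ex j}")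
    case False
    then obtain z a d e where x: "x = Mux z a d e" using ok by (cases x) auto
    have "frac (Suc (length ?os)) ?run \<le> ?b"
    proof (rule frac_Suc_le)
      fix cn
      have "\<not> tru c (move q x (dec q cn) r) os"
        using tru_Mux[of r z a d e os c "dec q cn"] Cons.prems ok x deg_ok_below by auto
      then show "frac (length ?os) (\<lambda>cs. ?run (cn # cs)) \<le> ?b"
        using IH[of cn] x by (simp add: astep_def Let_def)
    qed
    also have "?b \<le> real (length (x # os)) * (2 / 2 ^ k * G)"
      using \<open>0 \<le> G\<close> by (intro mult_right_mono) auto
    finally show ?thesis by simp
  next
    case True
    then obtain j where x: "x \<in> {Lin j, All j, Ex j}" by blast
    have j: "j < M" "quad M (sem g os) j" using x Cons.prems by auto
    show ?thesis
    proof (cases "test q x r c (?a 0) (?a 0 + ?a 1 + ?a 2)")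
      case False
      have "frac (Suc (length ?os)) ?run \<le> 0"
        by (rule frac_Suc_le) (use False in \<open>simp add: astep_def Let_def dead_frac\<close>)
      also have "0 \<le> real (length (x # os)) * (2 / 2 ^ k * G)" using \<open>0 \<le> G\<close> by simp
      finally show ?thesis by simp
    next
      case True
      let ?bad = "\<lambda>cn. tru (fst (snd (?st cn))) (snd (snd (?st cn))) os"
      have "frac (Suc (length ?os)) ?run \<le> 2 / 2 ^ k * G + ?b"
      proof (rule frac_Suc_le_bad[where bad = ?bad])
        let ?V = "{v. v \<le> q \<and> tru (claim q x v c (?a 0) (?a 1) (?a 2)) (move q x v r) os}"
        have "card {cn \<in> coinset. ?bad cn} \<le> card ?V"
        proof (rule card_inj_on_le[where f = "dec q"])
          show "inj_on (dec q) {cn \<in> coinset. ?bad cn}" by (rule inj_on_subset[OF inj_dec]) auto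
          show "dec q ` {cn \<in> coinset. ?bad cn} \<subseteq> ?V" using dec_le by (auto simp: astep_def Let_def)
          show "finite ?V" by simp
        qed
        also have "\<dots> \<le> 2"
          by (rule false_step[OF Cons.prems(1) j(1) x j(2) Cons.prems(2) _ Cons.prems(4) True])
            (simp add: coef_def dec_le)
        finally show "card {cn \<in> coinset. ?bad cn} \<le> 2" .
        show "frac (length ?os) (\<lambda>cs. ?run (cn # cs)) \<le> G" for cn
        proof -
          have "length (snd (snd (?st cn))) = M"
            using valid_move[OF Cons.prems(1)] by (simp add: astep_def Let_def valid_def)
          then show ?thesis
            using any_frac[OF H, of "snd (snd (?st cn))" os ?tr cn "fst (?st cn)" "fst (snd (?st cn))"] deg_ok_Check[OF ok(1)]
            by simp
        qed
        show "frac (length ?os) (\<lambda>cs. ?run (cn # cs)) \<le> ?b"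
          if "\<not> ?bad cn" for cn using IH[of cn] that by simp
      qed (use b \<open>0 \<le> G\<close> in auto)
      also have "\<dots> = real (length (x # os)) * (2 / 2 ^ k * G)" by (simp add: of_nat_Suc algebra_simps add_divide_distrib)
      finally show ?thesis by simp
    qed
  qed
qed

text \<open>The induction hypothesis is uniform in the transcript and so serves as \<open>H\<close>
  in \<open>false_frac\<close>. Thus a Merlin who adapts to earlier repetitions gains nothing, and
  the errors multiply.\<close>

lemma reps_frac:
  assumes "deg_ok M g os" "\<not> tru 1 (replicate M 0) os"
  shows "frac (length (reps n os)) (run m tr c0 (ok, 1, replicate M 0) (reps n os))
    \<le> (real (length os) * (2 / 2 ^ k)) ^ n"
proof (induction n arbitrary: tr c0 ok)
  case 0
  then show ?case using frac_0_le by simp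
next
  case (Suc n)
  have "1 \<le> q" using prime prime_gt_1_nat[of "Suc q"] by simp
  have "frac (length (os @ Check # reps n os))
      (run m tr c0 (ok, 1, replicate M 0) (os @ Check # reps n os))
    \<le> real (length os) * (2 / 2 ^ k * (real (length os) * (2 / 2 ^ k)) ^ n)"
    by (rule false_frac[OF Suc.IH _ valid_zeros \<open>1 \<le> q\<close> assms]) simp
  then show ?case by (simp add: mult.assoc)
qed

subsection \<open>The honest Merlin\<close>

definition good_reply :: "op \<Rightarrow> op list \<Rightarrow> nat list \<Rightarrow> bits \<Rightarrow> bool" where
  "good_reply x os r w \<longleftrightarrow> (\<forall>j. x \<in> {Lin j, All j, Ex j} \<longrightarrow>
     (\<forall>X. [int (coef q l 0 w) + int (coef q l 1 w) * X + int (coef q l 2 w) * X\<^sup>2 = sem g os ((map int r)[j := X])] (mod p)))"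

lemma true_step:
  assumes "valid r" "c \<le> q" "deg_ok M g (x # os)" "tru c r (x # os)" "good_reply x os r w"
  shows "\<exists>c'. astep q l base x cn w (True, c, r) = (True, c', move q x (dec q cn) r) \<and> c' \<le> q \<and>
    tru c' (move q x (dec q cn) r) os"
proof (cases "\<exists>j. x \<in> {Lin j, All j, Ex j}")
  case False
  then obtain z a d e where x: "x = Mux z a d e" using assms(3) by (cases x) auto
  have "tru c (move q x (dec q cn) r) os"
    using tru_Mux[of r z a d e os c "dec q cn"] assms x deg_ok_below by auto
  then show ?thesis using assms(2) x by (simp add: astep_def Let_def)
next
  case True
  then obtain j where x: "x \<in> {Lin j, All j, Ex j}" by blast
  have j: "j < M" using x assms(3) by auto
  let ?a = "\<lambda>i. coef q l i w"
  have good: "[int (?a 0) + int (?a 1) * X + int (?a 2) * X\<^sup>2 = sem g os ((map int r)[j := X])] (mod p)" for X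
    using assms(5) x unfolding good_reply_def by blast
  have "test q x r c (?a 0) (?a 0 + ?a 1 + ?a 2)"
    by (rule test_iff[THEN iffD2, OF assms(1) j x _ assms(2) _ _ assms(4)])
       (use good[of 0] good[of 1] in \<open>auto simp: coef_def dec_le\<close>)
  moreover have "tru (claim q x (dec q cn) c (?a 0) (?a 1) (?a 2)) (move q x (dec q cn) r) os"
    unfolding tru_claim[OF x] by (rule good)
  moreover have "claim q x (dec q cn) c (?a 0) (?a 1) (?a 2) \<le> q" "x \<noteq> Check"
    using x by (auto simp: less_Suc_eq_le[symmetric])
  ultimately show ?thesis by (simp add: astep_def Let_def)
qed

text \<open>The restriction is a quadratic with integer coefficients, whose residues fit into
  \<open>l\<close> bits each. Where no polynomial is asked for, any string of the right length will
  do.\<close>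

lemma good_reply_exists:
  assumes "valid r" "deg_ok M g (x # os) \<or> x = Check"
  shows "\<exists>w. length w = 3 * l \<and> good_reply x os r w"
proof (cases "\<exists>j. x \<in> {Lin j, All j, Ex j}")
  case False
  then show ?thesis by (intro exI[of _ "replicate (3 * l) False"]) (auto simp: good_reply_def)
next
  case True
  then obtain j where x: "x \<in> {Lin j, All j, Ex j}" by blast
  then have "quad M (sem g os) j" using assms(2) by auto
  then obtain A B C where ABC: "\<And>X. sem g os ((map int r)[j := X]) = A + B * X + C * X\<^sup>2"
    using assms(1) unfolding quad_def valid_def by (metis length_map)
  have "\<exists>bs. length bs = l \<and> [int (dec q bs) = A] (mod p)" for A :: int
  proof -
    have "A mod p < p" "0 \<le> A mod p" by (rule pos_mod_bound, simp) (rule pos_mod_sign, simp)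
    then have "nat (A mod p) < Suc q" by linarith
    then have "nat (A mod p) < 2 ^ l" using room by (rule less_le_trans)
    then obtain bs where bs: "length bs = l" "bin bs = nat (A mod p)" using bin_surj by blast
    have "int (dec q bs) = A mod p" unfolding dec_eq_bin bs(2) zmod_int by simp
    then show ?thesis using bs by (auto simp: cong_def)
  qed
  then obtain f where f: "\<And>A. length (f A) = l" "\<And>A. [int (dec q (f A)) = A] (mod p)" by metis
  let ?w = "f A @ f B @ f C"
  have coef: "coef q l 0 ?w = dec q (f A)" "coef q l 1 ?w = dec q (f B)" "coef q l 2 ?w = dec q (f C)"
    by (simp_all add: coef_def f)
  have "j' = j" if "x \<in> {Lin j', All j', Ex j'}" for j' using that x by auto
  then have "good_reply x os r ?w"
    unfolding good_reply_def coef using f(2) by (auto simp: ABC intro!: cong_add cong_mult)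
  then show ?thesis using f(1) by (intro exI[of _ ?w]) simp
qed

text \<open>Lets the honest Merlin recover the current point from the coins in the
  transcript.\<close>

definition point_after :: "op list \<Rightarrow> bits list \<Rightarrow> nat list" where
  "point_after os cs = foldl (\<lambda>r z. move q (fst z) (dec q (snd z)) r) (replicate M 0) (zip os cs)"

lemma valid_point_after: "valid (point_after os cs)"
proof -
  have "valid (foldl (\<lambda>r z. move q (fst z) (dec q (snd z)) r) r zs)" if "valid r" for r zs
    using that by (induction zs arbitrary: r) (auto simp: valid_move)
  then show ?thesis unfolding point_after_def using valid_zeros by blast
qed

lemma point_after_snoc:
  assumes "length cs < length os"
  shows "point_after os (cs @ [cn]) = move q (os ! length cs) (dec q cn) (point_after os cs)"
proof -
  have "zip os (cs @ [cn]) = zip os cs @ [(os ! length cs, cn)]"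
    using assms take_zip[of "length cs" os cs] by (simp add: zip_append2 Cons_nth_drop_Suc[symmetric])
  then show ?thesis by (simp add: point_after_def)
qed

lemma point_after_round:
  assumes "length tr < length ops"
  shows "point_after ops (coins_of (tr @ [(c0, a, w)]) cn) =
    move q (ops ! length tr) (dec q cn) (point_after ops (coins_of tr c0))"
proof -
  have "coins_of (tr @ [(c0, a, w)]) cn = coins_of tr c0 @ [cn]" "length (coins_of tr c0) = length tr"
    by (cases tr; simp add: coins_of_def)+
  then show ?thesis using point_after_snoc assms by metis
qed

text \<open>The honest counterpart of \<open>false_frac\<close>: within a repetition
  \<open>true_step\<close> keeps the claim true, at \<open>Check\<close> it agrees with
  \<open>base\<close>, and \<open>H\<close> takes over from there.\<close>

lemma complete_inner:
  assumes hon: "\<And>tr c0. length tr < length ops \<Longrightarrow>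
      good_reply (ops ! length tr) (drop (Suc (length tr)) ops) (point_after ops (coins_of tr c0)) (m tr c0 [])"
    and H: "\<And>tr c0 cs. length tr \<le> length ops \<Longrightarrow> drop (length tr) ops = rest \<Longrightarrow> point_after ops (coins_of tr c0) = replicate M 0 \<Longrightarrow>
      length cs = length rest \<Longrightarrow> run m tr c0 (True, 1, replicate M 0) rest cs"
    and "drop (length tr) ops = os @ Check # rest" "length cs = length (os @ Check # rest)"
    and "deg_ok M g os" "c \<le> q" "tru c (point_after ops (coins_of tr c0)) os"
  shows "run m tr c0 (True, c, point_after ops (coins_of tr c0)) (os @ Check # rest) cs"
  using assms(3-)
proof (induction os arbitrary: tr c0 c cs)
  case Nil
  let ?r = "point_after ops (coins_of tr c0)"
  obtain cn cs' where cs: "cs = cn # cs'" "length cs' = length rest" using Nil by (cases cs) auto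
  have v: "valid ?r" by (rule valid_point_after)
  have lt: "length tr < length ops" using Nil(1) by (metis append_Nil drop_all linorder_not_less list.distinct(1))
  have "[int c = int (base ?r)] (mod p)"
    using Nil base[of ?r] v by (auto simp: tru_def valid_def intro: cong_trans cong_sym)
  then have "base ?r = c" using base_le[of ?r] Nil(4) mod_Suc_eq_iff[of c q "base ?r"] by simp
  moreover have "map (\<lambda>_. 0) ?r = replicate M (0::nat)" using v by (simp add: map_replicate_const valid_def)
  moreover have ck: "ops ! length tr = Check" "drop (Suc (length tr)) ops = rest"
    using Nil(1) lt by (auto simp: Cons_nth_drop_Suc[symmetric])
  moreover have "point_after ops (coins_of (tr @ [(c0, [], m tr c0 [])]) cn) = move q (ops ! length tr) (dec q cn) ?r"
    by (rule point_after_round[OF lt])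
  ultimately show ?case
    using H[of "tr @ [(c0, [], m tr c0 [])]" cn cs'] lt cs by (simp add: astep_def Let_def)
next
  case (Cons x os)
  let ?r = "point_after ops (coins_of tr c0)"
  let ?tr = "tr @ [(c0, [], m tr c0 [])]"
  obtain cn cs' where cs: "cs = cn # cs'" "length cs' = length (os @ Check # rest)" using Cons.prems by (cases cs) auto
  have lt: "length tr < length ops" using Cons.prems(1) by (metis append_Cons drop_all linorder_not_less list.distinct(1))
  have x: "ops ! length tr = x" "drop (Suc (length tr)) ops = os @ Check # rest"
    using Cons.prems(1) lt by (auto simp: Cons_nth_drop_Suc[symmetric])
  have "good_reply x (os @ Check # rest) ?r (m tr c0 [])" using hon[OF lt, of c0] x by simp
  then have "good_reply x os ?r (m tr c0 [])"
    using deg_ok_Check[of M g os] Cons.prems(3) by (simp add: good_reply_def sem_append_Check)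
  then obtain c' where c': "astep q l base x cn (m tr c0 []) (True, c, ?r) = (True, c', move q x (dec q cn) ?r)"
     "c' \<le> q" "tru c' (move q x (dec q cn) ?r) os"
    using true_step[OF valid_point_after Cons.prems(4,3,5)] by blast
  have r': "move q x (dec q cn) ?r = point_after ops (coins_of ?tr cn)"
    using point_after_round[OF lt] x(1) by simp
  have "run m ?tr cn (True, c', point_after ops (coins_of ?tr cn)) (os @ Check # rest) cs'"
    by (rule Cons.IH) (use Cons.prems x cs c' r' in auto)
  then show ?case using cs c'(1) r' by simp
qed

lemma complete_reps:
  assumes hon: "\<And>tr c0. length tr < length ops \<Longrightarrow>
      good_reply (ops ! length tr) (drop (Suc (length tr)) ops) (point_after ops (coins_of tr c0)) (m tr c0 [])"
    and "deg_ok M g os" "tru 1 (replicate M 0) os"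
    and "drop (length tr) ops = reps n os" "length cs = length (reps n os)"
    and "point_after ops (coins_of tr c0) = replicate M 0"
  shows "run m tr c0 (True, 1, replicate M 0) (reps n os) cs"
  using assms(4-)
proof (induction n arbitrary: tr c0 cs)
  case (Suc n)
  have "1 \<le> q" using prime prime_gt_1_nat[of "Suc q"] by simp
  have "run m tr c0 (True, 1, point_after ops (coins_of tr c0)) (os @ Check # reps n os) cs"
  proof (rule complete_inner[where ops = ops and m = m])
    show "good_reply (ops ! length tr) (drop (Suc (length tr)) ops) (point_after ops (coins_of tr c0)) (m tr c0 [])"
      if "length tr < length ops" for tr c0 by (rule hon[OF that])
    show "run m tr c0 (True, 1, replicate M 0) (reps n os) cs"
      if "drop (length tr) ops = reps n os"
        "point_after ops (coins_of tr c0) = replicate M 0"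
        "length cs = length (reps n os)" for tr c0 cs
      by (rule Suc.IH[OF that(1,3,2)])
  qed (use Suc.prems assms \<open>1 \<le> q\<close> in auto)
  then show ?case using Suc.prems(3) by simp
qed simp

end

declare of_nat_Suc [simp]

section \<open>From transcripts to the abstract game\<close>

fun replies :: "strategy \<Rightarrow> transcript \<Rightarrow> bits list \<Rightarrow> transcript" where
  "replies m tr [] = []"
| "replies m tr (c # cs) = (c, [], m tr c []) # replies m (tr @ [(c, [], m tr c [])]) cs"

lemma play_eq_replies:
  assumes "\<And>xa tr c. ip_alice \<pi> xa tr c = []"
  shows "play \<pi> xa m cs = replies m [] cs"
proof -
  have "foldl (\<lambda>tr c. let a = ip_alice \<pi> xa tr c in tr @ [(c, a, m tr c a)]) tr cs = tr @ replies m tr cs" for tr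
    by (induction cs arbitrary: tr) (simp_all add: assms Let_def)
  then show ?thesis unfolding play_def by simp
qed

fun bob_run :: "inst \<Rightarrow> bits \<Rightarrow> nat list \<Rightarrow> op list \<Rightarrow> bits list \<Rightarrow> bits" where
  "bob_run I xb r (x # os) (c # cs) =
     (if x = Check then enc (5 * inst_h I) (party_eval I (fst (fst I) div 2) False xb r) else [])
     @ bob_run I xb (move (inst_q I) x (dec (inst_q I) c) r) os cs"
| "bob_run I xb r _ _ = []"

lemma bob_eq_bob_run: "bob I xb cs = bob_run I xb (replicate (inst_M I) 0) (inst_ops I) (drop 1 cs)"
proof -
  have "snd (foldl (bob_step I xb) (r, out) (zip os cs)) = out @ bob_run I xb r os cs" for r out os cs
    by (induction os arbitrary: r out cs; case_tac cs) (simp_all add: bob_step_def)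
  then show ?thesis unfolding bob_def by simp
qed

lemma length_bob_run:
  "length os = length cs \<Longrightarrow> length (bob_run I xb r os cs) = length (filter (\<lambda>x. x = Check) os) * (5 * inst_h I)"
  by (induction os cs arbitrary: r rule: list_induct2) auto

lemma enc_Suc: "enc (Suc l) n = enc l (n div 2) @ [n mod 2 = 1]"
proof -
  have "((\<lambda>z. (fst z div 2, (fst z mod 2 = 1) # snd z)) ^^ l) (n, bs) = (n div 2 ^ l, enc l n @ bs)" for n bs
  proof (induction l arbitrary: n bs)
    case (Suc l)
    have "enc (Suc l) n = (n div 2 ^ l mod 2 = 1) # enc l n"
      by (subst enc_def) (simp only: funpow.simps o_def enc_iterate fst_conv snd_conv)
    then show ?case using Suc enc_iterate[of "Suc l" n] by (simp add: enc_iterate)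
  qed (simp add: enc_def)
  from this[of "n div 2" "[n mod 2 = 1]"] show ?thesis
    unfolding enc_def by (simp only: funpow_Suc_right o_def fst_conv snd_conv)
qed

lemma bin_enc: "n < 2 ^ l \<Longrightarrow> bin (enc l n) = n"
proof (induction l arbitrary: n)
  case (Suc l)
  then have "n div 2 < 2 ^ l" by auto
  moreover have "2 * (n div 2) + of_bool (n mod 2 = 1) = n"
    using mult_div_mod_eq[of 2 n] by (cases "n mod 2 = 1") auto
  ultimately show ?case using Suc.IH[of "n div 2"] by (simp only: enc_Suc bin_snoc)
qed (simp add: enc_def)

lemma dec_enc: "n \<le> q \<Longrightarrow> Suc q \<le> 2 ^ l \<Longrightarrow> dec q (enc l n) = n"
  by (simp add: dec_eq_bin bin_enc)

definition base_value :: "inst \<Rightarrow> bits \<Rightarrow> bits \<Rightarrow> nat list \<Rightarrow> nat" where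
  "base_value I xa xb r =
    (party_eval I 0 True xa r + party_eval I (fst (fst I) div 2) False xb r) mod Suc (inst_q I)"

lemma party_eval_le: "party_eval I off pad xs r \<le> inst_q I"
  unfolding party_eval_def
  by (rule foldl_invariant[where P = "\<lambda>_ a. a \<le> inst_q I"]) (auto simp: less_Suc_eq_le[symmetric])

text \<open>Proved for arbitrary intermediate states, with \<open>bob_run\<close> as the unread part
  of Bob's message: each \<open>Check\<close> finds at its front the residue that completes
  \<open>base_value\<close>, and decoding recovers it as it fits into \<open>5 * inst_h I\<close>
  bits.\<close>

lemma verdict_eq_arun:
  assumes "Suc (inst_q I) \<le> 2 ^ (5 * inst_h I)" "length cs = length (inst_ops I)"
  shows "verdict I xa (replies m [] (c0 # cs)) (bob I xb (c0 # cs)) =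
    arun (inst_q I) (5 * inst_h I) (base_value I xa xb) m [] c0 (True, 1, replicate (inst_M I) 0) (inst_ops I) cs"
proof -
  have "fst (foldl (alice_step I xa) (ok, c, r, bob_run I xb r os cs)
     (zip os (zip (map fst (drop 1 (replies m tr (c0 # cs)))) (map snd (replies m tr (c0 # cs)))))) =
     arun (inst_q I) (5 * inst_h I) (base_value I xa xb) m tr c0 (ok, c, r) os cs"
    if "length os = length cs" for os cs tr c0 ok c r
    using that
  proof (induction os cs arbitrary: tr c0 ok c r rule: list_induct2)
    case (Cons x os cn cs)
    show ?case
      using Cons.IH[of _ _ _ "tr @ [(c0, [], m tr c0 [])]" cn]
      by (simp add: alice_step_def astep_def Let_def base_value_def dec_enc[OF party_eval_le assms(1)])
  qed simp
  from this[of "inst_ops I" cs True 1 "replicate (inst_M I) 0" "[]" c0] show ?thesis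
    unfolding verdict_def bob_eq_bob_run using assms(2) by simp
qed

section \<open>The multilinear extension\<close>

lemma wt_cong:
  assumes "\<forall>a \<in> set r. a \<le> q"
  shows "[int (wt q r y) = weight (map int r) y] (mod int (Suc q))"
proof -
  have "[int (foldl (\<lambda>acc z. (acc * (if snd z then fst z else neg q (fst z))) mod Suc q) a (zip r y)) =
      int a * weight (map int r) y] (mod int (Suc q))" for a
    using assms
  proof (induction r arbitrary: y a)
    case (Cons x r)
    show ?case
    proof (cases y)
      case (Cons b ys)
      let ?a = "(a * (if b then x else neg q x)) mod Suc q"
      have "[int (if b then x else neg q x) = (if b then int x else 1 - int x)] (mod int (Suc q))"
        using int_neg[of x q] Cons.prems by auto
      then have "[int a * int (if b then x else neg q x) = int a * (if b then int x else 1 - int x)] (mod int (Suc q))"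
        by (rule cong_scalar_left)
      moreover have "[int ?a = int a * int (if b then x else neg q x)] (mod int (Suc q))"
        unfolding cong_def zmod_int of_nat_mult by simp
      ultimately have "[int ?a * weight (map int r) ys = int a * (if b then int x else 1 - int x) * weight (map int r) ys] (mod int (Suc q))"
        by (intro cong_scalar_right) (rule cong_trans)
      moreover have "[int (foldl (\<lambda>acc z. (acc * (if snd z then fst z else neg q (fst z))) mod Suc q) ?a (zip r ys)) =
         int ?a * weight (map int r) ys] (mod int (Suc q))"
        using Cons.prems by (intro Cons.IH) simp
      ultimately have "[int (foldl (\<lambda>acc z. (acc * (if snd z then fst z else neg q (fst z))) mod Suc q) ?a (zip r ys)) =
          int a * (if b then int x else 1 - int x) * weight (map int r) ys] (mod int (Suc q))"
        by (blast intro: cong_trans)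
      then show ?thesis using Cons by (cases b) (simp_all add: mult.assoc del: of_nat_Suc)
    qed simp
  qed simp
  from this[of 1] show ?thesis unfolding wt_def by simp
qed

lemma foldl_add_mod_cong:
  assumes "\<And>y. [int (f y) = g y] (mod int (Suc q))"
  shows "[int (foldl (\<lambda>acc y. (acc + f y) mod Suc q) a ys) = int a + (\<Sum>y\<leftarrow>ys. g y)] (mod int (Suc q))"
proof (induction ys arbitrary: a)
  case (Cons y ys)
  have "[int ((a + f y) mod Suc q) = int a + g y] (mod int (Suc q))"
    using assms[of y] unfolding cong_def zmod_int of_nat_add by (metis mod_add_right_eq mod_mod_trivial)
  then have "[int ((a + f y) mod Suc q) + (\<Sum>y\<leftarrow>ys. g y) = int a + g y + (\<Sum>y\<leftarrow>ys. g y)] (mod int (Suc q))"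
    by (rule cong_add) (rule cong_refl)
  then show ?case using Cons.IH[of "(a + f y) mod Suc q"] by (simp add: add.assoc del: of_nat_Suc) (blast intro: cong_trans)
qed simp

lemma party_eval_cong:
  assumes "length r = inst_M I" "\<forall>a \<in> set r. a \<le> inst_q I"
  shows "[int (party_eval I off pad xs r) = mle (\<lambda>y. of_bool (ent I off pad xs y)) (map int r)] (mod int (Suc (inst_q I)))"
proof -
  have "[int (if ent I off pad xs y then wt (inst_q I) r y else 0) = weight (map int r) y * of_bool (ent I off pad xs y)]
     (mod int (Suc (inst_q I)))" for y
    using wt_cong[OF assms(2), of y] by auto
  from foldl_add_mod_cong[OF this, where a = 0 and ys = "cube (inst_M I)"] show ?thesis
    unfolding party_eval_def mle_eq_sum by (simp add: assms(1) del: of_nat_Suc)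
qed

lemma mle_cong: "(\<And>y. length y = length r \<Longrightarrow> G y = H y) \<Longrightarrow> mle G r = mle H r"
proof (induction r arbitrary: G H)
  case (Cons x r)
  have "mle (\<lambda>y. G (b # y)) r = mle (\<lambda>y. H (b # y)) r" for b
    by (rule Cons.IH) (simp add: Cons.prems)
  then show ?case by simp
qed simp

section \<open>The instance of a branching program\<close>

definition bp_data :: "branching_program \<Rightarrow> nat \<times> nat \<times> nat \<times> table" where
  "bp_data P = (bp_vars P, bp_length P, bp_width P,
     map (\<lambda>i. (bp_label P i, map (\<lambda>u. map (\<lambda>v. ((i, u, False, v) \<in> bp_edges P, (i, u, True, v) \<in> bp_edges P))
       [0..<bp_width P]) [0..<bp_width P])) [0..<bp_length P - 1])"

definition inst_of :: "branching_program \<Rightarrow> real \<Rightarrow> inst" where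
  "inst_of P \<epsilon> = (bp_data P, nat \<lceil>log 2 (1 / \<epsilon>)\<rceil>)"

lemma code_map: "code (map f xs) = code_list (\<lambda>x. code (f x)) xs"
  by (induction xs) (simp_all add: Defs.code_list_def)

lemma code_inst_of: "code (inst_of P \<epsilon>) = code_instance P \<epsilon>"
  unfolding inst_of_def bp_data_def code_instance_def code_bp_def code_Pair code_map
  by (simp add: code_nat_inst code_bool_inst)

text \<open>Identity steps pad the path to a power of two. The bound on \<open>u\<close> confines
  them to nodes that the available bits can name, as \<open>bsem_core\<close> demands.\<close>

definition entry :: "branching_program \<Rightarrow> bits \<Rightarrow> nat \<Rightarrow> nat \<Rightarrow> nat \<Rightarrow> bool" where
  "entry P x i u v = (if i < bp_length P - 1 then (i, u, x ! bp_label P i, v) \<in> bp_edges P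
     else u = v \<and> u < 2 ^ floorlog 2 (bp_width P))"

definition entry_at :: "branching_program \<Rightarrow> bits \<Rightarrow> bool list \<Rightarrow> bool" where
  "entry_at P x y = (let K = floorlog 2 (bp_length P); L = floorlog 2 (bp_width P) in
     entry P x (bin (take K y)) (bin (take L (drop K y))) (bin (take L (drop (K + L) y))))"

lemma less_power_floorlog: "n < 2 ^ floorlog 2 n"
  using floorlog_bounds[of n 2] by (cases "n = 0") auto

lemma inst_of_simps:
  "fst (fst (inst_of P \<epsilon>)) = bp_vars P" "fst (snd (fst (inst_of P \<epsilon>))) = bp_length P"
  "fst (snd (snd (fst (inst_of P \<epsilon>)))) = bp_width P"
  "inst_K (inst_of P \<epsilon>) = floorlog 2 (bp_length P)" "inst_L (inst_of P \<epsilon>) = floorlog 2 (bp_width P)"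
  by (simp_all add: inst_of_def bp_data_def inst_K_def inst_L_def)

text \<open>Each layer has exactly one owner: the party holding its variable, or Alice for the
  padding. So the other summand is 0, and by linearity of \<open>mle\<close> the two shares of the
  extension add up.\<close>

lemma ent_sum:
  assumes "wf_bp P" "length x = bp_vars P" "length y = inst_M (inst_of P \<epsilon>)"
  shows "of_bool (ent (inst_of P \<epsilon>) 0 True (alice_part P x) y) +
     of_bool (ent (inst_of P \<epsilon>) (bp_vars P div 2) False (bob_part P x) y) = (of_bool (entry_at P x y) :: int)"
proof -
  let ?I = "inst_of P \<epsilon>"
  define K L where "K = floorlog 2 (bp_length P)" and "L = floorlog 2 (bp_width P)"
  have len: "length y = K + 3 * L" using assms(3) by (simp add: inst_M_def inst_of_simps K_def L_def)
  define cap where "cap = pow_floorlog (bp_length P) * pow_floorlog (bp_width P)"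
  have cap: "2 ^ K \<le> cap" "2 ^ L \<le> cap" by (simp_all add: cap_def pow_floorlog_def K_def L_def)
  define i u v where "i = bin (take K y)" and "u = bin (take L (drop K y))" and "v = bin (take L (drop (K + L) y))"
  have b: "i < 2 ^ K" "u < 2 ^ L" "v < 2 ^ L"
    unfolding i_def u_def v_def
    using bin_less[of "take K y"] bin_less[of "take L (drop K y)"] bin_less[of "take L (drop (K + L) y)"] len by auto
  have dec: "dec cap (take K y) = i" "dec cap (take L (drop K y)) = u" "dec cap (take L (drop (K + L) y)) = v"
    unfolding dec_eq_bin i_def[symmetric] u_def[symmetric] v_def[symmetric] using b cap by auto
  define row where "row i = map (\<lambda>u. map (\<lambda>v. ((i, u, False, v) \<in> bp_edges P, (i, u, True, v) \<in> bp_edges P))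
       [0..<bp_width P]) [0..<bp_width P]" for i
  have tab: "inst_table ?I = map (\<lambda>i. (bp_label P i, row i)) [0..<bp_length P - 1]"
    by (simp add: inst_table_def inst_of_def bp_data_def row_def)
  have ent: "ent ?I off pad xs y = (if i < bp_length P - 1 then
       off \<le> bp_label P i \<and> bp_label P i < off + length xs \<and> (i, u, nth_default False xs (bp_label P i - off), v) \<in> bp_edges P
     else pad \<and> u = v)" for off pad xs
  proof -
    \<comment> \<open>Bit patterns can also name nodes from \<open>bp_width P\<close> on. No edge
      touches these, in agreement with the default entry of the table.\<close>
    have "u < bp_width P \<and> v < bp_width P" if "(i, u, c, v) \<in> bp_edges P" for c
      using assms(1) that unfolding wf_bp_def by auto
    then have "nth_default (False, False) (nth_default [] (row i) u) v = ((i, u, False, v) \<in> bp_edges P, (i, u, True, v) \<in> bp_edges P)"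
      by (auto simp: nth_default_def row_def)
    moreover have "nth_default (0, []) (inst_table ?I) i = (bp_label P i, row i)" if "i < bp_length P - 1"
      using that unfolding tab by (simp add: nth_default_nth)
    ultimately show ?thesis
      unfolding ent_def Let_def inst_of_simps K_def[symmetric] L_def[symmetric] cap_def[symmetric] dec
      by (simp add: tab)
  qed
  have at: "entry_at P x y = entry P x i u v"
    by (simp add: entry_at_def Let_def K_def L_def i_def u_def v_def)
  show ?thesis
  proof (cases "i < bp_length P - 1")
    case True
    then have lab: "bp_label P i < bp_vars P" using assms(1) unfolding wf_bp_def by auto
    have "nth_default False (alice_part P x) (bp_label P i) = x ! bp_label P i" if "bp_label P i < bp_vars P div 2"
      using that assms(2) by (simp add: alice_part_def nth_default_def)
    moreover have "nth_default False (bob_part P x) (bp_label P i - bp_vars P div 2) = x ! bp_label P i" if "bp_vars P div 2 \<le> bp_label P i"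
      using that assms(2) lab by (auto simp: bob_part_def nth_default_def)
    moreover have "length (alice_part P x) = bp_vars P div 2" "length (bob_part P x) = bp_vars P - bp_vars P div 2"
      using assms(2) by (auto simp: alice_part_def bob_part_def)
    ultimately show ?thesis
      unfolding at ent entry_def using True lab by (cases "bp_label P i < bp_vars P div 2") auto
  next
    case False
    then show ?thesis unfolding at ent entry_def using b L_def by auto
  qed
qed

lemma reach_iff_path:
  "reach A i n u v \<longleftrightarrow> (\<exists>p. length p = Suc n \<and> p ! 0 = u \<and> p ! n = v \<and> (\<forall>j<n. A (i + j) (p ! j) (p ! Suc j)))"
proof (induction n arbitrary: i u)
  case 0
  show ?case
  proof
    assume "reach A i 0 u v"
    then show "\<exists>p. length p = Suc 0 \<and> p ! 0 = u \<and> p ! 0 = v \<and> (\<forall>j<0. A (i + j) (p ! j) (p ! Suc j))"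
      by (intro exI[of _ "[u]"]) simp
  qed auto
next
  case (Suc n)
  show ?case
  proof
    assume "reach A i (Suc n) u v"
    then obtain w p where w: "A i u w" "length p = Suc n" "p ! 0 = w" "p ! n = v" "\<forall>j<n. A (Suc i + j) (p ! j) (p ! Suc j)"
      using Suc by auto
    then have "\<forall>j<Suc n. A (i + j) ((u # p) ! j) ((u # p) ! Suc j)" by (auto simp: less_Suc_eq_0_disj)
    then show "\<exists>p. length p = Suc (Suc n) \<and> p ! 0 = u \<and> p ! Suc n = v \<and> (\<forall>j<Suc n. A (i + j) (p ! j) (p ! Suc j))"
      using w by (intro exI[of _ "u # p"]) auto
  next
    assume "\<exists>p. length p = Suc (Suc n) \<and> p ! 0 = u \<and> p ! Suc n = v \<and> (\<forall>j<Suc n. A (i + j) (p ! j) (p ! Suc j))"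
    then obtain p where p: "length p = Suc (Suc n)" "p ! 0 = u" "p ! Suc n = v" "\<And>j. j < Suc n \<Longrightarrow> A (i + j) (p ! j) (p ! Suc j)"
      by blast
    have "reach A (Suc i) n (p ! 1) v"
      unfolding Suc.IH using p(1,3) p(4)[of "Suc j" for j] by (intro exI[of _ "tl p"]) (auto simp: nth_tl)
    moreover have "A i u (p ! 1)" using p(2) p(4)[of 0] by simp
    ultimately show "reach A i (Suc n) u v" by auto
  qed
qed

text \<open>All steps after the first \<open>bp_length P - 1\<close> are idle, so the padded path
  ends at node 0 exactly if its real part does.\<close>

lemma reach_entry_iff_accepts:
  assumes "wf_bp P"
  shows "reach (entry P x) 0 (2 ^ floorlog 2 (bp_length P)) 0 0 \<longleftrightarrow> bp_accepts P x"
proof -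
  let ?T = "bp_length P"
  have T: "1 \<le> ?T" using assms by (simp add: wf_bp_def)
  have idle: "reach (entry P x) i n u v \<longleftrightarrow> u = v" if "?T - 1 \<le> i" "u < 2 ^ floorlog 2 (bp_width P)" for i n u v
    using that by (induction n arbitrary: i) (auto simp: entry_def)
  have "?T - 1 \<le> 2 ^ floorlog 2 ?T" using less_power_floorlog[of ?T] by simp
  then obtain d where d: "2 ^ floorlog 2 ?T = (?T - 1) + d" using le_Suc_ex by blast
  have less: "v < 2 ^ floorlog 2 (bp_width P)" if "reach (entry P x) i n 0 v" for i n v
  proof -
    have "v < 2 ^ floorlog 2 (bp_width P)" if "reach (entry P x) i n u v" "u < 2 ^ floorlog 2 (bp_width P)" for u
      using that
    proof (induction n arbitrary: i u)
      case (Suc n)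
      then obtain w where w: "entry P x i u w" "reach (entry P x) (Suc i) n w v" by auto
      have "w < 2 ^ floorlog 2 (bp_width P)"
        using w(1) assms less_power_floorlog[of "bp_width P"] unfolding entry_def wf_bp_def
        by (auto split: if_splits intro: less_trans)
      then show ?case using Suc.IH w(2) by blast
    qed simp
    then show ?thesis using that by simp
  qed
  have "reach (entry P x) 0 (2 ^ floorlog 2 ?T) 0 0 \<longleftrightarrow> reach (entry P x) 0 (?T - 1) 0 0"
    unfolding d reach_add using idle[of "?T - 1"] less by auto
  also have "\<dots> \<longleftrightarrow> bp_accepts P x"
    unfolding reach_iff_path bp_accepts_def using T by (auto simp: entry_def less_diff_conv)
  finally show ?thesis .
qed

section \<open>Parameters of the protocol\<close>

lemma primes_from_to_iff: "p \<in> set (primes_from_to a b) \<longleftrightarrow> prime p \<and> a \<le> p \<and> p < b"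
proof -
  have "list_all (\<lambda>d. p mod d \<noteq> 0) [2..<p] \<longleftrightarrow> (\<forall>n\<in>{1<..<p}. \<not> n dvd p)"
    by (auto simp: list_all_iff dvd_eq_mod_eq_0 Suc_le_eq)
  then show ?thesis
    unfolding primes_from_to_def prime_nat_iff' by (auto simp: Suc_le_eq)
qed

lemma inst_q_props:
  assumes "20 \<le> inst_N I"
  shows "prime (Suc (inst_q I))" "2 ^ (2 * inst_h I) \<le> Suc (inst_q I)" "Suc (inst_q I) \<le> 2 ^ (5 * inst_h I)"
proof -
  define s where "s = pow_floorlog (2 * inst_N I)"
  have s: "s = 2 ^ inst_h I" by (simp add: s_def pow_floorlog_def inst_h_def)
  have "40 < s" using less_power_floorlog[of "2 * inst_N I"] assms by (simp add: s_def pow_floorlog_def)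
  \<comment> \<open>\<open>ex_prime_between\<close> at \<open>s * s\<close> yields a prime up to
    \<open>2 * s ^ 4\<close>, and the leading 2 is absorbed by a fifth factor
    \<open>s\<close>.\<close>
  then have "64 \<le> s * s" using mult_mono[of 40 s 40 s] by simp
  then obtain p where p: "prime p" "s * s < p" "p \<le> 2 * (s * s)\<^sup>2" using ex_prime_between by blast
  have "2 * (s * s)\<^sup>2 < s * (s * s)\<^sup>2" using \<open>40 < s\<close> by (intro mult_strict_right_mono) auto
  with p(3) have "p < s * (s * s)\<^sup>2" by (rule le_less_trans)
  then have "p < s * s * s * s * s" by (simp only: power2_eq_square mult.assoc)
  then have "p \<in> set (primes_from_to (Suc (s * s)) (s * s * s * s * s))"
    using p by (simp add: primes_from_to_iff)
  then obtain p' ps where pp: "primes_from_to (Suc (s * s)) (s * s * s * s * s) = p' # ps"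
    by (cases "primes_from_to (Suc (s * s)) (s * s * s * s * s)") auto
  then have p': "prime p'" "s * s < p'" "p' < s * s * s * s * s"
    using primes_from_to_iff[of p' "Suc (s * s)" "s * s * s * s * s"] by auto
  have "inst_q I = p' - 1" unfolding inst_q_def s_def[symmetric] Let_def pp by simp
  then have q: "Suc (inst_q I) = p'" using prime_gt_0_nat[OF p'(1)] by simp
  show "prime (Suc (inst_q I))" using p' q by simp
  have h: "2 * inst_h I = inst_h I + inst_h I" "5 * inst_h I = inst_h I + inst_h I + inst_h I + inst_h I + inst_h I"
    by simp_all
  have "2 ^ (2 * inst_h I) = s * s" "2 ^ (5 * inst_h I) = s * s * s * s * s"
    unfolding h s power_add by (rule refl)+
  then show "2 ^ (2 * inst_h I) \<le> Suc (inst_q I)" "Suc (inst_q I) \<le> 2 ^ (5 * inst_h I)" using p' q by auto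
qed

lemma floorlog_pos: "1 \<le> n \<Longrightarrow> 1 \<le> floorlog 2 n"
  using floorlog_eq_zero_iff[of 2 n] by linarith

text \<open>The number 20 is the value \<open>1 * 4 * 5\<close> at
  \<open>inst_K I = inst_L I = 1\<close>. It makes \<open>s\<close> large enough for the theorem on
  primes.\<close>

lemma inst_N_ge:
  assumes "1 \<le> inst_K I" "1 \<le> inst_L I" shows "20 \<le> inst_N I"
proof -
  have "1 * (3 * 1 + 1) * (1 + 3 * 1 + 1) \<le> inst_K I * (3 * inst_L I + 1) * (inst_K I + 3 * inst_L I + 1)"
    using assms by (intro mult_mono add_mono) auto
  then show ?thesis by (simp add: inst_N_def inst_M_def)
qed

lemma length_inst_body: "length (inst_body I) = inst_N I"
proof -
  have b: "length (block K L k) = 3 * L + 1" for K L k by (simp add: block_def)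
  have "length (concat (map (block K L) ks)) = length ks * (3 * L + 1)" for K L ks
    by (induction ks) (simp_all add: b)
  moreover have "length (linearize M os) = length os * (M + 1)" for M os
    by (induction os) (simp_all add: linearize_def)
  ultimately show ?thesis by (simp add: inst_body_def inst_N_def)
qed

lemma length_inst_ops: "length (inst_ops I) = inst_reps I * (inst_N I + 1)"
proof -
  have "length (reps n os) = n * (length os + 1)" for n os by (induction n) auto
  then show ?thesis by (simp add: inst_ops_def length_inst_body)
qed

lemma deg_ok_body:
  assumes "\<And>i. lin (inst_M I) g i" shows "deg_ok (inst_M I) g (inst_body I)"
proof -
  have "\<forall>x \<in> set (concat (map (block (inst_K I) (inst_L I)) [0..<inst_K I])). proper_op (inst_M I) x"
    by (auto simp: block_def inst_M_def)
  then show ?thesis unfolding inst_body_def using deg_ok_linearize assms by blast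
qed

definition ext :: "branching_program \<Rightarrow> bits \<Rightarrow> int list \<Rightarrow> int" where
  "ext P x = mle (\<lambda>y. of_bool (entry_at P x y))"

lemma wf_inst_N: "wf_bp P \<Longrightarrow> 20 \<le> inst_N (inst_of P \<epsilon>)"
  by (rule inst_N_ge; unfold inst_of_simps; rule floorlog_pos; simp add: wf_bp_def)

lemma game_inst:
  fixes \<epsilon> :: real
  assumes "wf_bp P" "length x = bp_vars P"
  defines "I \<equiv> inst_of P \<epsilon>"
  shows "game (inst_q I) (2 * inst_h I) (5 * inst_h I) (inst_M I) (ext P x) (base_value I (alice_part P x) (bob_part P x))"
proof
  note N = inst_q_props[OF wf_inst_N[OF assms(1)], of \<epsilon>, folded I_def]
  show "prime (Suc (inst_q I))" "2 ^ (2 * inst_h I) \<le> Suc (inst_q I)" "Suc (inst_q I) \<le> 2 ^ (5 * inst_h I)"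
    by (rule N)+
  show "pcong (int (Suc (inst_q I))) (inst_M I) (ext P x)" unfolding ext_def by (rule pcong_mle)
  show "base_value I (alice_part P x) (bob_part P x) r \<le> inst_q I" for r
    by (simp add: base_value_def less_Suc_eq_le[symmetric])
  fix r assume r: "length r = inst_M I" "\<forall>a \<in> set r. a \<le> inst_q I"
  let ?a = "party_eval I 0 True (alice_part P x) r" and ?b = "party_eval I (bp_vars P div 2) False (bob_part P x) r"
  have "[int ?a + int ?b = mle (\<lambda>y. of_bool (ent I 0 True (alice_part P x) y)) (map int r) +
      mle (\<lambda>y. of_bool (ent I (bp_vars P div 2) False (bob_part P x) y)) (map int r)] (mod int (Suc (inst_q I)))"
    by (intro cong_add party_eval_cong r)
  moreover have "mle (\<lambda>y. of_bool (ent I 0 True (alice_part P x) y)) (map int r) +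
      mle (\<lambda>y. of_bool (ent I (bp_vars P div 2) False (bob_part P x) y)) (map int r) = ext P x (map int r)"
    unfolding mle_add[symmetric] ext_def
    by (rule mle_cong) (use ent_sum[OF assms(1,2)] r in \<open>auto simp: I_def\<close>)
  moreover have "[int (base_value I (alice_part P x) (bob_part P x) r) = int ?a + int ?b] (mod int (Suc (inst_q I)))"
    unfolding base_value_def zmod_int cong_def by (simp add: I_def inst_of_simps del: of_nat_Suc)
  ultimately show "[int (base_value I (alice_part P x) (bob_part P x) r) = ext P x (map int r)] (mod int (Suc (inst_q I)))"
    using cong_trans by metis
qed

text \<open>The point 0 names layer 0 and the end nodes 0 and 0, so the initial claim is about paths
  from first node to first node. There \<open>sem\<close> is 0 or 1 as an integer, and these stay
  distinct modulo \<open>p\<close>.\<close>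

lemma claim_iff_accepts:
  fixes \<epsilon> :: real
  assumes "wf_bp P" "length x = bp_vars P"
  defines "I \<equiv> inst_of P \<epsilon>"
  shows "game.tru (inst_q I) (ext P x) 1 (replicate (inst_M I) 0) (inst_body I) \<longleftrightarrow> bp_accepts P x"
proof -
  interpret game "inst_q I" "2 * inst_h I" "5 * inst_h I" "inst_M I" "ext P x"
    "base_value I (alice_part P x) (bob_part P x)"
    unfolding I_def by (rule game_inst[OF assms(1,2)])
  let ?K = "inst_K I" and ?L = "inst_L I" and ?M = "inst_M I"
  have below: "\<forall>x \<in> set (inst_body I). op_below ?M x"
    by (rule deg_ok_below[OF deg_ok_body[of I "ext P x"]]) (simp add: ext_def lin_mle)
  have "sem (ext P x) (inst_body I) (map of_bool (replicate ?M False)) = of_bool (bsem (entry_at P x) (inst_body I) (replicate ?M False))"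
    by (rule sem_bool[OF _ below]) (simp_all add: ext_def mle_of_bool)
  moreover have "map of_bool (replicate ?M False) = map int (replicate ?M 0)" by simp
  moreover have "bsem (entry_at P x) (inst_body I) (replicate ?M False) \<longleftrightarrow> bp_accepts P x"
  proof -
    have KL: "?K = floorlog 2 (bp_length P)" "?L = floorlog 2 (bp_width P)" by (simp_all add: I_def inst_of_simps)
    have split: "replicate ?M False = replicate ?K False @ replicate ?L False @ replicate ?L False @ replicate ?L False"
      by (simp add: inst_M_def replicate_add[symmetric])
    have "bsem (entry_at P x) (inst_body I) (replicate ?M False) \<longleftrightarrow>
       bsem (entry_at P x) (concat (map (block ?K ?L) [0..<?K])) (replicate ?K False @ replicate ?L False @ replicate ?L False @ replicate ?L False)"
      unfolding inst_body_def bsem_linearize split ..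
    also have "\<dots> \<longleftrightarrow> reach (entry P x) (bin (take 0 (replicate ?K False) @ replicate (?K - 0) False)) (2 ^ (?K - 0))
        (bin (replicate ?L False)) (bin (replicate ?L False))"
    proof (rule bsem_core)
      show "v < 2 ^ ?L" if "entry P x i u v" for i u v
        using that assms(1) less_power_floorlog[of "bp_width P"] unfolding entry_def wf_bp_def KL
        by (auto split: if_splits intro: less_trans)
      show "entry_at P x (J @ s @ t @ w) = entry P x (bin J) (bin s) (bin t)"
        if "length J = ?K" "length s = ?L" "length t = ?L" "length w = ?L" for J s t w
        using that unfolding entry_at_def Let_def KL[symmetric] by simp
    qed auto
    also have "\<dots> \<longleftrightarrow> bp_accepts P x"
      using reach_entry_iff_accepts[OF assms(1)] KL by simp
    finally show ?thesis .
  qed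
  moreover have "1 < p" using prime_gt_1_nat[OF prime] by simp
  ultimately show ?thesis unfolding tru_def by (auto simp: cong_def simp del: of_nat_Suc)
qed

section \<open>The protocol\<close>

text \<open>Locates an operator within its repetition. Since \<open>deg_ok\<close> admits no
  \<open>Check\<close>, degrees are known only for the suffix up to the next
  \<open>Check\<close>.\<close>

lemma nth_reps:
  assumes "i < length (reps n os)"
  shows "reps n os ! i = Check \<or>
    (\<exists>pre suf rest. os = pre @ reps n os ! i # suf \<and> drop (Suc i) (reps n os) = suf @ Check # rest)"
  using assms
proof (induction n arbitrary: i)
  case (Suc n)
  consider "i < length os" | "i = length os" | "length os < i" by linarith
  then show ?case
  proof cases
    case 1
    then have "os = take i os @ os ! i # drop (Suc i) os" by (simp add: id_take_nth_drop)
    moreover have "reps (Suc n) os ! i = os ! i" using 1 by (simp add: nth_append)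
    moreover have "drop (Suc i) (reps (Suc n) os) = drop (Suc i) os @ Check # reps n os" using 1 by simp
    ultimately show ?thesis by metis
  next
    case 2
    then show ?thesis by simp
  next
    case 3
    then obtain j where j: "i = Suc (length os) + j" using less_iff_Suc_add by auto
    then have "reps (Suc n) os ! i = reps n os ! j" "drop (Suc i) (reps (Suc n) os) = drop (Suc j) (reps n os)"
      by (simp_all add: nth_append)
    then show ?thesis using Suc.IH[of j] Suc.prems j by simp
  qed
qed simp

text \<open>Merlin is unbounded, so \<open>SOME\<close> may pick his reply. The guard covers the
  round after the last operator, where only the length is prescribed.\<close>

definition honest :: "branching_program \<Rightarrow> real \<Rightarrow> bits \<Rightarrow> strategy" where
  "honest P \<epsilon> x tr c0 a = (let I = inst_of P \<epsilon>; ops = inst_ops I in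
     SOME w. length w = 15 * inst_h I \<and> (length tr < length ops \<longrightarrow>
       game.good_reply (inst_q I) (5 * inst_h I) (ext P x) (ops ! length tr) (drop (Suc (length tr)) ops)
         (game.point_after (inst_q I) (inst_M I) ops (coins_of tr c0)) w))"

lemma deg_ok_suffix: "deg_ok M g (xs @ ys) \<Longrightarrow> deg_ok M g ys"
  by (induction xs) auto

lemma honest_props:
  fixes \<epsilon> :: real
  assumes "wf_bp P" "length x = bp_vars P"
  defines "I \<equiv> inst_of P \<epsilon>"
  shows "length (honest P \<epsilon> x tr c0 a) = 15 * inst_h I \<and> (length tr < length (inst_ops I) \<longrightarrow>
    game.good_reply (inst_q I) (5 * inst_h I) (ext P x) (inst_ops I ! length tr) (drop (Suc (length tr)) (inst_ops I))
         (game.point_after (inst_q I) (inst_M I) (inst_ops I) (coins_of tr c0)) (honest P \<epsilon> x tr c0 a))"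
proof -
  interpret game "inst_q I" "2 * inst_h I" "5 * inst_h I" "inst_M I" "ext P x"
    "base_value I (alice_part P x) (bob_part P x)"
    unfolding I_def by (rule game_inst[OF assms(1,2)])
  have body: "deg_ok (inst_M I) (ext P x) (inst_body I)"
    by (rule deg_ok_body) (simp add: ext_def lin_mle)
  let ?ops = "inst_ops I" and ?r = "point_after (inst_ops I) (coins_of tr c0)"
  have "\<exists>w. length w = 15 * inst_h I \<and> (length tr < length ?ops \<longrightarrow>
     good_reply (?ops ! length tr) (drop (Suc (length tr)) ?ops) ?r w)"
  proof (cases "length tr < length ?ops")
    case True
    consider "?ops ! length tr = Check" | pre suf rest where "inst_body I = pre @ ?ops ! length tr # suf"
        "drop (Suc (length tr)) ?ops = suf @ Check # rest"
      using nth_reps[OF True[unfolded inst_ops_def]] unfolding inst_ops_def by blast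
    then show ?thesis
    proof cases
      case 1
      then show ?thesis using good_reply_exists[OF valid_point_after] by force
    next
      case 2
      have ok: "deg_ok (inst_M I) (ext P x) (?ops ! length tr # suf)" using body 2(1) deg_ok_suffix by metis
      then have "Check \<notin> set suf" using deg_ok_Check by force
      then have "good_reply (?ops ! length tr) (drop (Suc (length tr)) ?ops) ?r w \<longleftrightarrow> good_reply (?ops ! length tr) suf ?r w" for w
        unfolding 2(2) good_reply_def by (simp add: sem_append_Check)
      then show ?thesis using good_reply_exists[OF valid_point_after, of "?ops ! length tr" suf] ok by fastforce
    qed
  next
    case False
    then show ?thesis by (intro exI[of _ "replicate (15 * inst_h I) False"]) simp
  qed
  then show ?thesis
    unfolding honest_def Let_def I_def[symmetric] by (rule someI_ex)
qed

definition protocol :: "branching_program \<Rightarrow> real \<Rightarrow> ip_protocol" where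
  "protocol P \<epsilon> = \<lparr>ip_schedule = inst_schedule (inst_of P \<epsilon>), ip_alice = (\<lambda>_ _ _. []),
     ip_bob = bob (inst_of P \<epsilon>), ip_verdict = verdict (inst_of P \<epsilon>), ip_merlin = honest P \<epsilon>\<rparr>"

lemma poly_time_of_pt:
  assumes "pt f" "\<And>inp out. (inp, out) \<in> R \<Longrightarrow> \<exists>a. inp = code a \<and> out = code (f a)"
  shows "poly_time R"
proof -
  obtain c B where "pb B" "computes c f B" using ptE[OF assms(1)] by blast
  moreover from \<open>pb B\<close> obtain d where d: "\<And>a. B a \<le> d * (size (code a) + 1) ^ d" unfolding pb_def by blast
  ultimately have "\<exists>t. t \<le> d * (size (code a) + 1) ^ d \<and> runs c (code a) t (code (f a))" for a
    using computesD[of c f B "(\<lambda>_. Atom)(0 := code a)" a] d[of a] unfolding runs_def by (auto intro: order_trans)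
  then show ?thesis unfolding poly_time_def using assms(2) by (intro exI[of _ c] exI[of _ d]) fast
qed

lemma code_bits_eq: "code_bits bs = code bs"
  by (simp add: code_list_inst code_bool_inst[abs_def])

lemma code_transcript_eq: "code_transcript tr = code tr"
proof -
  have "(\<lambda>(c, a, w). Dot (code_bits c) (Dot (code_bits a) (code_bits w))) = code"
    by (auto simp: fun_eq_iff code_bits_eq)
  then show ?thesis by (simp add: code_transcript_def code_list_inst)
qed

lemma code_schedule_eq: "code_schedule sc = code sc"
proof -
  have "(\<lambda>(k, l). Dot (code_nat k) (code_nat l)) = code"
    by (auto simp: fun_eq_iff code_nat_inst)
  then show ?thesis by (simp add: code_schedule_def code_list_inst)
qed

lemma code_bits_list_eq: "code_list code_bits cs = code cs"
proof -
  have "code_bits = code" by (simp add: fun_eq_iff code_bits_eq)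
  then show ?thesis by (simp add: code_list_inst)
qed

lemma efficient_protocol: "efficient protocol"
  unfolding efficient_def code_bits_list_eq code_bits_eq code_transcript_eq code_schedule_eq
  unfolding code_inst_of[symmetric] code_bool_inst[symmetric] code_Pair[symmetric]
proof (intro conjI, goal_cases)
  case 1
  show ?case
    by (rule poly_time_of_pt[OF pt_inst_schedule[OF pt_ident]]) (auto simp: protocol_def simp del: code_Pair split_paired_Ex)
next
  case 2
  have "pt (\<lambda>_ :: inst \<times> bits \<times> transcript \<times> bits. [] :: bits)" by (rule pt_const)
  then show ?case
    by (rule poly_time_of_pt) (auto simp: protocol_def simp del: code_Pair split_paired_Ex)
next
  case 3
  have "pt (\<lambda>z. verdict (fst z) (fst (snd z)) (fst (snd (snd z))) (snd (snd (snd z))))" by (intro pt_intros)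
  then show ?case
    by (rule poly_time_of_pt) (auto simp: protocol_def simp del: code_Pair split_paired_Ex)
next
  case 4
  have "pt (\<lambda>z. bob (fst z) (fst (snd z)) (snd (snd z)))" by (intro pt_intros)
  then show ?case
    by (rule poly_time_of_pt) (auto simp: protocol_def simp del: code_Pair split_paired_Ex)
qed

section \<open>The bounds\<close>

lemma lg_ge_1: "1 \<le> lg z"
  by (simp add: lg_def)

lemma floorlog_le_log: "1 \<le> n \<Longrightarrow> real (floorlog 2 n) \<le> log 2 (real n) + 1"
  by (simp add: floorlog_def)

lemma floorlog_le_lg: "1 \<le> n \<Longrightarrow> real (floorlog 2 n) \<le> 2 * lg (real n)"
  using floorlog_le_log[of n] by (simp add: lg_def)

text \<open>The count is at most \<open>20 * (L\<^sup>2 * K\<^sup>2)\<close> since \<open>K\<close>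
  and \<open>L\<close> are at least 1. Passing from \<open>floorlog\<close> to \<open>lg\<close>
  doubles each of the four factors, whence \<open>320 = 20 * 16\<close>.\<close>

lemma inst_N_le:
  assumes "wf_bp P"
  shows "real (inst_N (inst_of P \<epsilon>)) \<le> 320 * ((lg (bp_width P))\<^sup>2 * (lg (bp_length P))\<^sup>2)"
proof -
  let ?K = "floorlog 2 (bp_length P)" and ?L = "floorlog 2 (bp_width P)"
  have 1: "1 \<le> bp_length P" "1 \<le> bp_width P" using assms by (auto simp: wf_bp_def)
  have KL: "1 \<le> ?K" "1 \<le> ?L" using 1 by (auto intro: floorlog_pos simp del: One_nat_def)
  have "?K * 1 + 3 * (1 * ?L) + 1 * 1 \<le> ?K * ?L + 3 * (?K * ?L) + ?K * ?L"
    using KL by (intro add_mono mult_mono) auto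
  then have "?K + 3 * ?L + 1 \<le> 5 * (?K * ?L)" by simp
  moreover have "3 * ?L + 1 \<le> 4 * ?L" using KL by simp
  ultimately have "inst_N (inst_of P \<epsilon>) \<le> ?K * (4 * ?L) * (5 * (?K * ?L))"
    unfolding inst_N_def inst_M_def inst_of_simps by (intro mult_mono) auto
  also have "\<dots> = 20 * (?L\<^sup>2 * ?K\<^sup>2)" by (simp add: power2_eq_square)
  finally have "real (inst_N (inst_of P \<epsilon>)) \<le> real (20 * (?L\<^sup>2 * ?K\<^sup>2))" by (simp only: of_nat_le_iff)
  also have "\<dots> = 20 * ((real ?L)\<^sup>2 * (real ?K)\<^sup>2)" by simp
  also have "\<dots> \<le> 20 * ((2 * lg (bp_width P))\<^sup>2 * (2 * lg (bp_length P))\<^sup>2)"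
    using floorlog_le_lg 1 by (intro mult_left_mono mult_mono power_mono) auto
  also have "\<dots> = 320 * ((lg (bp_width P))\<^sup>2 * (lg (bp_length P))\<^sup>2)" by (simp add: power2_eq_square)
  finally show ?thesis .
qed

lemma inst_h_le:
  assumes "wf_bp P"
  shows "real (inst_h (inst_of P \<epsilon>)) \<le> 6 * bob_bound (bp_width P) (bp_length P) \<epsilon>"
proof -
  let ?a = "lg (bp_width P)" and ?b = "lg (bp_length P)" and ?N = "inst_N (inst_of P \<epsilon>)"
  have N: "20 \<le> ?N" by (rule wf_inst_N[OF assms])
  have ab: "1 \<le> ?a" "1 \<le> ?b" by (rule lg_ge_1)+
  have "real (inst_h (inst_of P \<epsilon>)) \<le> log 2 (real (2 * ?N)) + 1"
    unfolding inst_h_def by (rule floorlog_le_log) (use N in simp)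
  \<comment> \<open>The constant \<open>2 * 320\<close> is rounded up to
    \<open>1024 = 2 ^ 10\<close>.\<close>
  also have "log 2 (real (2 * ?N)) \<le> log 2 (1024 * (?a\<^sup>2 * ?b\<^sup>2))"
  proof -
    have "0 \<le> ?a\<^sup>2 * ?b\<^sup>2" by simp
    then have "real (2 * ?N) \<le> 1024 * (?a\<^sup>2 * ?b\<^sup>2)"
      using inst_N_le[OF assms, of \<epsilon>] unfolding of_nat_mult of_nat_numeral by linarith
    then show ?thesis using N by (intro log_mono) auto
  qed
  also have "log 2 (1024 * (?a\<^sup>2 * ?b\<^sup>2)) = 10 + 2 * log 2 ?a + 2 * log 2 ?b"
  proof -
    have "log 2 (1024 :: real) = 10" using log_pow_cancel[of "2 :: real" 10] by simp
    then show ?thesis using ab by (simp add: log_mult log_nat_power)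
  qed
  finally have "real (inst_h (inst_of P \<epsilon>)) \<le> 11 + 2 * log 2 ?a + 2 * log 2 ?b" by simp
  also have "\<dots> \<le> 11 + 2 * lg ?a + 2 * lg ?b" by (simp add: lg_def)
  also have "\<dots> \<le> 6 * (lg ?a + lg ?b + lg (1 / \<epsilon>))"
  proof -
    have "11 + 2 * u + 2 * v \<le> 6 * (u + v + w)" if "1 \<le> u" "1 \<le> v" "1 \<le> w" for u v w :: real
      using that by simp
    then show ?thesis using lg_ge_1 by blast
  qed
  finally show ?thesis by (simp add: bob_bound_def)
qed

text \<open>Rounding the quotient costs only one further \<open>h\<close>, so the product is at most
  \<open>e + h\<close>. This keeps \<open>log 2 (1 / \<epsilon>)\<close> an additive term; 8 is 6
  for \<open>h\<close> plus 2 for the ceiling in \<open>e\<close>.\<close>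

lemma inst_reps_h_le:
  assumes "wf_bp P"
  shows "real (inst_reps (inst_of P \<epsilon>) * inst_h (inst_of P \<epsilon>)) \<le> 8 * bob_bound (bp_width P) (bp_length P) \<epsilon>"
proof -
  let ?I = "inst_of P \<epsilon>" and ?e = "nat \<lceil>log 2 (1 / \<epsilon>)\<rceil>"
  have "inst_reps ?I * inst_h ?I \<le> ?e + inst_h ?I"
    by (simp add: inst_reps_def inst_of_def)
  then have "real (inst_reps ?I * inst_h ?I) \<le> real (?e + inst_h ?I)" by (rule of_nat_mono)
  moreover have "real ?e \<le> 2 * lg (1 / \<epsilon>)"
    unfolding lg_def by linarith
  moreover have "lg (1 / \<epsilon>) \<le> bob_bound (bp_width P) (bp_length P) \<epsilon>"
    using lg_ge_1[of "lg (bp_width P)"] lg_ge_1[of "lg (bp_length P)"] unfolding bob_bound_def by linarith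
  ultimately show ?thesis using inst_h_le[OF assms, of \<epsilon>] by simp
qed

lemma bob_bound_nonneg: "0 \<le> bob_bound W T \<epsilon>"
  using lg_ge_1[of "lg W"] lg_ge_1[of "lg T"] lg_ge_1[of "1 / \<epsilon>"] unfolding bob_bound_def by linarith

lemma rounds_le:
  assumes "wf_bp P"
  shows "real (Suc (length (inst_ops (inst_of P \<epsilon>))) * (15 * inst_h (inst_of P \<epsilon>)))
    \<le> 100000 * alice_bound (bp_width P) (bp_length P) \<epsilon>"
proof -
  let ?I = "inst_of P \<epsilon>" and ?B = "bob_bound (bp_width P) (bp_length P) \<epsilon>"
  have "1 \<le> inst_reps ?I" "20 \<le> inst_N ?I" using wf_inst_N[OF assms] by (auto simp: inst_reps_def)
  then have "Suc (inst_reps ?I * (inst_N ?I + 1)) \<le> inst_reps ?I * (2 * inst_N ?I)"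
  proof -
    have "Suc (inst_reps ?I * (inst_N ?I + 1)) \<le> inst_reps ?I * (inst_N ?I + 1) + inst_reps ?I * 1"
      using \<open>1 \<le> inst_reps ?I\<close> by simp
    also have "\<dots> = inst_reps ?I * (inst_N ?I + 2)" by (simp add: algebra_simps)
    also have "\<dots> \<le> inst_reps ?I * (2 * inst_N ?I)" using \<open>20 \<le> inst_N ?I\<close> by (intro mult_left_mono) auto
    finally show ?thesis .
  qed
  then have "Suc (length (inst_ops ?I)) * (15 * inst_h ?I) \<le> inst_reps ?I * (2 * inst_N ?I) * (15 * inst_h ?I)"
    unfolding length_inst_ops by (rule mult_right_mono) simp
  also have "\<dots> = 30 * (inst_N ?I * (inst_reps ?I * inst_h ?I))" by simp
  finally have "real (Suc (length (inst_ops ?I)) * (15 * inst_h ?I)) \<le> real (30 * (inst_N ?I * (inst_reps ?I * inst_h ?I)))"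
    by (rule of_nat_mono)
  also have "\<dots> = 30 * (real (inst_N ?I) * real (inst_reps ?I * inst_h ?I))" by simp
  also have "\<dots> \<le> 30 * (320 * ((lg (bp_width P))\<^sup>2 * (lg (bp_length P))\<^sup>2) * (8 * ?B))"
    by (intro mult_left_mono mult_mono inst_N_le inst_reps_h_le assms) auto
  also have "\<dots> = 76800 * alice_bound (bp_width P) (bp_length P) \<epsilon>" by (simp add: alice_bound_def)
  also have "\<dots> \<le> 100000 * alice_bound (bp_width P) (bp_length P) \<epsilon>"
    by (intro mult_right_mono) (auto simp: alice_bound_def bob_bound_nonneg)
  finally show ?thesis .
qed

text \<open>One run errs with probability at most
  \<open>2 * N / 2 ^ (2 * h) \<le> 2 ^ h / 2 ^ (2 * h)\<close>, and the exponents \<open>h\<close>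
  of all repetitions add up to more than \<open>log 2 (1 / \<epsilon>)\<close>.\<close>

lemma error_le:
  assumes "wf_bp P" "\<epsilon> > 0"
  defines "I \<equiv> inst_of P \<epsilon>"
  shows "(real (inst_N I) * (2 / 2 ^ (2 * inst_h I))) ^ inst_reps I \<le> \<epsilon>"
proof -
  have h: "0 < inst_h I"
    using wf_inst_N[OF assms(1), of \<epsilon>] floorlog_pos[of "2 * inst_N I"] unfolding inst_h_def I_def by linarith
  have "2 * inst_N I < 2 ^ inst_h I" unfolding inst_h_def by (rule less_power_floorlog)
  then have "real (2 * inst_N I) \<le> real (2 ^ inst_h I)" by (simp only: of_nat_le_iff less_imp_le)
  then have "real (inst_N I) * (2 / 2 ^ (2 * inst_h I)) \<le> 2 ^ inst_h I / 2 ^ (2 * inst_h I)"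
    by (simp add: divide_right_mono)
  also have "\<dots> = (1 / 2) ^ inst_h I" by (simp add: mult_2 power_add power_divide)
  finally have "(real (inst_N I) * (2 / 2 ^ (2 * inst_h I))) ^ inst_reps I \<le> ((1 / 2) ^ inst_h I) ^ inst_reps I"
    by (intro power_mono) auto
  also have "\<dots> = (1 / 2) ^ (inst_h I * inst_reps I)" by (simp only: power_mult)
  also have "\<dots> = 2 powr (- real (inst_h I * inst_reps I))"
    by (simp only: powr_minus powr_realpow zero_less_numeral) (simp add: power_one_over inverse_eq_divide)
  also have "\<dots> \<le> 2 powr (log 2 \<epsilon>)"
  proof -
    let ?e = "nat \<lceil>log 2 (1 / \<epsilon>)\<rceil>"
    have "?e < inst_h I * inst_reps I"
      using dividend_less_times_div[OF h, of ?e] unfolding inst_reps_def by (simp add: I_def inst_of_def)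
    moreover have "log 2 (1 / \<epsilon>) \<le> real ?e" by linarith
    moreover have "log 2 (1 / \<epsilon>) = - log 2 \<epsilon>" using assms(2) by (simp add: log_divide)
    ultimately have "- log 2 \<epsilon> \<le> real (inst_h I * inst_reps I)" by linarith
    then show ?thesis by (intro powr_mono) auto
  qed
  also have "\<dots> = \<epsilon>" using assms(2) by simp
  finally show ?thesis .
qed

lemma exchanged_replies:
  assumes "\<And>tr c a. length tr < n \<Longrightarrow> length (m tr c a) = k" "length tr + length cs \<le> n"
  shows "exchanged_bits (replies m tr cs) = length cs * k"
  using assms(2)
proof (induction cs arbitrary: tr)
  case (Cons c cs)
  have "exchanged_bits (replies m (tr @ [(c, [], m tr c [])]) cs) = length cs * k"
    by (rule Cons.IH) (use Cons.prems in simp)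
  then show ?case using assms(1)[of tr] Cons.prems by (simp add: exchanged_bits_def)
qed (simp add: exchanged_bits_def)

lemma count_Check_reps:
  assumes "Check \<notin> set os"
  shows "length (filter (\<lambda>x. x = Check) (reps n os)) = n"
proof -
  have "filter (\<lambda>x. x = Check) os = []" using assms by (auto simp: filter_empty_conv)
  then show ?thesis by (induction n) simp_all
qed

lemma map_length_eq_replicate:
  "map length cs = replicate n k \<longleftrightarrow> length cs = n \<and> (\<forall>c \<in> set cs. length c = k)"
  by (induction cs arbitrary: n; case_tac n) auto

lemma protocol_simps:
  "ip_schedule (protocol P \<epsilon>) = inst_schedule (inst_of P \<epsilon>)" "ip_alice (protocol P \<epsilon>) xa tr c = []"
  "ip_bob (protocol P \<epsilon>) = bob (inst_of P \<epsilon>)" "ip_verdict (protocol P \<epsilon>) = verdict (inst_of P \<epsilon>)"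
  "ip_merlin (protocol P \<epsilon>) = honest P \<epsilon>"
  by (simp_all add: protocol_def)

lemma coin_space_protocol:
  "coin_space (protocol P \<epsilon>) = {cs. length cs = Suc (length (inst_ops (inst_of P \<epsilon>))) \<and>
     (\<forall>c \<in> set cs. length c = 2 * inst_h (inst_of P \<epsilon>))}"
  unfolding coin_space_def protocol_simps inst_schedule_def map_replicate map_length_eq_replicate by simp

lemma strategies_protocol:
  "m \<in> strategies (protocol P \<epsilon>) \<longleftrightarrow> (\<forall>tr c a. length tr < Suc (length (inst_ops (inst_of P \<epsilon>))) \<longrightarrow>
     length (m tr c a) = 15 * inst_h (inst_of P \<epsilon>))"
  unfolding strategies_def protocol_simps inst_schedule_def by (auto simp del: replicate.simps)

lemma accepts_protocol:
  assumes "wf_bp P" "length x = bp_vars P" "length cs = length (inst_ops (inst_of P \<epsilon>))"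
  defines "I \<equiv> inst_of P \<epsilon>"
  shows "alice_accepts (protocol P \<epsilon>) (alice_part P x) (bob_part P x) m (c0 # cs) \<longleftrightarrow>
    arun (inst_q I) (5 * inst_h I) (base_value I (alice_part P x) (bob_part P x)) m [] c0
      (True, 1, replicate (inst_M I) 0) (inst_ops I) cs"
proof -
  have "Suc (inst_q I) \<le> 2 ^ (5 * inst_h I)"
    unfolding I_def by (rule inst_q_props(3)[OF wf_inst_N[OF assms(1)]])
  then show ?thesis
    unfolding alice_accepts_def play_eq_replies[OF protocol_simps(2)] protocol_simps I_def[symmetric]
    using verdict_eq_arun assms(3) I_def by blast
qed

section \<open>Completeness, soundness and costs of the concrete protocol\<close>

lemma protocol_complete:
  assumes "wf_bp P" "length x = bp_vars P" "bp_accepts P x" "cs \<in> coin_space (protocol P \<epsilon>)"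
  shows "alice_accepts (protocol P \<epsilon>) (alice_part P x) (bob_part P x) (honest P \<epsilon> x) cs"
proof -
  define I where "I = inst_of P \<epsilon>"
  interpret game "inst_q I" "2 * inst_h I" "5 * inst_h I" "inst_M I" "ext P x"
    "base_value I (alice_part P x) (bob_part P x)"
    unfolding I_def by (rule game_inst[OF assms(1,2)])
  obtain c0 cs' where cs: "cs = c0 # cs'" "length cs' = length (inst_ops I)"
    using assms(4) unfolding coin_space_protocol I_def by (cases cs) auto
  have "run (honest P \<epsilon> x) [] c0 (True, 1, replicate (inst_M I) 0) (reps (inst_reps I) (inst_body I)) cs'"
  proof (rule complete_reps[where ops = "inst_ops I"])
    show "good_reply (inst_ops I ! length tr) (drop (Suc (length tr)) (inst_ops I))
        (point_after (inst_ops I) (coins_of tr c0)) (honest P \<epsilon> x tr c0 [])"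
      if "length tr < length (inst_ops I)" for tr c0
      using honest_props[OF assms(1,2), of \<epsilon> tr c0 "[]"] that unfolding I_def by blast
    show "deg_ok (inst_M I) (ext P x) (inst_body I)" by (rule deg_ok_body) (simp add: ext_def lin_mle)
    show "tru 1 (replicate (inst_M I) 0) (inst_body I)"
      using claim_iff_accepts[OF assms(1,2), of \<epsilon>] assms(3) unfolding I_def by blast
    show "point_after (inst_ops I) (coins_of [] c0) = replicate (inst_M I) 0"
      by (simp add: point_after_def coins_of_def)
  qed (use cs in \<open>simp_all add: inst_ops_def\<close>)
  then show ?thesis
    unfolding cs(1) using accepts_protocol[OF assms(1,2), of cs' \<epsilon>] cs(2) by (simp add: I_def inst_ops_def)
qed

lemma protocol_sound:
  assumes "wf_bp P" "length x = bp_vars P" "\<not> bp_accepts P x" "\<epsilon> > 0"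
  shows "measure_pmf.prob (pmf_of_set (coin_space (protocol P \<epsilon>)))
    {cs. \<not> alice_accepts (protocol P \<epsilon>) (alice_part P x) (bob_part P x) m cs} \<ge> 1 - \<epsilon>"
proof -
  define I where "I = inst_of P \<epsilon>"
  interpret game "inst_q I" "2 * inst_h I" "5 * inst_h I" "inst_M I" "ext P x"
    "base_value I (alice_part P x) (bob_part P x)"
    unfolding I_def by (rule game_inst[OF assms(1,2)])
  let ?n = "length (inst_ops I)"
  let ?acc = "alice_accepts (protocol P \<epsilon>) (alice_part P x) (bob_part P x) m"
  have space: "coin_space (protocol P \<epsilon>) = coinlists (Suc ?n)"
    unfolding coinlists_def coinset_def unfolding I_def coin_space_protocol by auto
  have "frac (Suc ?n) ?acc \<le> (real (inst_N I) * (2 / 2 ^ (2 * inst_h I))) ^ inst_reps I"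
  \<comment> \<open>The bound holds for each value \<open>c0\<close> of the coins of round 0, hence
    on average over them.\<close>
  proof (rule frac_Suc_le)
    fix c0
    have "frac ?n (run m [] c0 (True, 1, replicate (inst_M I) 0) (inst_ops I)) \<le> (real (length (inst_body I)) * (2 / 2 ^ (2 * inst_h I))) ^ inst_reps I"
      unfolding inst_ops_def
    proof (rule reps_frac)
      show "deg_ok (inst_M I) (ext P x) (inst_body I)" by (rule deg_ok_body) (simp add: ext_def lin_mle)
      show "\<not> tru 1 (replicate (inst_M I) 0) (inst_body I)"
        using claim_iff_accepts[OF assms(1,2), of \<epsilon>] assms(3) unfolding I_def by blast
    qed
    moreover have "frac ?n (\<lambda>cs. ?acc (c0 # cs)) = frac ?n (run m [] c0 (True, 1, replicate (inst_M I) 0) (inst_ops I))"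
    proof -
      have "{cs \<in> coinlists ?n. ?acc (c0 # cs)} = {cs \<in> coinlists ?n. run m [] c0 (True, 1, replicate (inst_M I) 0) (inst_ops I) cs}"
        unfolding coinlists_def using accepts_protocol[OF assms(1,2), of _ \<epsilon>] unfolding I_def by blast
      then show ?thesis by (simp add: frac_def)
    qed
    ultimately show "frac ?n (\<lambda>cs. ?acc (c0 # cs)) \<le> (real (inst_N I) * (2 / 2 ^ (2 * inst_h I))) ^ inst_reps I"
      by (simp add: length_inst_body)
  qed
  also have "\<dots> \<le> \<epsilon>" unfolding I_def by (rule error_le[OF assms(1,4)])
  finally have acc: "frac (Suc ?n) ?acc \<le> \<epsilon>" .
  let ?S = "coinlists (Suc ?n)"
  have card: "real (card ?S) = (2 ^ (2 * inst_h I)) ^ Suc ?n" by (simp add: card_coinlists)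
  have pos: "card ?S > 0" by (simp add: card_coinlists)
  then have ne: "?S \<noteq> {}" by auto
  have "card (?S \<inter> {cs. \<not> ?acc cs}) = card ?S - card {cs \<in> ?S. ?acc cs}"
  proof -
    have "?S \<inter> {cs. \<not> ?acc cs} = ?S - {cs \<in> ?S. ?acc cs}" by auto
    moreover have "finite {cs \<in> ?S. ?acc cs}" by (rule finite_subset[OF _ finite_coinlists]) auto
    ultimately show ?thesis by (simp add: card_Diff_subset)
  qed
  moreover have "card {cs \<in> ?S. ?acc cs} \<le> card ?S" by (intro card_mono finite_coinlists) auto
  ultimately have "real (card (?S \<inter> {cs. \<not> ?acc cs})) / real (card ?S) = 1 - frac (Suc ?n) ?acc"
    using pos unfolding frac_def card[symmetric] by (simp add: of_nat_diff diff_divide_distrib)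
  then show ?thesis
    unfolding space measure_pmf_of_set[OF ne finite_coinlists] using acc by simp
qed

text \<open>One constant serves all the bounds: the exchange with Merlin needs
  \<open>30 * 320 * 8 = 76800\<close>, the coins need less, and Bob's message needs
  \<open>5 * 8 = 40\<close>.\<close>

theorem theorem5p5:
  shows "\<exists>(C::real) (F :: branching_program \<Rightarrow> real \<Rightarrow> ip_protocol).
    efficient F \<and>
    (\<forall>P \<epsilon> n T W \<pi>. wf_bp P \<and> bp_vars P = n \<and> bp_length P = T \<and> bp_width P = W \<and>
        \<epsilon> > 0 \<and> \<pi> = F P \<epsilon> \<longrightarrow>
      (\<forall>x m cs. length x = n \<and> m \<in> strategies \<pi> \<and> cs \<in> coin_space \<pi> \<longrightarrow>
         real (exchanged_bits (play \<pi> (alice_part P x) m cs)) \<le> C * alice_bound W T \<epsilon>) \<and>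
      real (coin_count \<pi>) \<le> C * alice_bound W T \<epsilon> \<and>
      (\<forall>x cs. length x = n \<and> cs \<in> coin_space \<pi> \<longrightarrow>
         real (length (ip_bob \<pi> (bob_part P x) cs)) \<le> C * bob_bound W T \<epsilon>) \<and>
      (\<forall>x. length x = n \<longrightarrow>
         ip_merlin \<pi> x \<in> strategies \<pi> \<and>
         (bp_accepts P x \<longrightarrow>
           (\<forall>cs \<in> coin_space \<pi>.
              alice_accepts \<pi> (alice_part P x) (bob_part P x) (ip_merlin \<pi> x) cs)) \<and>
         (\<not> bp_accepts P x \<longrightarrow>
           (\<forall>m \<in> strategies \<pi>.
              measure_pmf.prob (pmf_of_set (coin_space \<pi>))
                {cs. \<not> alice_accepts \<pi> (alice_part P x) (bob_part P x) m cs} \<ge> 1 - \<epsilon>))))"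
proof (intro exI conjI allI impI; (elim conjE)?)
  fix P \<epsilon> n T W \<pi>
  assume wf: "wf_bp P" and [symmetric, simp]: "bp_vars P = n" "bp_length P = T" "bp_width P = W" and \<epsilon>: "0 < \<epsilon>"
    and \<pi>: "\<pi> = protocol P \<epsilon>"
  let ?I = "inst_of P \<epsilon>"
  show "real (exchanged_bits (play \<pi> (alice_part P x) m cs)) \<le> 100000 * alice_bound W T \<epsilon>"
    if "m \<in> strategies \<pi>" "cs \<in> coin_space \<pi>" for x m cs
  proof -
    have cs: "length cs = Suc (length (inst_ops ?I))" using that(2) unfolding \<pi> coin_space_protocol by blast
    have "exchanged_bits (play \<pi> (alice_part P x) m cs) = length cs * (15 * inst_h ?I)"
      unfolding \<pi> play_eq_replies[OF protocol_simps(2)]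
      by (rule exchanged_replies[where n = "Suc (length (inst_ops ?I))"])
        (use that(1) cs in \<open>auto simp: \<pi> strategies_protocol\<close>)
    then show ?thesis using rounds_le[OF wf, of \<epsilon>] cs by simp
  qed
  show "real (coin_count \<pi>) \<le> 100000 * alice_bound W T \<epsilon>"
  proof -
    have "coin_count \<pi> = Suc (length (inst_ops ?I)) * (2 * inst_h ?I)"
      unfolding \<pi> coin_count_def protocol_simps inst_schedule_def map_replicate sum_list_replicate by simp
    also have "\<dots> \<le> Suc (length (inst_ops ?I)) * (15 * inst_h ?I)" by (intro mult_left_mono) auto
    finally have "real (coin_count \<pi>) \<le> real (Suc (length (inst_ops ?I)) * (15 * inst_h ?I))" by (rule of_nat_mono)
    then show ?thesis using rounds_le[OF wf, of \<epsilon>] by simp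
  qed
  show "real (length (ip_bob \<pi> (bob_part P x) cs)) \<le> 100000 * bob_bound W T \<epsilon>" if "cs \<in> coin_space \<pi>" for x cs
  proof -
    have cs: "length cs = Suc (length (inst_ops ?I))" using that unfolding \<pi> coin_space_protocol by blast
    have "Check \<notin> set (inst_body ?I)"
      by (rule deg_ok_Check[OF deg_ok_body[OF lin_mle]])
    then have "length (filter (\<lambda>x. x = Check) (inst_ops ?I)) = inst_reps ?I"
      unfolding inst_ops_def by (rule count_Check_reps)
    then have "length (ip_bob \<pi> (bob_part P x) cs) = 5 * (inst_reps ?I * inst_h ?I)"
      unfolding \<pi> protocol_simps bob_eq_bob_run using cs by (subst length_bob_run) auto
    then have "real (length (ip_bob \<pi> (bob_part P x) cs)) = 5 * real (inst_reps ?I * inst_h ?I)"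
      by (simp only: of_nat_mult of_nat_numeral)
    then have "real (length (ip_bob \<pi> (bob_part P x) cs)) \<le> 100000 * bob_bound (bp_width P) (bp_length P) \<epsilon>"
      using inst_reps_h_le[OF wf, of \<epsilon>] bob_bound_nonneg[of "bp_width P" "bp_length P" \<epsilon>] by linarith
    then show ?thesis by simp
  qed
  show "ip_merlin \<pi> x \<in> strategies \<pi>" if "length x = n" for x
    unfolding \<pi> strategies_protocol protocol_simps using honest_props[OF wf] that by simp
  show "\<forall>cs \<in> coin_space \<pi>. alice_accepts \<pi> (alice_part P x) (bob_part P x) (ip_merlin \<pi> x) cs"
    if "length x = n" "bp_accepts P x" for x
    unfolding \<pi> protocol_simps using protocol_complete[OF wf] that by simp
  show "\<forall>m \<in> strategies \<pi>. measure_pmf.prob (pmf_of_set (coin_space \<pi>))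
      {cs. \<not> alice_accepts \<pi> (alice_part P x) (bob_part P x) m cs} \<ge> 1 - \<epsilon>"
    if "length x = n" "\<not> bp_accepts P x" for x
    unfolding \<pi> using protocol_sound[OF wf _ that(2) \<epsilon>] that by simp
qed (rule efficient_protocol)

end
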